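(* Let $\mathcal P=\langle S\mid r_1,r_2,\dots\rangle$ be a $C'(\frac1{24})$ presentation. For any distinct elements $[X^1],[X^2]\in\mathcal{TC}(\mathcal P)$ such that $[X^1]\preceq[X^2]$, there is an embedding of posets $\phi:\mathcal P(\omega)/Fin\hookrightarrow\mathcal{TC}(\mathcal P)$ such that for each $[A]\in\mathcal P(\omega)/Fin$, $$\phi([\emptyset])=[X^1]\preceq\phi([A])\preceq[X^2]=\phi([\mathbb N]).$$
   Context: Small cancellation. $S$ is a set (not necessarily finite), $F(S)$ the free group on $S$, $R=\{r_1,r_2,\dots\}\subset F(S)$ a (finite or countably infinite) set of cyclically reduced words, and $G=F(S)/\langle\!\langle R\rangle\!\rangle$. It is assumed that every $s\in S$ appears in some $r_i$. Let $\overline R$ be the set of all reduced cyclic conjugates of the $r_i$ and of their inverses. A word $u$ is an initial subword of $r$ if $r=ut$ with $|r|_S=|u|_S+|t|_S$. A piece is a word which is an initial subword of at least two distinct elements of $\overline R$. $\mathcal P$ is $C'(\lambda)$ if $|u|_S<\lambda|r|_S$ whenever a piece $u$ is an initial subword of $r\in\overline R$. Generating sets. For generating sets $X,Y$ of $G$ (possibly infinite; lengths $|\cdot|_X$ with respect to $X\cup X^{-1}$), $X\preceq Y$ means $\sup_{y\in Y}|y|_X<\infty$; $[X]$ is the class of $X$ for the equivalence relation ($X\preceq Y$ and $Y\preceq X$), and $\preceq$ induces a partial order on classes. Thin cones. $L\subset F(S)$ is the union of $S$ and the set of all initial subwords of elements of $\overline R$. $P^4$ is the set of words in $L$ which are a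 product of at most 4 pieces. For each $i$ let $C_i$ be an oriented cycle of length $|r_i|_S$ labelled by $r_i$. For $S\cup P^4\subseteq X\subseteq L$ let $X_i$ be the set of elements of $X$ which are subwords of cyclic conjugates of $r_i^{\pm1}$, and let $C_i^X$ be obtained from $C_i$ by adding, for each $x\in X_i^{\pm1}$, an edge between the initial and terminal vertices of every subpath of $C_i$ labelled by $x$. $\mathcal{TC}(\mathcal P)$ is the set of classes $[X]$ of generating sets of $G$ having a representative (the image in $G$ of) $X$ with $S\cup P^4\subseteq X\subseteq L$ such that there is $\delta\ge0$ for which every $C_i^X$ is $\delta$-hyperbolic; it is ordered by $\preceq$. $\mathcal P(\omega)/Fin$ is the poset of equivalence classes of subsets of $\mathbb N$, where $A,B$ are equivalent if $|A\triangle B|<\infty$, and $[A]\le[B]$ if $|A\setminus B|<\infty$. An embedding of posets is a map $\phi$ with $a\le b$ if and only if $\phi(a)\preceq\phi(b)$. *)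

theory Defs
  imports
    Complex_Main
    "HOL-Library.Sublist"
    "HOL-Library.Countable_Set"
    "HOL-Algebra.Coset"
    "HOL-Algebra.Generated_Groups"
begin

section \<open>Free groups\<close>

text \<open>The letter \<open>(s, True)\<close> is the generator \<open>s\<close>, and \<open>(s, False)\<close> is its inverse.
  An element of the free group is represented by its unique reduced word, so its length over the
  basis is the length of the list.\<close>

type_synonym 'a letter = "'a \<times> bool"
type_synonym 'a word = "'a letter list"

fun flip :: "'a letter \<Rightarrow> 'a letter" where
  "flip (s, b) = (s, \<not> b)"

definition reduced :: "'a word \<Rightarrow> bool" where
  "reduced = successively (\<lambda>x y. y \<noteq> flip x)"

fun push :: "'a letter \<Rightarrow> 'a word \<Rightarrow> 'a word" where
  "push x [] = [x]"
| "push x (y # w) = (if y = flip x then w else x # y # w)"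

definition reduce :: "'a word \<Rightarrow> 'a word" where
  "reduce w = foldr push w []"

definition word_inv :: "'a word \<Rightarrow> 'a word" where
  "word_inv w = rev (map flip w)"

definition free_group :: "'a set \<Rightarrow> 'a word monoid" where
  "free_group S =
    \<lparr>carrier = {w. reduced w \<and> fst ` set w \<subseteq> S},
     mult = (\<lambda>u v. reduce (u @ v)),
     one = []\<rparr>"

lemma flip_flip [simp]: "flip (flip x) = x"
  by (cases x) auto

lemma fst_flip [simp]: "fst (flip x) = fst x"
  by (cases x) auto

lemma flip_eq_iff [simp]: "flip x = flip y \<longleftrightarrow> x = y"
  by (metis flip_flip)

lemma reduced_Nil [simp]: "reduced []"
  by (simp add: reduced_def)

lemma reduced_Cons: "reduced (x # w) \<longleftrightarrow> (w = [] \<or> hd w \<noteq> flip x) \<and> reduced w"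
  by (cases w) (auto simp: reduced_def)

lemma reduced_push: "reduced w \<Longrightarrow> reduced (push x w)"
  by (cases w) (auto simp: reduced_Cons)

lemma push_flip: "reduced w \<Longrightarrow> push x (push (flip x) w) = w"
proof (cases w)
  case (Cons y ys)
  assume "reduced w"
  with Cons show ?thesis by (cases ys) (auto simp: reduced_Cons)
qed simp

lemma reduced_foldr_push: "reduced v \<Longrightarrow> reduced (foldr push u v)"
  by (induction u) (auto simp: reduced_push)

lemma reduced_reduce: "reduced (reduce w)"
  by (simp add: reduce_def reduced_foldr_push)

lemma reduce_reduced: "reduced w \<Longrightarrow> reduce w = w"
proof (induction w)
  case (Cons x w)
  then show ?case by (cases w) (auto simp: reduce_def reduced_Cons)
qed (simp add: reduce_def)

lemma foldr_push_push:
  assumes "reduced v"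
  shows "foldr push (push x w) v = push x (foldr push w v)"
proof (cases w)
  case (Cons y ys)
  then show ?thesis
    using push_flip [OF reduced_foldr_push [OF assms], of x ys] by auto
qed simp

lemma foldr_push_reduce: "reduced v \<Longrightarrow> foldr push (reduce u) v = foldr push u v"
  by (induction u) (auto simp: reduce_def foldr_push_push)

lemma reduce_append: "reduce (u @ v) = foldr push u (reduce v)"
  by (simp add: reduce_def)

lemma reduce_reduce_append [simp]: "reduce (reduce u @ v) = reduce (u @ v)"
  by (simp add: reduce_append foldr_push_reduce reduced_reduce)

lemma reduce_append_reduce [simp]: "reduce (u @ reduce v) = reduce (u @ v)"
  by (simp add: reduce_append reduce_reduced reduced_reduce)

lemma set_push: "set (push x w) \<subseteq> insert x (set w)"
  by (cases w) auto

lemma set_reduce: "set (reduce w) \<subseteq> set w"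
proof (induction w)
  case (Cons x w)
  then show ?case using set_push [of x "reduce w"] by (auto simp: reduce_def)
qed (simp add: reduce_def)

lemma reduced_append:
  "reduced (u @ v) \<longleftrightarrow> reduced u \<and> reduced v \<and> (u = [] \<or> v = [] \<or> hd v \<noteq> flip (last u))"
  by (auto simp: reduced_def successively_append_iff)

lemma reduced_word_inv: "reduced w \<Longrightarrow> reduced (word_inv w)"
proof (induction w)
  case (Cons x w)
  then show ?case
    by (cases w) (auto simp: word_inv_def reduced_append reduced_Cons)
qed (simp add: word_inv_def)

lemma reduce_word_inv: "reduce (word_inv w @ w) = []"
proof (induction w)
  case (Cons x w)
  have "reduce (word_inv (x # w) @ x # w) = foldr push (word_inv w) (push (flip x) (push x (reduce w)))"
    by (simp add: word_inv_def reduce_def)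
  also have "push (flip x) (push x (reduce w)) = reduce w"
    using push_flip [OF reduced_reduce, of "flip x" w] by simp
  finally show ?case using Cons by (simp add: reduce_append)
qed (simp add: reduce_def word_inv_def)

lemma word_inv_closed:
  "w \<in> carrier (free_group S) \<Longrightarrow> word_inv w \<in> carrier (free_group S)"
  by (simp add: free_group_def reduced_word_inv) (simp add: word_inv_def image_image)

lemma group_free_group: "group (free_group S)"
proof (rule groupI)
  fix u v assume "u \<in> carrier (free_group S)" "v \<in> carrier (free_group S)"
  then show "u \<otimes>\<^bsub>free_group S\<^esub> v \<in> carrier (free_group S)"
    using order_trans [OF image_mono [OF set_reduce [of "u @ v"], of fst]]
    by (simp add: free_group_def reduced_reduce image_Un)
next
  fix u assume u: "u \<in> carrier (free_group S)"
  then show "\<exists>v\<in>carrier (free_group S). v \<otimes>\<^bsub>free_group S\<^esub> u = \<one>\<^bsub>free_group S\<^esub>"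
    using word_inv_closed [OF u] reduce_word_inv [of u]
    by (intro bexI [of _ "word_inv u"]) (simp_all add: free_group_def)
qed (auto simp: free_group_def reduce_reduced)

lemma inv_free_group:
  "w \<in> carrier (free_group S) \<Longrightarrow> inv\<^bsub>free_group S\<^esub> w = word_inv w"
  by (rule group.inv_equality [OF group_free_group])
    (simp_all add: word_inv_closed, simp add: free_group_def reduce_word_inv)

lemma length_push: "length (push x w) \<le> Suc (length w)"
  by (cases w) auto

lemma length_reduce: "length (reduce w) \<le> length w"
proof (induction w)
  case (Cons x w)
  then show ?case using length_push [of x "reduce w"] by (auto simp: reduce_def)
qed (simp add: reduce_def)

lemma reduce_eq_self: "length (reduce w) = length w \<Longrightarrow> reduce w = w"
proof (induction w)
  case (Cons x w)
  have *: "reduce (x # w) = push x (reduce w)" by (simp add: reduce_def)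
  with Cons.prems have "length (push x (reduce w)) = Suc (length w)" by simp
  with length_push [of x "reduce w"] length_reduce [of w]
  have "length (reduce w) = length w" by linarith
  with Cons.IH have w: "reduce w = w" by blast
  with * Cons.prems show ?case by (cases w) (auto split: if_splits)
qed (simp add: reduce_def)

text \<open>Initial subwords, i.e. \<open>r = u t\<close> in the free group with additive lengths, are
  exactly list prefixes.\<close>

lemma initial_subword_iff_prefix:
  assumes "r \<in> carrier (free_group S)" "u \<in> carrier (free_group S)"
  shows "(\<exists>t\<in>carrier (free_group S). r = u \<otimes>\<^bsub>free_group S\<^esub> t \<and> length r = length u + length t)
    \<longleftrightarrow> prefix u r"
proof
  assume "\<exists>t\<in>carrier (free_group S). r = u \<otimes>\<^bsub>free_group S\<^esub> t \<and> length r = length u + length t"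
  then obtain t where "r = reduce (u @ t)" "length r = length (u @ t)"
    by (auto simp: free_group_def)
  then have "r = u @ t" using reduce_eq_self [of "u @ t"] by simp
  then show "prefix u r" by simp
next
  assume "prefix u r"
  then obtain t where t: "r = u @ t" by (auto simp: prefix_def)
  with assms have "t \<in> carrier (free_group S)" "r = reduce (u @ t)"
    by (auto simp: free_group_def reduced_append reduce_reduced)
  with t show "\<exists>t\<in>carrier (free_group S). r = u \<otimes>\<^bsub>free_group S\<^esub> t \<and> length r = length u + length t"
    by (auto simp: free_group_def)
qed


section \<open>Presentations and small cancellation\<close>

definition cyclically_reduced :: "'a word \<Rightarrow> bool" where
  "cyclically_reduced w \<longleftrightarrow> reduced w \<and> (w \<noteq> [] \<longrightarrow> hd w \<noteq> flip (last w))"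

definition presentation :: "'a set \<Rightarrow> 'a word set \<Rightarrow> bool" where
  "presentation S R \<longleftrightarrow>
     countable R \<and> R \<subseteq> carrier (free_group S) \<and> (\<forall>r\<in>R. cyclically_reduced r) \<and>
     (\<forall>s\<in>S. \<exists>r\<in>R. s \<in> fst ` set r)"

definition normal_closure :: "('g, 'm) monoid_scheme \<Rightarrow> 'g set \<Rightarrow> 'g set" where
  "normal_closure G A = \<Inter>{N. N \<lhd> G \<and> A \<subseteq> N}"

lemma normal_normal_closure:
  fixes G (structure)
  assumes "group G" "A \<subseteq> carrier G"
  shows "normal_closure G A \<lhd> G"
proof -
  interpret group G by fact
  have car: "carrier G \<in> {N. N \<lhd> G \<and> A \<subseteq> N}"
    using assms by (auto simp: normal_inv_iff subgroup_self)
  have "subgroup (\<Inter>{N. N \<lhd> G \<and> A \<subseteq> N}) G"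
    using car by (intro subgroups_Inter) (auto simp: normal_imp_subgroup)
  moreover have "x \<otimes> h \<otimes> inv x \<in> \<Inter>{N. N \<lhd> G \<and> A \<subseteq> N}"
    if "x \<in> carrier G" "h \<in> \<Inter>{N. N \<lhd> G \<and> A \<subseteq> N}" for x h
    using that by (auto intro: normal.inv_op_closed2)
  ultimately show ?thesis
    unfolding normal_closure_def normal_inv_iff by simp
qed

definition presented_group :: "'a set \<Rightarrow> 'a word set \<Rightarrow> 'a word set monoid" where
  "presented_group S R = free_group S Mod normal_closure (free_group S) R"

definition image_in_group :: "'a set \<Rightarrow> 'a word set \<Rightarrow> 'a word set \<Rightarrow> 'a word set set" where
  "image_in_group S R X = (\<lambda>w. normal_closure (free_group S) R #>\<^bsub>free_group S\<^esub> w) ` X"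

text \<open>Every cyclic permutation of a cyclically reduced word is reduced, so the reduced cyclic
  conjugates of such a word are its rotations.\<close>

definition cyclic_conjugates :: "'a word \<Rightarrow> 'a word set" where
  "cyclic_conjugates r = range (\<lambda>k. rotate k r)"

definition symmetrized :: "'a word set \<Rightarrow> 'a word set" where
  "symmetrized R = (\<Union>r\<in>R. cyclic_conjugates r \<union> cyclic_conjugates (word_inv r))"

definition is_piece :: "'a word set \<Rightarrow> 'a word \<Rightarrow> bool" where
  "is_piece R u \<longleftrightarrow>
     (\<exists>r\<in>symmetrized R. \<exists>r'\<in>symmetrized R. r \<noteq> r' \<and> prefix u r \<and> prefix u r')"

definition small_cancellation :: "real \<Rightarrow> 'a word set \<Rightarrow> bool" where
  "small_cancellation lam R \<longleftrightarrow>
     (\<forall>u. \<forall>r\<in>symmetrized R. is_piece R u \<and> prefix u r \<longrightarrow>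
        real (length u) < lam * real (length r))"


section \<open>Generating sets up to bounded change\<close>

definition generating_set :: "('g, 'm) monoid_scheme \<Rightarrow> 'g set \<Rightarrow> bool" where
  "generating_set G X \<longleftrightarrow> X \<subseteq> carrier G \<and> generate G X = carrier G"

definition word_length :: "('g, 'm) monoid_scheme \<Rightarrow> 'g set \<Rightarrow> 'g \<Rightarrow> nat" where
  "word_length G X g =
     (LEAST n. \<exists>xs. length xs = n \<and> set xs \<subseteq> X \<union> m_inv G ` X \<and> g = foldr (mult G) xs (one G))"

definition gens_le :: "('g, 'm) monoid_scheme \<Rightarrow> 'g set \<Rightarrow> 'g set \<Rightarrow> bool" where
  "gens_le G X Y \<longleftrightarrow> bdd_above (word_length G X ` Y)"

definition gens_equiv :: "('g, 'm) monoid_scheme \<Rightarrow> ('g set \<times> 'g set) set" where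
  "gens_equiv G =
     {(X, Y). generating_set G X \<and> generating_set G Y \<and> gens_le G X Y \<and> gens_le G Y X}"

definition gens_classes :: "('g, 'm) monoid_scheme \<Rightarrow> 'g set set set" where
  "gens_classes G = Collect (generating_set G) // gens_equiv G"

definition gens_class_le :: "('g, 'm) monoid_scheme \<Rightarrow> 'g set set \<Rightarrow> 'g set set \<Rightarrow> bool" where
  "gens_class_le G c d \<longleftrightarrow> (\<exists>X\<in>c. \<exists>Y\<in>d. gens_le G X Y)"


section \<open>Hyperbolic graphs\<close>

text \<open>A graph is given by its vertex set and a symmetric adjacency relation; it is viewed as a
  metric space through the edge-path metric on its vertices. Loops and multiple edges do not
  affect this metric.\<close>

definition graph_dist :: "('v \<times> 'v) set \<Rightarrow> 'v \<Rightarrow> 'v \<Rightarrow> nat" where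
  "graph_dist E u v = (LEAST n. (u, v) \<in> E ^^ n)"

text \<open>Gromov's four-point condition.\<close>

definition hyperbolic :: "real \<Rightarrow> 'v set \<Rightarrow> ('v \<Rightarrow> 'v \<Rightarrow> real) \<Rightarrow> bool" where
  "hyperbolic \<delta> V d \<longleftrightarrow>
     (\<forall>x\<in>V. \<forall>y\<in>V. \<forall>z\<in>V. \<forall>t\<in>V.
        d x y + d z t \<le> max (d x z + d y t) (d x t + d y z) + 2 * \<delta>)"

definition hyperbolic_graph :: "real \<Rightarrow> 'v set \<Rightarrow> ('v \<times> 'v) set \<Rightarrow> bool" where
  "hyperbolic_graph \<delta> V E \<longleftrightarrow> hyperbolic \<delta> V (\<lambda>u v. real (graph_dist E u v))"


section \<open>Thin cones\<close>

definition basis_words :: "'a set \<Rightarrow> 'a word set" where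
  "basis_words S = (\<lambda>s. [(s, True)]) ` S"

definition initial_words :: "'a set \<Rightarrow> 'a word set \<Rightarrow> 'a word set" where
  "initial_words S R = basis_words S \<union> {u. \<exists>r\<in>symmetrized R. prefix u r}"

definition four_piece_words :: "'a set \<Rightarrow> 'a word set \<Rightarrow> 'a word set" where
  "four_piece_words S R =
     {w \<in> initial_words S R. \<exists>ps. length ps \<le> 4 \<and> (\<forall>p\<in>set ps. is_piece R p) \<and>
        w = foldr (mult (free_group S)) ps (one (free_group S))}"

definition subwords_at :: "'a word set \<Rightarrow> 'a word \<Rightarrow> 'a word set" where
  "subwords_at X r = {x \<in> X. \<exists>w\<in>symmetrized {r}. sublist x w}"

text \<open>The vertices of the cycle labelled by \<open>r\<close> are \<open>0, \<dots>, length r - 1\<close>, and its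
  edge from \<open>p\<close> to \<open>Suc p mod length r\<close> is labelled by \<open>r ! p\<close>. For \<open>length x \<le> length r\<close>
  the positively oriented subpath of length \<open>length x\<close> from \<open>p\<close> has label \<open>x\<close> iff \<open>x\<close> is
  a prefix of \<open>rotate p r\<close>. A negatively oriented subpath with label \<open>x\<close> is the reverse of a
  positively oriented one with label \<open>word_inv x\<close>; since the added words are closed under
  inversion and the adjacency relation is symmetric, positively oriented subpaths suffice.\<close>

definition cone_vertices :: "'a word \<Rightarrow> nat set" where
  "cone_vertices r = {..<length r}"

definition cone_adj :: "'a word set \<Rightarrow> 'a word \<Rightarrow> (nat \<times> nat) set" where
  "cone_adj X r =
     (let E = {(p, Suc p mod length r) | p. p < length r} \<union>
              {(p, (p + length x) mod length r) | p x.
                 p < length r \<and> x \<in> subwords_at X r \<union> word_inv ` subwords_at X r \<and>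
                 prefix x (rotate p r)}
      in E \<union> E\<inverse>)"

definition thin_cones :: "'a set \<Rightarrow> 'a word set \<Rightarrow> 'a word set set set set" where
  "thin_cones S R =
     {c \<in> gens_classes (presented_group S R).
        \<exists>X. basis_words S \<union> four_piece_words S R \<subseteq> X \<and> X \<subseteq> initial_words S R \<and>
            image_in_group S R X \<in> c \<and>
            (\<exists>\<delta>\<ge>0. \<forall>r\<in>R. hyperbolic_graph \<delta> (cone_vertices r) (cone_adj X r))}"


section \<open>Subsets of the natural numbers modulo finite sets\<close>

definition eq_mod_fin :: "(nat set \<times> nat set) set" where
  "eq_mod_fin = {(A, B). finite (sym_diff A B)}"

definition Pomega_Fin :: "nat set set set" where
  "Pomega_Fin = UNIV // eq_mod_fin"

definition fin_class :: "nat set \<Rightarrow> nat set set" where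
  "fin_class A = eq_mod_fin `` {A}"

definition Pomega_Fin_le :: "nat set set \<Rightarrow> nat set set \<Rightarrow> bool" where
  "Pomega_Fin_le a b \<longleftrightarrow> (\<exists>A\<in>a. \<exists>B\<in>b. finite (A - B))"

definition poset_embedding ::
  "'p set \<Rightarrow> ('p \<Rightarrow> 'p \<Rightarrow> bool) \<Rightarrow> 'q set \<Rightarrow> ('q \<Rightarrow> 'q \<Rightarrow> bool) \<Rightarrow> ('p \<Rightarrow> 'q) \<Rightarrow> bool" where
  "poset_embedding P leP Q leQ f \<longleftrightarrow>
     f ` P \<subseteq> Q \<and> (\<forall>a\<in>P. \<forall>b\<in>P. leP a b \<longleftrightarrow> leQ (f a) (f b))"

end

theory Submission
  imports Defs "HOL-Library.Infinite_Set"
begin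

text \<open>The free group acts on its Cayley tree, where each conjugate of a relator is a translation along
  an axis. By the condition $C'(1/24)$, two distinct axes share less than $1/24$ of the translation
  length of either of them. Growing a subtree by successively absorbing all the axes that it meets
  (a windmill) shows that a path from a point to its translate by a nontrivial element of the normal
  closure runs along more than $20/24$ of the translation length of some axis; this replaces the
  use of van Kampen diagrams.

  An equation in $G$ between a subword $u$ of a relator and a product of $n$ elements of $X^{\pm 1}$ is a
  polygon in the tree, closed up to the normal closure, whose sides lie on axes. Cutting off the
  exposed axis replaces at least nine sides by three, and sides on a common axis can be merged. By
  induction, the end points of $u$ are at distance bounded in terms of $n$ in the cone $C_i^X$. Hence
  the $X$-length of subwords of $r_i$ only depends, up to a uniform change, on $X_i$.

  Given $X^1$ and $X^2$, sort the relators into levels according to the largest $X^2$-length of an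
  element of $X^1_i$, which is unbounded. The set for $A$ uses $X^2_i$ if the level of $r_i$ is in $A$,
  and $X^1_i$ otherwise.\<close>

section \<open>Trees\<close>

text \<open>All thresholds are counted in 24ths of a translation length. A windmill may overlap an
  axis that it has not absorbed in less than 2/24, because such an overlap splits into at most two
  pieces. A rotation about an axis therefore moves points that project near the windmill more than
  24 - 2 - 1 - 1 = 20 parts along it; this is the origin of 20/24. In a polygon whose sides have
  been rotated to at most half of their axes, a side covers at most 12/24 of its own axis and at
  most 1/24 of any other. When at most one side lies on the exposed axis, \<open>k\<close>
  consecutive sides cover it only if 20 < k + 12, hence the nine sides. The obstacle is that an
  exposed segment ends in the middle of a side, whereas cone distances are only known between the
  ends of sides. Such a point is located by going round the other sides that are cut off and
  projecting them to the axis of its side: a foreign axis projects to a point or to a piece, and a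
  nonempty piece is an edge of the cone. So only the number of sides matters, not the length of the
  relators.\<close>

locale tree_metric =
  fixes d :: "'v \<Rightarrow> 'v \<Rightarrow> nat"
  assumes d_zero: "d x y = 0 \<longleftrightarrow> x = y"
    and d_comm: "d x y = d y x"
    and d_tri: "d x z \<le> d x y + d y z"
    and median: "\<exists>m. d x m + d m y = d x y \<and> d y m + d m z = d y z \<and> d x m + d m z = d x z"
    and geodesic_unique: "d x p + d p y = d x y \<Longrightarrow> d x q + d q y = d x y \<Longrightarrow> d x p \<le> d x q
      \<Longrightarrow> d x p + d p q = d x q"
begin

definition btw :: "'v \<Rightarrow> 'v \<Rightarrow> 'v \<Rightarrow> bool" where
  "btw x z y \<longleftrightarrow> d x z + d z y = d x y"

definition convex :: "'v set \<Rightarrow> bool" where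
  "convex C \<longleftrightarrow> (\<forall>x\<in>C. \<forall>y\<in>C. \<forall>z. btw x z y \<longrightarrow> z \<in> C)"

lemma d_self [simp]: "d x x = 0"
  by (simp add: d_zero)

lemma btw_left [simp]: "btw x x y" and btw_right [simp]: "btw x y y"
  by (simp_all add: btw_def)

lemma btw_sym: "btw x z y \<longleftrightarrow> btw y z x"
  by (simp add: btw_def d_comm add.commute)

lemma btw_same: "btw x z x \<Longrightarrow> z = x"
  using d_zero [of x z] by (simp add: btw_def)

lemma convexD: "convex C \<Longrightarrow> x \<in> C \<Longrightarrow> y \<in> C \<Longrightarrow> btw x z y \<Longrightarrow> z \<in> C"
  unfolding convex_def by blast

lemma btw_trans: "btw x p m \<Longrightarrow> btw x m z \<Longrightarrow> btw x p z"
  using d_tri [of x z p] d_tri [of p z m] by (simp add: btw_def)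

lemma btw_trans': "btw x p m \<Longrightarrow> btw x m z \<Longrightarrow> btw p m z"
  using d_tri [of x z p] d_tri [of p z m] by (simp add: btw_def)

lemma btw_linear: "btw x p y \<Longrightarrow> btw x q y \<Longrightarrow> d x p \<le> d x q \<Longrightarrow> btw x p q"
  unfolding btw_def by (rule geodesic_unique)

lemma btw_cases: "btw x p y \<Longrightarrow> btw x q y \<Longrightarrow> btw x p q \<or> btw x q p"
  using btw_linear [of x p y q] btw_linear [of x q y p] by linarith

lemma btw_cases2: "btw x p y \<Longrightarrow> btw x q y \<Longrightarrow> btw x p q \<or> btw q p y"
  using btw_cases [of x p y q] btw_trans' [of x q p y] by blast

lemma obtain_median:
  obtains m where "btw x m y" "btw y m z" "btw x m z"
  using median [of x y z] unfolding btw_def by blast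

lemma btw_cover: "btw x p y \<Longrightarrow> btw x p z \<or> btw z p y"
proof -
  assume p: "btw x p y"
  obtain m where m: "btw x m y" "btw y m z" "btw x m z" by (rule obtain_median)
  from btw_cases2 [OF p m(1)] show ?thesis
  proof
    assume "btw x p m"
    from btw_trans [OF this m(3)] show ?thesis ..
  next
    assume "btw m p y"
    then have "btw y p m" by (simp add: btw_sym)
    from btw_trans [OF this m(2)] have "btw z p y" by (simp add: btw_sym)
    then show ?thesis ..
  qed
qed

text \<open>Being geodesic is a local property in a tree: two geodesics that overlap in a
  nondegenerate segment can be glued. The median of \<open>x\<close>, \<open>b\<close> and
  \<open>y\<close> has to be \<open>b\<close>, as otherwise the path would turn back before
  \<open>a\<close>.\<close>

lemma btw_concat: "btw x a b \<Longrightarrow> btw a b y \<Longrightarrow> a \<noteq> b \<Longrightarrow> btw x b y"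
proof -
  assume x: "btw x a b" and y: "btw a b y" and ne: "a \<noteq> b"
  obtain m where m: "btw x m b" "btw b m y" "btw x m y" by (rule obtain_median)
  have "d a b > 0" using ne d_zero by auto
  from btw_cases2 [OF x m(1)] show ?thesis
  proof
    assume 1: "btw x a m"
    have "d a y \<le> d a m + d m y" by (rule d_tri)
    moreover have "d a m + d m b = d a b" using btw_trans' [OF 1 m(1)] by (simp add: btw_def)
    ultimately have "d m b = 0" using y m(2) d_comm [of m b] unfolding btw_def by linarith
    then show ?thesis using m(3) d_zero [of m b] by simp
  next
    assume 1: "btw m a b"
    then have "btw b a m" by (simp add: btw_sym)
    then have "btw b a y" using m(2) btw_trans by blast
    then have False using y \<open>d a b > 0\<close> unfolding btw_def using d_comm [of a b] by linarith
    then show ?thesis ..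
  qed
qed

text \<open>Nearest-point projection to a subtree, characterised by all geodesics from
  \<open>x\<close> into \<open>C\<close> passing through it.\<close>

definition gate :: "'v set \<Rightarrow> 'v \<Rightarrow> 'v" where
  "gate C x = (SOME g. g \<in> C \<and> (\<forall>c\<in>C. btw x g c))"

text \<open>A nearest point works: the median of \<open>x\<close>, that point and any
  \<open>c\<close> is in \<open>C\<close> by convexity and cannot be closer to \<open>x\<close>. A
  nearest point exists since distances are natural numbers.\<close>

lemma gate_exists:
  assumes "convex C" "C \<noteq> {}"
  shows "\<exists>g. g \<in> C \<and> (\<forall>c\<in>C. btw x g c)"
proof -
  from assms(2) obtain c0 where "c0 \<in> C" by auto
  then obtain g where g: "g \<in> C" and min: "\<And>y. y \<in> C \<Longrightarrow> d x g \<le> d x y"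
    using ex_has_least_nat [of "\<lambda>y. y \<in> C" c0 "d x"] by blast
  have "btw x g c" if c: "c \<in> C" for c
  proof -
    obtain m where m: "btw x m g" "btw g m c" "btw x m c" by (rule obtain_median)
    have "m \<in> C" using convexD [OF assms(1) g c m(2)] .
    from min [OF this] m(1) have "d m g = 0" unfolding btw_def by linarith
    with m(3) show ?thesis using d_zero [of m g] by simp
  qed
  with g show ?thesis by blast
qed

lemma
  assumes "convex C" "C \<noteq> {}"
  shows gate_in: "gate C x \<in> C" and gate_btw: "c \<in> C \<Longrightarrow> btw x (gate C x) c"
proof -
  have "gate C x \<in> C \<and> (\<forall>c\<in>C. btw x (gate C x) c)"
    unfolding gate_def by (rule someI_ex [OF gate_exists [OF assms]])
  then show "gate C x \<in> C" "c \<in> C \<Longrightarrow> btw x (gate C x) c" by auto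
qed

lemma gate_unique:
  assumes "convex C" "g \<in> C" "\<And>c. c \<in> C \<Longrightarrow> btw x g c"
  shows "gate C x = g"
proof -
  have "C \<noteq> {}" using assms by auto
  note G = gate_in [OF assms(1) this, of x] gate_btw [OF assms(1) this, of _ x]
  have "btw x (gate C x) g" "btw x g (gate C x)" using G assms by auto
  then have "d g (gate C x) = 0" unfolding btw_def using d_comm [of g "gate C x"] by linarith
  then show ?thesis by (simp add: d_zero)
qed

lemma gate_self: "convex C \<Longrightarrow> x \<in> C \<Longrightarrow> gate C x = x"
  by (rule gate_unique) auto

text \<open>The segment between the two gates is shared by the geodesics from \<open>x\<close> and
  from \<open>y\<close> to the opposite gate, so \<open>btw_concat\<close> glues them. Hence two
  different projections show that a geodesic runs along \<open>C\<close>.\<close>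

lemma gate_bridge:
  assumes "convex C" "C \<noteq> {}" "gate C x \<noteq> gate C y"
  shows "btw x (gate C x) y" "btw x (gate C y) y" "btw (gate C x) (gate C y) y"
    "btw x (gate C x) (gate C y)"
proof -
  show 1: "btw x (gate C x) (gate C y)" by (intro gate_btw gate_in assms(1,2))
  show 2: "btw (gate C x) (gate C y) y"
    using gate_btw [OF assms(1,2), of "gate C x" y] gate_in [OF assms(1,2)] btw_sym by blast
  show 3: "btw x (gate C y) y" using btw_concat [OF 1 2 assms(3)] .
  show "btw x (gate C x) y" using btw_trans [OF 1 3] .
qed

lemma gate_image_convex:
  assumes "convex C" "C \<noteq> {}" "convex B" "x \<in> B" "y \<in> B" "gate C x \<noteq> gate C y"
  shows "gate C x \<in> B" "gate C y \<in> B"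
  using convexD [OF assms(3-5)] gate_bridge(1,2) [OF assms(1,2,6)] by auto

lemma gate_in_meeting:
  assumes "convex C" "convex B" "x \<in> B" "p \<in> B" "p \<in> C"
  shows "gate C x \<in> B"
proof -
  have "btw x (gate C x) p" using gate_btw [of C p x] assms by blast
  then show ?thesis by (rule convexD [OF assms(2-4)])
qed

lemma convex_sing: "convex {x}"
  unfolding convex_def using btw_same by blast

end

section \<open>Axes and windmills\<close>

text \<open>The generated subgroup. The class \<open>group_add\<close> is additive notation for
  groups that need not be commutative; \<open>h + x\<close> is the left translate of the vertex
  \<open>x\<close> by \<open>h\<close>.\<close>

inductive_set gen :: "'g::group_add set \<Rightarrow> 'g set" for A where
  gen_zero: "0 \<in> gen A"
| gen_plus: "a \<in> A \<Longrightarrow> x \<in> gen A \<Longrightarrow> a + x \<in> gen A"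
| gen_minus: "a \<in> A \<Longrightarrow> x \<in> gen A \<Longrightarrow> - a + x \<in> gen A"

lemma gen_incl: "a \<in> A \<Longrightarrow> a \<in> gen A"
  using gen_plus [OF _ gen_zero, of a A] by simp

lemma gen_incl_uminus: "a \<in> A \<Longrightarrow> - a \<in> gen A"
  using gen_minus [OF _ gen_zero, of a A] by simp

lemma gen_add: "x \<in> gen A \<Longrightarrow> y \<in> gen A \<Longrightarrow> x + y \<in> gen A"
  by (induction rule: gen.induct) (auto simp: add.assoc intro: gen.intros)

lemma gen_uminus: "x \<in> gen A \<Longrightarrow> - x \<in> gen A"
proof (induction rule: gen.induct)
  case (gen_plus a x)
  then show ?case using gen_add [OF gen_plus.IH gen_incl_uminus [OF gen_plus.hyps(1)]]
    by (simp add: minus_add)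
next
  case (gen_minus a x)
  then show ?case using gen_add [OF gen_minus.IH gen_incl [OF gen_minus.hyps(1)]] by (simp add: minus_add)
qed (simp add: gen_zero)

lemma gen_mono: "x \<in> gen A \<Longrightarrow> A \<subseteq> B \<Longrightarrow> x \<in> gen B"
  by (induction rule: gen.induct) (auto intro: gen.intros)

lemma gen_least:
  assumes "x \<in> gen A" "A \<subseteq> K" "0 \<in> K" "\<And>x y. x \<in> K \<Longrightarrow> y \<in> K \<Longrightarrow> x + y \<in> K" "\<And>x. x \<in> K \<Longrightarrow> - x \<in> K"
  shows "x \<in> K"
  using assms(1) by induction (use assms(2-) in auto)

text \<open>Rewriting with these turns a group expression into a flat sum of signed atoms without
  cancelling neighbours, which decides the identities needed below.\<close>

lemmas group_norm = diff_conv_add_uminus minus_add add.assoc minus_minus minus_add_cancel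
  add_minus_cancel add_0_left add_0_right left_minus right_minus minus_zero

definition conj_by :: "'g::group_add \<Rightarrow> 'g \<Rightarrow> 'g" where
  "conj_by h c = h + c - h"

lemma conj_by_zero [simp]: "conj_by 0 c = c" "conj_by h 0 = 0"
  by (simp_all add: conj_by_def)

lemma conj_by_conj_by [simp]: "conj_by h (conj_by k c) = conj_by (h + k) c"
  by (simp only: conj_by_def group_norm)

lemma conj_by_uminus: "conj_by h (- c) = - conj_by h c"
  by (simp only: conj_by_def group_norm)

lemma conj_by_add: "conj_by h (a + b) = conj_by h a + conj_by h b"
  by (simp only: conj_by_def group_norm)

lemma conj_by_eq_iff [simp]: "conj_by h a = conj_by h b \<longleftrightarrow> a = b"
proof
  assume "conj_by h a = conj_by h b"
  then have "conj_by (- h) (conj_by h a) = conj_by (- h) (conj_by h b)" by simp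
  then show "a = b" unfolding conj_by_conj_by by simp
qed simp

lemma conj_by_plus: "conj_by h a + (h + x) = h + (a + x)"
  by (simp only: conj_by_def group_norm)

lemma conj_by_gen: "x \<in> gen {c} \<Longrightarrow> conj_by h x \<in> gen {conj_by h c}"
proof (induction rule: gen.induct)
  case gen_zero show ?case by (simp add: gen.gen_zero)
next
  case (gen_plus a x) then show ?case by (simp add: conj_by_add gen.gen_plus)
next
  case (gen_minus a x) then show ?case by (simp add: conj_by_add conj_by_uminus gen.gen_minus)
qed

lemma gen_sing_uminus: "gen {- c} = gen {c}"
proof -
  have "x \<in> gen {c}" if "x \<in> gen {- c}" for x c :: 'a
    using that by induction (auto intro: gen.intros)
  from this [of _ c] this [of _ "- c"] show ?thesis by auto
qed

lemma gen_commutes: "x \<in> gen {c} \<Longrightarrow> conj_by x c = c"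
proof (induction rule: gen.induct)
  case (gen_plus a x)
  have "conj_by (a + x) c = conj_by a (conj_by x c)" by simp
  then show ?case using gen_plus by (simp add: conj_by_def)
next
  case (gen_minus a x)
  have "conj_by (- a + x) c = conj_by (- a) (conj_by x c)" by simp
  then show ?case using gen_minus by (simp add: conj_by_def)
qed simp

text \<open>\<open>c\<close> and \<open>- c\<close> index the same axis, so "different axes" has to
  exclude both signs.\<close>

definition pm_eq :: "'g::group_add \<Rightarrow> 'g \<Rightarrow> bool" where
  "pm_eq a b \<longleftrightarrow> b = a \<or> b = - a"

lemma pm_eq_refl [simp]: "pm_eq a a"
  by (simp add: pm_eq_def)

lemma pm_eq_sym: "pm_eq a b \<longleftrightarrow> pm_eq b a"
  by (auto simp: pm_eq_def)

lemma pm_eq_trans: "pm_eq a b \<Longrightarrow> pm_eq b c \<Longrightarrow> pm_eq a c"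
  by (auto simp: pm_eq_def)

lemma pm_eq_conj_by [simp]: "pm_eq (conj_by h a) (conj_by h b) \<longleftrightarrow> pm_eq a b"
  by (simp add: pm_eq_def flip: conj_by_uminus)

lemma pm_eq_conj_by_shift: "pm_eq (conj_by (- h) a) b \<longleftrightarrow> pm_eq a (conj_by h b)"
  using pm_eq_conj_by [of h "conj_by (- h) a" b] by simp

lemma pm_eq_gen: "pm_eq a b \<Longrightarrow> gen {a} = gen {b}"
  by (auto simp: pm_eq_def gen_sing_uminus)

text \<open>In the application, the axes are the lines in the Cayley tree of a free group which are
  labelled by the powers of a relator, indexed by the translation along the line.\<close>

locale axis_system = tree_metric d for d :: "'g::group_add \<Rightarrow> 'g \<Rightarrow> nat" +
  fixes Ax :: "'g \<Rightarrow> 'g set" and len :: "'g \<Rightarrow> nat"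
  assumes d_left: "d (h + x) (h + y) = d x y"
    and Ax_conj': "x \<in> Ax c \<Longrightarrow> h + x \<in> Ax (conj_by h c)"
    and len_conj: "x \<in> Ax c \<Longrightarrow> len (conj_by h c) = len c"
    and Ax_uminus: "Ax (- c) = Ax c"
    and len_uminus: "x \<in> Ax c \<Longrightarrow> len (- c) = len c"
    and len_pos: "x \<in> Ax c \<Longrightarrow> 0 < len c"
    and Ax_nonzero: "x \<in> Ax c \<Longrightarrow> c \<noteq> 0"
    and Ax_convex: "convex (Ax c)"
    and Rot_moves: "x \<in> Ax c \<Longrightarrow> \<rho> \<in> gen {c} \<Longrightarrow> \<rho> \<noteq> 0 \<Longrightarrow> len c \<le> d x (\<rho> + x)"
    and Ax_overlap: "x \<in> Ax c \<Longrightarrow> y \<in> Ax c \<Longrightarrow> x \<in> Ax c' \<Longrightarrow> y \<in> Ax c' \<Longrightarrow> \<not> pm_eq c c' \<Longrightarrow>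
      24 * d x y < len c"
    and Ax_shorten: "x \<in> Ax c \<Longrightarrow> y \<in> Ax c \<Longrightarrow> len c < 2 * d x y \<Longrightarrow>
      \<exists>\<rho>\<in>gen {c}. d x (\<rho> + y) < d x y"
    and Ax_cover: "x \<noteq> y \<Longrightarrow> \<exists>z c. btw x z y \<and> z \<noteq> y \<and> z \<in> Ax c \<and> y \<in> Ax c"
begin

lemma btw_translate [simp]: "btw (h + x) (h + z) (h + y) \<longleftrightarrow> btw x z y"
  by (simp add: btw_def d_left)

lemma btw_shift: "btw (h + x) z (h + y) \<longleftrightarrow> btw x (- h + z) y"
  using btw_translate [of h x "- h + z" y] by simp

lemma Ax_conj [simp]: "h + x \<in> Ax (conj_by h c) \<longleftrightarrow> x \<in> Ax c"
  using Ax_conj' [of x c h] Ax_conj' [of "h + x" "conj_by h c" "- h"] by auto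

lemma Ax_conj_shift: "x \<in> Ax (conj_by h c) \<longleftrightarrow> - h + x \<in> Ax c"
  using Ax_conj [of h "- h + x" c] by simp

lemma Ax_pm_eq: "pm_eq a b \<Longrightarrow> Ax a = Ax b"
  by (auto simp: pm_eq_def Ax_uminus)

lemma len_pm_eq: "pm_eq a b \<Longrightarrow> x \<in> Ax a \<Longrightarrow> len a = len b"
  by (auto simp: pm_eq_def len_uminus)

lemma Ax_Rot [simp]: "\<rho> \<in> gen {c} \<Longrightarrow> \<rho> + x \<in> Ax c \<longleftrightarrow> x \<in> Ax c"
  using Ax_conj [of \<rho> x c] by (simp add: gen_commutes)

lemma gate_left:
  assumes "Ax c \<noteq> {}"
  shows "gate (Ax (conj_by h c)) (h + x) = h + gate (Ax c) x"
proof (rule gate_unique [OF Ax_convex])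
  show "h + gate (Ax c) x \<in> Ax (conj_by h c)"
    using gate_in [OF Ax_convex assms] by simp
  fix y assume "y \<in> Ax (conj_by h c)"
  then have "- h + y \<in> Ax c" by (simp add: Ax_conj_shift)
  from gate_btw [OF Ax_convex assms this, of x]
  show "btw (h + x) (h + gate (Ax c) x) y"
    using btw_translate [of h x "gate (Ax c) x" "- h + y"] by simp
qed

lemma gate_Rot:
  assumes "Ax c \<noteq> {}" "\<rho> \<in> gen {c}"
  shows "gate (Ax c) (\<rho> + x) = \<rho> + gate (Ax c) x"
  using gate_left [OF assms(1), of \<rho> x] gen_commutes [OF assms(2)] by simp

end

text \<open>\<open>K\<close> is the group generated so far and \<open>W\<close> an invariant subtree
  around the base point. The constant in \<open>W_axes\<close> is twice the bound for a piece, which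
  is what \<open>overlap_far\<close> reproduces for the next stage.\<close>

locale windmill = axis_system +
  fixes K W
  assumes K_zero: "0 \<in> K" and K_add: "x \<in> K \<Longrightarrow> y \<in> K \<Longrightarrow> x + y \<in> K" and K_uminus: "x \<in> K \<Longrightarrow> - x \<in> K"
    and W_convex: "convex W" and W_zero: "0 \<in> W"
    and W_inv: "k \<in> K \<Longrightarrow> w \<in> W \<Longrightarrow> k + w \<in> W"
    and W_axes: "Ax c \<noteq> {} \<Longrightarrow> (c \<in> K \<and> Ax c \<subseteq> W) \<or> (\<forall>x\<in>Ax c \<inter> W. \<forall>y\<in>Ax c \<inter> W. 12 * d x y < len c)"
begin

section \<open>Ping-pong with the new axes of a windmill\<close>

definition New :: "'a set" where
  "New = {c. Ax c \<inter> W \<noteq> {} \<and> c \<notin> K}"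

text \<open>The projection to the axis is within the length of a piece of \<open>W\<close>. The
  ping-pong argument needs no other information about a point.\<close>

definition near :: "'a \<Rightarrow> 'a \<Rightarrow> bool" where
  "near a x \<longleftrightarrow> (\<exists>p\<in>Ax a \<inter> W. 24 * d (gate (Ax a) x) p < len a)"

lemma conj_by_K: "k \<in> K \<Longrightarrow> conj_by k c \<in> K \<longleftrightarrow> c \<in> K"
proof -
  assume k: "k \<in> K"
  have *: "conj_by k c \<in> K" if "k \<in> K" "c \<in> K" for k c
    unfolding conj_by_def diff_conv_add_uminus using that by (intro K_add K_uminus)
  show ?thesis using * [OF k, of c] * [OF K_uminus [OF k], of "conj_by k c"] by auto
qed

lemma New_conj: "k \<in> K \<Longrightarrow> a \<in> New \<Longrightarrow> conj_by k a \<in> New"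
  using W_inv by (auto simp: New_def conj_by_K) (metis Ax_conj IntI empty_iff)

lemma New_ne: "a \<in> New \<Longrightarrow> Ax a \<noteq> {}"
  by (auto simp: New_def)

lemma New_meet: "a \<in> New \<Longrightarrow> \<exists>p. p \<in> Ax a \<and> p \<in> W"
  by (auto simp: New_def)

lemma New_small: "a \<in> New \<Longrightarrow> x \<in> Ax a \<Longrightarrow> x \<in> W \<Longrightarrow> y \<in> Ax a \<Longrightarrow> y \<in> W \<Longrightarrow> 12 * d x y < len a"
  using W_axes [of a] New_ne [of a] by (auto simp: New_def)

lemma near_W: "a \<in> New \<Longrightarrow> x \<in> W \<Longrightarrow> near a x"
proof -
  assume a: "a \<in> New" and x: "x \<in> W"
  obtain p where p: "p \<in> Ax a" "p \<in> W" using New_meet [OF a] by blast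
  have "gate (Ax a) x \<in> W" by (rule gate_in_meeting [OF Ax_convex W_convex x p(2,1)])
  moreover have "gate (Ax a) x \<in> Ax a" using gate_in [OF Ax_convex New_ne [OF a]] .
  ultimately show ?thesis unfolding near_def
    using len_pos [OF p(1)] by (intro bexI [of _ "gate (Ax a) x"]) auto
qed

text \<open>A point \<open>p\<close> of \<open>W\<close> on the second axis projects into
  \<open>W\<close>. The projections of \<open>p\<close> and \<open>y\<close> either coincide or span
  an overlap of the two axes, that is, a piece.\<close>

lemma near_axis: "a \<in> New \<Longrightarrow> b \<in> New \<Longrightarrow> \<not> pm_eq a b \<Longrightarrow> y \<in> Ax b \<Longrightarrow> near a y"
proof -
  assume a: "a \<in> New" and b: "b \<in> New" and ne: "\<not> pm_eq a b" and y: "y \<in> Ax b"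
  obtain p where p: "p \<in> Ax b" "p \<in> W" using New_meet [OF b] by blast
  obtain q where q: "q \<in> Ax a" "q \<in> W" using New_meet [OF a] by blast
  have W: "gate (Ax a) p \<in> W" by (rule gate_in_meeting [OF Ax_convex W_convex p(2) q(2,1)])
  note gin = gate_in [OF Ax_convex New_ne [OF a]]
  have "24 * d (gate (Ax a) y) (gate (Ax a) p) < len a"
  proof (cases "gate (Ax a) y = gate (Ax a) p")
    case True then show ?thesis using len_pos [OF q(1)] by simp
  next
    case False
    from gate_image_convex [OF Ax_convex New_ne [OF a] Ax_convex y p(1) False]
    show ?thesis using Ax_overlap gin ne by blast
  qed
  then show ?thesis unfolding near_def using W gin by blast
qed

lemma near_conj: "k \<in> K \<Longrightarrow> a \<in> New \<Longrightarrow> near (conj_by k a) (k + x) \<longleftrightarrow> near a x"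
proof -
  have *: "near (conj_by k a) (k + x)" if k: "k \<in> K" and a: "a \<in> New" and n: "near a x" for k a x
  proof -
    obtain p where p: "p \<in> Ax a" "p \<in> W" "24 * d (gate (Ax a) x) p < len a"
      using n unfolding near_def by auto
    then show ?thesis unfolding near_def
      using W_inv [OF k] len_conj [OF p(1), of k] gate_left [OF New_ne [OF a], of k x]
      by (intro bexI [of _ "k + p"]) (auto simp: d_left)
  qed
  assume "k \<in> K" "a \<in> New"
  then show ?thesis using * [of k a x] * [of "- k" "conj_by k a" "k + x"]
    by (auto simp: New_conj K_uminus)
qed

text \<open>The rotation moves \<open>p\<close> by at least \<open>len a\<close>. Less than 1/24 of
  this is lost at \<open>x\<close>, less than 1/24 at \<open>y\<close>, and less than 1/12 between
  the witnesses \<open>p\<close> and \<open>q\<close> in \<open>W\<close>.\<close>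

lemma crossing:
  assumes a: "a \<in> New" and x: "near a x" and y: "near a y" and \<rho>: "\<rho> \<in> gen {a}" "\<rho> \<noteq> 0"
  shows "20 * len a < 24 * d (gate (Ax a) x) (gate (Ax a) (\<rho> + y))"
proof -
  obtain p where p: "p \<in> Ax a" "p \<in> W" "24 * d (gate (Ax a) x) p < len a"
    using x unfolding near_def by auto
  obtain q where q: "q \<in> Ax a" "q \<in> W" "24 * d (gate (Ax a) y) q < len a"
    using y unfolding near_def by auto
  have 1: "12 * d p q < len a" using New_small [OF a] p q by blast
  have 2: "len a \<le> d p (\<rho> + p)" using Rot_moves [OF p(1) \<rho>] .
  have 3: "d p (\<rho> + p) \<le> d p (gate (Ax a) x) + d (gate (Ax a) x) (\<rho> + gate (Ax a) y)
    + d (\<rho> + gate (Ax a) y) (\<rho> + q) + d (\<rho> + q) (\<rho> + p)"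
    using d_tri [of p "\<rho> + p" "gate (Ax a) x"] d_tri [of "gate (Ax a) x" "\<rho> + p" "\<rho> + gate (Ax a) y"]
      d_tri [of "\<rho> + gate (Ax a) y" "\<rho> + p" "\<rho> + q"] by linarith
  show ?thesis using 1 2 3 p(3) q(3) d_comm [of p q] d_comm [of p "gate (Ax a) x"]
    unfolding gate_Rot [OF New_ne [OF a] \<rho>(1)] d_left by linarith
qed

text \<open>The geodesic from \<open>s\<close> to \<open>\<rho> + z\<close> runs along
  \<open>Ax a\<close> from \<open>u\<close> to \<open>v\<close> and contains the projection
  \<open>p\<close> to \<open>Ax b\<close>. Before \<open>u\<close>, the point \<open>p\<close> is in
  \<open>W\<close>; between \<open>u\<close> and \<open>v\<close>, it is within a piece of
  \<open>u\<close>, which is in \<open>W\<close>; beyond \<open>v\<close>, the two axes would share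
  everything from \<open>u\<close> to \<open>v\<close>, which is too much.\<close>

lemma near_step:
  assumes a: "a \<in> New" and b: "b \<in> New" and ne: "\<not> pm_eq a b" and z: "near a z"
    and \<rho>: "\<rho> \<in> gen {a}" "\<rho> \<noteq> 0"
  shows "near b (\<rho> + z)"
proof -
  obtain s where s: "s \<in> Ax b" "s \<in> W" using New_meet [OF b] by blast
  obtain q where q: "q \<in> Ax a" "q \<in> W" using New_meet [OF a] by blast
  define p where "p = gate (Ax b) (\<rho> + z)"
  define u where "u = gate (Ax a) s"
  define v where "v = gate (Ax a) (\<rho> + z)"
  have pb: "p \<in> Ax b" unfolding p_def by (rule gate_in [OF Ax_convex New_ne [OF b]])
  have ua: "u \<in> Ax a" and va: "v \<in> Ax a"
    unfolding u_def v_def by (rule gate_in [OF Ax_convex New_ne [OF a]])+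
  have uW: "u \<in> W" unfolding u_def by (rule gate_in_meeting [OF Ax_convex W_convex s(2) q(2,1)])
  have uv: "20 * len a < 24 * d u v" unfolding u_def v_def
    by (rule crossing [OF a near_W [OF a s(2)] z \<rho>])
  then have "u \<noteq> v" by auto
  note br = gate_bridge [OF Ax_convex New_ne [OF a] this [unfolded u_def v_def], folded u_def v_def]
  have bp: "btw s p (\<rho> + z)" unfolding p_def
    using gate_btw [OF Ax_convex New_ne [OF b] s(1)] btw_sym by blast
  have ord: "btw x r y" if "btw x r w" "btw r y w" for x r y w
    using btw_trans' [of w y r x] that by (simp add: btw_sym)
  have "\<exists>p'\<in>Ax b \<inter> W. 24 * d p p' < len b"
    using btw_cases2 [OF bp br(1)]
  proof
    assume "btw s p u"
    then have "p \<in> W" using convexD [OF W_convex s(2) uW] by blast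
    then show ?thesis using pb len_pos [OF pb] by (intro bexI [of _ p]) auto
  next
    assume up: "btw u p (\<rho> + z)"
    have ub: "u \<in> Ax b" using convexD [OF Ax_convex s(1) pb] ord [OF br(1) up] by blast
    from btw_cases2 [OF up br(3)] show ?thesis
    proof
      assume "btw u p v"
      then have "p \<in> Ax a" using convexD [OF Ax_convex ua va] by blast
      then have "24 * d p u < len b"
        using Ax_overlap [OF pb ub _ ua] ne pm_eq_sym by blast
      then show ?thesis using ub uW by blast
    next
      assume vp: "btw v p (\<rho> + z)"
      have "v \<in> Ax b" using convexD [OF Ax_convex s(1) pb] ord [OF br(2) vp] by blast
      then have "24 * d u v < len a" using Ax_overlap [OF ua va ub _ ne] by blast
      then show ?thesis using uv by linarith
    qed
  qed
  then show ?thesis unfolding near_def p_def .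
qed

text \<open>A point of the next windmill is reached from \<^term>\<open>W\<close> by alternately rotating about new axes and
  applying elements of \<^term>\<open>K\<close>; \<open>far\<close> records the first axis of such an alternating expression,
  which starts from a point of \<open>Z\<close> or from a point of \<open>E\<close> on a new axis.\<close>

inductive far :: "'a set \<Rightarrow> 'a set \<Rightarrow> 'a option \<Rightarrow> 'a \<Rightarrow> bool" for Z E where
  far_base: "w \<in> Z \<Longrightarrow> far Z E None w"
| far_axis: "b \<in> New \<Longrightarrow> z \<in> Ax b \<Longrightarrow> z \<in> E \<Longrightarrow> far Z E (Some b) z"
| far_step: "a \<in> New \<Longrightarrow> \<rho> \<in> gen {a} \<Longrightarrow> \<rho> \<noteq> 0 \<Longrightarrow> k \<in> K \<Longrightarrow> far Z E ob z \<Longrightarrow>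
    (\<And>b. ob = Some b \<Longrightarrow> \<not> pm_eq a (conj_by k b)) \<Longrightarrow> far Z E (Some a) (\<rho> + (k + z))"

text \<open>This is the ping-pong induction. In the step, the first axis is pulled back by
  \<open>k\<close>; as consecutive rotations have different axes, the induction hypothesis applies
  to it, and \<open>near_step\<close> carries nearness across the rotation.\<close>

lemma far_near:
  assumes "far Z E ob z" "Z \<subseteq> W" "a \<in> New" "\<And>b. ob = Some b \<Longrightarrow> \<not> pm_eq a b"
  shows "near a z"
  using assms
proof (induction arbitrary: a rule: far.induct)
  case (far_base w) then show ?case using near_W by blast
next
  case (far_axis b z) then show ?case using near_axis by blast
next
  case (far_step b \<rho> k ob z)
  have "near (conj_by (- k) b) z"
    using far_step.hyps far_step.prems
      by (intro far_step.IH New_conj K_uminus) (auto simp: pm_eq_conj_by_shift)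
  then have n: "near b (k + z)"
    using near_conj [of k "conj_by (- k) b" z] far_step.hyps by (simp add: New_conj K_uminus)
  have "\<not> pm_eq b a" using far_step.prems(3) pm_eq_sym by blast
  from near_step [OF far_step.hyps(1) far_step.prems(2) this n far_step.hyps(2,3)] show ?case .
qed

lemma far_near_K:
  assumes "far Z E ob z" "Z \<subseteq> W" "a \<in> New" "k \<in> K" "\<And>b. ob = Some b \<Longrightarrow> \<not> pm_eq a (conj_by k b)"
  shows "near a (k + z)"
proof -
  have a: "conj_by (- k) a \<in> New" using assms New_conj K_uminus by blast
  have "near (conj_by (- k) a) z"
    by (rule far_near [OF assms(1,2) a]) (simp add: assms(5) pm_eq_conj_by_shift)
  then show ?thesis using near_conj [OF assms(4) a, of z] by simp
qed

definition mill :: "'a set \<Rightarrow> 'a set \<Rightarrow> 'a set" where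
  "mill Z E = {k + z |k z. k \<in> K \<and> (\<exists>ob. far Z E ob z)}"

lemma mill_K: "k \<in> K \<Longrightarrow> x \<in> mill Z E \<Longrightarrow> k + x \<in> mill Z E"
  unfolding mill_def using K_add by (fastforce simp flip: add.assoc)

lemma mill_far: "far Z E ob z \<Longrightarrow> z \<in> mill Z E"
  unfolding mill_def using K_zero by force

text \<open>A rotation either prolongs the alternating expression or has the same axis as its first
  rotation and is merged with it; if the result is trivial, the expression gets shorter. A starting
  point on a new axis just moves along that axis, so \<open>E\<close> has to be invariant. It is
  \<open>{}\<close> in \<open>new_relator_exposed\<close> and \<open>UNIV\<close> in
  \<open>W'_mill\<close>.\<close>

lemma mill_Rot:
  assumes E: "\<And>h x. x \<in> E \<Longrightarrow> h + x \<in> E"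
    and a: "a \<in> New" and \<rho>: "\<rho> \<in> gen {a}" and x: "x \<in> mill Z E"
  shows "\<rho> + x \<in> mill Z E"
proof (cases "\<rho> = 0")
  case True then show ?thesis using x by simp
next
  case False
  obtain k z ob where k: "k \<in> K" and z: "far Z E ob z" and xk: "x = k + z"
    using x unfolding mill_def by blast
  show ?thesis
  proof (cases "\<exists>b. ob = Some b \<and> pm_eq a (conj_by k b)")
    case False
    then show ?thesis unfolding xk
      by (intro mill_far [of _ _ "Some a"] far_step [OF a \<rho> \<open>\<rho> \<noteq> 0\<close> k z]) auto
  next
    case True
    then obtain b where ob: "ob = Some b" and eq: "pm_eq a (conj_by k b)" by blast
    from z ob show ?thesis
    proof cases
      case (far_axis b')
      then have "k + z \<in> Ax a" using Ax_pm_eq [OF eq] ob by simp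
      then show ?thesis unfolding xk using far_axis E \<rho>
        by (intro mill_far [of _ _ "Some a"] far.far_axis [OF a]) auto
    next
      case (far_step b' \<rho>' k' ob' z')
      then have b': "b' = b" using ob by simp
      \<comment> \<open>Conjugated by \<open>k\<close>, the inner rotation is about \<open>a\<close>
        too, so the two combine to one.\<close>
      define \<sigma> where "\<sigma> = \<rho> + conj_by k \<rho>'"
      have "conj_by k \<rho>' \<in> gen {conj_by k b}" using far_step b' by (intro conj_by_gen) auto
      then have \<sigma>: "\<sigma> \<in> gen {a}" unfolding \<sigma>_def using \<rho> pm_eq_gen [OF eq] gen_add by blast
      have x: "\<rho> + x = \<sigma> + ((k + k') + z')"
        unfolding \<sigma>_def xk far_step(2) by (simp only: conj_by_def group_norm)
      have ne: "\<not> pm_eq a (conj_by (k + k') b'')" if "ob' = Some b''" for b''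
      proof
        assume "pm_eq a (conj_by (k + k') b'')"
        then have "pm_eq (conj_by k b) (conj_by (k + k') b'')"
          using eq pm_eq_sym pm_eq_trans by blast
        then have "pm_eq b (conj_by k' b'')"
          unfolding conj_by_conj_by [symmetric] pm_eq_conj_by .
        then show False using far_step(8) [OF that] b' by simp
      qed
      have kk: "k + k' \<in> K" using k far_step by (intro K_add) auto
      show ?thesis
      proof (cases "\<sigma> = 0")
        case True
        then show ?thesis unfolding x using mill_K [OF kk mill_far] far_step by auto
      next
        case False
        show ?thesis unfolding x
          by (intro mill_far [of _ _ "Some a"] far.far_step [OF a \<sigma> False kk]) (use far_step ne in auto)
      qed
    qed simp_all
  qed
qed

section \<open>The next windmill\<close>

definition K' :: "'a set" where "K' = gen (K \<union> New)"

definition W' :: "'a set" where "W' = {k + x |k x. k \<in> K' \<and> (x \<in> W \<or> (\<exists>a\<in>New. x \<in> Ax a))}"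

lemma mill_K':
  assumes E: "\<And>h x. x \<in> E \<Longrightarrow> h + x \<in> E" and "g \<in> K'" and "x \<in> mill Z E"
  shows "g + x \<in> mill Z E"
  using assms(2) unfolding K'_def
proof induction
  case gen_zero then show ?case using assms(3) by simp
next
  case (gen_plus a y)
  then show ?case using mill_K mill_Rot [OF E _ gen_incl] by (auto simp: add.assoc)
next
  case (gen_minus a y)
  then show ?case using mill_K K_uminus mill_Rot [OF E _ gen_incl_uminus] by (auto simp: add.assoc)
qed

lemma K'_add: "x \<in> K' \<Longrightarrow> y \<in> K' \<Longrightarrow> x + y \<in> K'" and K'_uminus: "x \<in> K' \<Longrightarrow> - x \<in> K'" and K'_zero: "0 \<in> K'"
  unfolding K'_def by (rule gen_add gen_uminus gen_zero; assumption)+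

lemma K_K': "k \<in> K \<Longrightarrow> k \<in> K'" and New_K': "k \<in> New \<Longrightarrow> k \<in> K'"
  unfolding K'_def by (auto intro: gen_incl)

text \<open>With \<open>Z = K\<close> and \<open>E = {}\<close>, the expression of an element
  outside \<open>K\<close> contains at least one rotation. The geodesic from \<open>- k\<close>, a
  point of \<open>W\<close>, to \<open>z\<close> follows the axis of the first rotation by
  \<open>crossing\<close>; translation by \<open>k\<close> makes it the geodesic from
  \<open>0\<close> to \<open>\<nu>\<close>.\<close>

lemma new_relator_exposed:
  assumes "\<nu> \<in> K'" "\<nu> \<notin> K"
  shows "\<exists>c x y. x \<in> Ax c \<and> y \<in> Ax c \<and> btw 0 x \<nu> \<and> btw 0 y \<nu> \<and> 20 * len c < 24 * d x y"
proof -
  have "0 \<in> mill K {}" using mill_far [OF far_base] K_zero by blast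
  from mill_K' [OF _ assms(1) this] have "\<nu> \<in> mill K {}" by simp
  then obtain k z ob where k: "k \<in> K" and z: "far K {} ob z" and \<nu>: "\<nu> = k + z"
    unfolding mill_def by blast
  from z show ?thesis
  proof cases
    case far_base
    then show ?thesis using assms(2) K_add k \<nu> by auto
  next
    case (far_step a \<rho> k' ob' z')
    have KW: "K \<subseteq> W" using W_inv [OF _ W_zero] by auto
    have kW: "- k \<in> W" using KW k K_uminus by blast
    have n: "near a (k' + z')"
      by (rule far_near_K [OF far_step(7) KW far_step(3,6)]) (use far_step in auto)
    define u where "u = gate (Ax a) (- k)"
    define v where "v = gate (Ax a) z"
    have uv: "20 * len a < 24 * d u v" unfolding u_def v_def far_step(2)
      using crossing [OF far_step(3) near_W [OF far_step(3) kW] n far_step(4,5)] .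
    then have "u \<noteq> v" by auto
    note br = gate_bridge [OF Ax_convex New_ne [OF far_step(3)] this [unfolded u_def v_def],
      folded u_def v_def]
    have ua: "u \<in> Ax a" and va: "v \<in> Ax a"
      unfolding u_def v_def by (rule gate_in [OF Ax_convex New_ne [OF far_step(3)]])+
    have "btw 0 (k + u) \<nu>" "btw 0 (k + v) \<nu>"
      using br(1,2) btw_translate [of k "- k" _ z] unfolding \<nu> by auto
    then show ?thesis using ua va uv len_conj [OF ua, of k]
      by (intro exI [of _ "conj_by k a"] exI [of _ "k + u"] exI [of _ "k + v"]) (simp add: d_left)
  qed simp
qed

lemma W'_K': "g \<in> K' \<Longrightarrow> x \<in> W' \<Longrightarrow> g + x \<in> W'"
  unfolding W'_def using K'_add by (fastforce simp flip: add.assoc)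

lemma W'_W: "x \<in> W \<Longrightarrow> x \<in> W'" and W'_New: "a \<in> New \<Longrightarrow> x \<in> Ax a \<Longrightarrow> x \<in> W'"
  unfolding W'_def using K'_zero by force+

lemma W'_mill: "x \<in> W' \<Longrightarrow> x \<in> mill W UNIV"
proof -
  assume "x \<in> W'"
  then obtain k y where k: "k \<in> K'" and y: "y \<in> W \<or> (\<exists>a\<in>New. y \<in> Ax a)" and x: "x = k + y"
    unfolding W'_def by blast
  have "y \<in> mill W UNIV" using y by (auto intro: mill_far far_base far_axis)
  then show ?thesis unfolding x using k mill_K' by simp
qed

text \<open>Each side of a geodesic triangle is covered by the other two, so segments from
  \<open>0\<close> suffice. Those to elements of \<open>K'\<close> are covered by translates of
  segments to generators; a general point of \<open>W'\<close> adds one segment inside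
  \<open>W\<close> or from \<open>W\<close> to a new axis.\<close>

lemma W'_convex: "convex W'"
proof -
  have seg_new: "z \<in> W'" if seg: "a \<in> New" "x \<in> W" "y \<in> Ax a" "btw x z y" for a x y z
  proof -
    obtain p where p: "p \<in> Ax a" "p \<in> W" using New_meet [OF seg(1)] by blast
    from btw_cover [OF seg(4), of p] have "btw x z p \<or> btw p z y" by simp
    then show ?thesis
      using convexD [OF W_convex seg(2) p(2)] convexD [OF Ax_convex p(1) seg(3)] W'_W W'_New [OF
        seg(1)] by blast
  qed
  have seg_gen: "z \<in> W'" if sg: "btw 0 z a" "a \<in> K \<or> a \<in> New \<or> - a \<in> New" for a z
  proof (cases "a \<in> K")
    case True
    then have "a \<in> W" using W_inv [OF True W_zero] by simp
    then show ?thesis using convexD [OF W_convex W_zero] W'_W sg(1) by blast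
  next
    case False
    then have "a \<in> New \<or> - a \<in> New" using sg(2) by blast
    then obtain b where b: "b \<in> New" "b = a \<or> b = - a" by blast
    have aK: "a \<in> K'" using b New_K' K'_uminus by fastforce
    have Rot: "a \<in> gen {b}" using b gen_incl [of b] gen_incl_uminus [of b] by fastforce
    obtain p where p: "p \<in> Ax b" "p \<in> W" using New_meet [OF b(1)] by blast
    \<comment> \<open>The detour from \<open>0\<close> over \<open>a + p\<close> to \<open>a\<close>
      runs first to a point of the new axis and then in the translate of \<open>W\<close> by
      \<open>a\<close>.\<close>
    have ap: "a + p \<in> Ax b" using p Rot by simp
    from btw_cover [OF sg(1), of "a + p"] show ?thesis
    proof
      assume "btw 0 z (a + p)"
      then show ?thesis using seg_new [OF b(1) W_zero ap] by blast
    next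
      assume "btw (a + p) z a"
      then have "btw 0 (- a + z) p" using btw_shift [of a 0 z p] btw_sym by auto
      then have "- a + z \<in> W'" using convexD [OF W_convex W_zero p(2)] W'_W by blast
      from W'_K' [OF aK this] show ?thesis by simp
    qed
  qed
  have step: "z \<in> W'" if "btw 0 z (a + y)" "a \<in> K \<or> a \<in> New \<or> - a \<in> New" "\<And>z. btw 0 z y \<Longrightarrow> z \<in> W'" for a y z
  proof -
    have aK: "a \<in> K'" using that(2) K_K' New_K' K'_uminus [of "- a"] by auto
    from btw_cover [OF that(1), of a] show ?thesis
    proof
      assume "btw 0 z a" then show ?thesis using seg_gen that(2) by blast
    next
      assume "btw a z (a + y)"
      then have "- a + z \<in> W'" using that(3) btw_shift [of a 0 z y] by simp
      from W'_K' [OF aK this] show ?thesis by simp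
    qed
  qed
  have K'_seg: "z \<in> W'" if "g \<in> K'" "btw 0 z g" for g z
    using that unfolding K'_def
  proof (induction arbitrary: z rule: gen.induct)
    case gen_zero
    then show ?case using btw_same W'_W W_zero by blast
  next
    case (gen_plus a x)
    then show ?case using step [of z a x] by blast
  next
    case (gen_minus a x)
    then show ?case using step [of z "- a" x] K_uminus by auto
  qed
  have from_zero: "z \<in> W'" if zx: "x \<in> W'" "btw 0 z x" for x z
  proof -
    obtain k y where k: "k \<in> K'" and y: "y \<in> W \<or> (\<exists>a\<in>New. y \<in> Ax a)" and x: "x = k + y"
      using zx(1) unfolding W'_def by blast
    from btw_cover [OF zx(2) [unfolded x], of k] show ?thesis
    proof
      assume "btw 0 z k" then show ?thesis using K'_seg k by blast
    next
      assume "btw k z (k + y)"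
      then have "btw 0 (- k + z) y" using btw_shift [of k 0 z y] by simp
      then have "- k + z \<in> W'" using y seg_new W_zero convexD [OF W_convex W_zero] W'_W by blast
      from W'_K' [OF k this] show ?thesis by simp
    qed
  qed
  show ?thesis unfolding convex_def
  proof (intro ballI allI impI)
    fix x y z assume x: "x \<in> W'" and y: "y \<in> W'" and z: "btw x z y"
    from btw_cover [OF z, of 0] have "btw 0 z x \<or> btw 0 z y" by (simp add: btw_sym)
    then show "z \<in> W'" using from_zero [OF x] from_zero [OF y] by blast
  qed
qed

text \<open>As \<open>B\<close> avoids all translates of \<open>W\<close>, two of its points on new
  axes have the same gate in \<open>W\<close>, and their median splits the overlap into one piece on
  each axis; this gives 2/24 = 1/12. If \<open>z\<close> starts with a rotation about an axis other
  than that of \<open>a\<close>, then \<open>B\<close> would follow more than 20/24 of it. If it is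
  the same axis, undoing the rotation gives a shorter expression.\<close>

lemma overlap_far:
  assumes "far W UNIV ob z" "a \<in> New" "y \<in> Ax a" "y \<in> Ax B" "z \<in> Ax B"
    and "\<And>g w. g \<in> K' \<Longrightarrow> w \<in> W \<Longrightarrow> g + w \<notin> Ax B"
  shows "12 * d y z < len B"
  using assms
proof (induction arbitrary: a y B rule: far.induct)
  case (far_base w)
  then show ?case using K'_zero by force
next
  case (far_axis b z)
  have BW: "w \<notin> Ax B" if "w \<in> W" for w using far_axis.prems(5) [OF K'_zero that] by simp
  have Wne: "W \<noteq> {}" using W_zero by blast
  note gW = gate_in [OF W_convex Wne]
  have neq: "\<not> pm_eq B e" if "e \<in> New" for e
    using New_meet [OF that] BW Ax_pm_eq [of B e] by blast
  have gy: "gate W y \<in> Ax a"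
    using New_meet [OF \<open>a \<in> New\<close>] gate_in_meeting [OF W_convex Ax_convex \<open>y \<in> Ax a\<close>] by blast
  have gz: "gate W z \<in> Ax b"
    using New_meet [OF \<open>b \<in> New\<close>] gate_in_meeting [OF W_convex Ax_convex \<open>z \<in> Ax b\<close>] by blast
  have eq: "gate W y = gate W z"
  proof (rule ccontr)
    assume "gate W y \<noteq> gate W z"
    then have "gate W y \<in> Ax B"
      using gate_bridge(1) [OF W_convex Wne] convexD [OF Ax_convex far_axis.prems(3,4)] by blast
    then show False using BW gW by blast
  qed
  obtain m where m: "btw y m z" "btw z m (gate W y)" "btw y m (gate W y)" by (rule obtain_median)
  have mB: "m \<in> Ax B" using m(1) convexD [OF Ax_convex far_axis.prems(3,4)] by blast
  have "m \<in> Ax a" using m(3) gy convexD [OF Ax_convex \<open>y \<in> Ax a\<close>] by blast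
  then have 1: "24 * d y m < len B"
    using Ax_overlap [OF far_axis.prems(3) mB \<open>y \<in> Ax a\<close>] neq far_axis.prems by blast
  have "m \<in> Ax b" using m(2) gz eq convexD [OF Ax_convex \<open>z \<in> Ax b\<close>] by simp
  then have 2: "24 * d m z < len B"
    using Ax_overlap [OF mB far_axis.prems(4) _ \<open>z \<in> Ax b\<close>] neq far_axis.hyps by blast
  from 1 2 m(1) show ?case unfolding btw_def by linarith
next
  case (far_step b \<rho> k ob z)
  have bK: "\<rho> \<in> K'" "k \<in> K'"
    using far_step.hyps New_K' K_K' gen_least [of \<rho> "{b}" K'] K'_zero K'_add K'_uminus by auto
  show ?case
  proof (cases "pm_eq b a")
    case True
    \<comment> \<open>Undoing the rotation keeps \<open>y\<close> on \<open>Ax a\<close>, and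
      undoing \<open>k\<close> moves that axis to another new one.\<close>
    define h where "h = - k + - \<rho>"
    have h: "h \<in> K'" unfolding h_def using bK by (intro K'_add K'_uminus)
    have hz: "h + (\<rho> + (k + z)) = z" by (simp only: h_def group_norm)
    have "- \<rho> \<in> gen {a}" using far_step.hyps pm_eq_gen [OF True] gen_uminus by blast
    then have "- \<rho> + y \<in> Ax a" using far_step.prems by simp
    moreover have "h + y = - k + (- \<rho> + y)" by (simp only: h_def group_norm)
    ultimately have 1: "h + y \<in> Ax (conj_by (- k) a)" by (simp only: Ax_conj)
    have "12 * d (h + y) z < len (conj_by h B)"
    proof (rule far_step.IH [OF _ 1])
      show "conj_by (- k) a \<in> New" using far_step New_conj K_uminus by blast
      show "h + y \<in> Ax (conj_by h B)" using far_step.prems by simp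
      show "z \<in> Ax (conj_by h B)" using far_step.prems(4) Ax_conj [of h "\<rho> + (k + z)" B] hz by simp
      show "g + w \<notin> Ax (conj_by h B)" if "g \<in> K'" "w \<in> W" for g w
        using far_step.prems(5) [of "- h + g" w] that h K'_uminus K'_add
          by (simp add: Ax_conj_shift add.assoc)
    qed
    then show ?thesis using d_left [of h y "\<rho> + (k + z)"] len_conj [OF far_step.prems(3), of h] hz by simp
  next
    case False
    have BW: "w \<notin> Ax B" if "w \<in> W" for w using far_step.prems(5) [OF K'_zero that] by simp
    have neq: "\<not> pm_eq b B" using New_meet [OF \<open>b \<in> New\<close>] BW Ax_pm_eq [of b B] by blast
    have n: "near b (k + z)"
      by (rule far_near_K [OF far_step.hyps(5) order_refl far_step.hyps(1,4,6)])
    define u where "u = gate (Ax b) y"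
    define v where "v = gate (Ax b) (\<rho> + (k + z))"
    have uv: "20 * len b < 24 * d u v" unfolding u_def v_def
      using crossing [OF far_step.hyps(1) near_axis [OF far_step.hyps(1) far_step.prems(1) False
        far_step.prems(2)] n far_step.hyps(2,3)] .
    then have "u \<noteq> v" by auto
    then have "u \<in> Ax B" "v \<in> Ax B"
      using gate_image_convex [OF Ax_convex New_ne [OF \<open>b \<in> New\<close>] Ax_convex far_step.prems(3,4)]
      unfolding u_def v_def by blast+
    moreover have "u \<in> Ax b" "v \<in> Ax b"
      unfolding u_def v_def by (rule gate_in [OF Ax_convex New_ne [OF \<open>b \<in> New\<close>]])+
    ultimately have "24 * d u v < len b" using Ax_overlap neq by blast
    then show ?thesis using uv by linarith
  qed
qed

text \<open>Translated back, the axis meets \<open>W\<close> itself, so its index is new or in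
  \<open>K\<close>. In the latter case it moves a point of the axis inside \<open>W\<close> by a
  full period, which rules out the small alternative of \<open>W_axes\<close>.\<close>

lemma W'_meets_axis:
  assumes "g \<in> K'" "w \<in> W" "g + w \<in> Ax B"
  shows "B \<in> K'" "Ax B \<subseteq> W'"
proof -
  define C where "C = conj_by (- g) B"
  have w: "w \<in> Ax C" unfolding C_def using assms(3) Ax_conj [of "- g" "g + w" B] by simp
  have "C \<in> K' \<and> Ax C \<subseteq> W'"
  proof (cases "C \<in> New")
    case True then show ?thesis using New_K' W'_New by blast
  next
    case False
    then have CK: "C \<in> K" using w assms(2) by (auto simp: New_def)
    have "Ax C \<subseteq> W"
    proof (rule ccontr)
      assume "\<not> Ax C \<subseteq> W"
      then have "12 * d w (C + w) < len C"
        using W_axes [of C] w assms(2) W_inv [OF CK assms(2)] Ax_Rot [of C C w] gen_incl [of C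
          "{C}"] by blast
      moreover have "C \<noteq> 0" using Ax_nonzero [OF w] .
      then have "len C \<le> d w (C + w)" using Rot_moves [OF w gen_incl [of C]] by simp
      moreover have "0 < len C" using len_pos [OF w] .
      ultimately show False by linarith
    qed
    then show ?thesis using CK K_K' W'_W by blast
  qed
  moreover have B: "B = conj_by g C" unfolding C_def by simp
  ultimately show "B \<in> K'"
    unfolding B conj_by_def diff_conv_add_uminus using assms(1) by (intro K'_add K'_uminus) auto
  show "Ax B \<subseteq> W'"
  proof
    fix x assume "x \<in> Ax B"
    then have "- g + x \<in> Ax C" unfolding B by (simp add: Ax_conj_shift)
    then have "- g + x \<in> W'" using \<open>C \<in> K' \<and> Ax C \<subseteq> W'\<close> by blast
    from W'_K' [OF assms(1) this] show "x \<in> W'" by simp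
  qed
qed

lemma windmill_next: "windmill d Ax len K' W'"
proof
  show "0 \<in> K'" by (rule K'_zero)
  show "x + y \<in> K'" if "x \<in> K'" "y \<in> K'" for x y using that by (rule K'_add)
  show "- x \<in> K'" if "x \<in> K'" for x using that by (rule K'_uminus)
  show "convex W'" by (rule W'_convex)
  show "0 \<in> W'" using W_zero by (rule W'_W)
  show "k + w \<in> W'" if "k \<in> K'" "w \<in> W'" for k w using that by (rule W'_K')
  show "(B \<in> K' \<and> Ax B \<subseteq> W') \<or> (\<forall>x\<in>Ax B \<inter> W'. \<forall>y\<in>Ax B \<inter> W'. 12 * d x y < len B)" for B
  proof (cases "\<exists>g w. g \<in> K' \<and> w \<in> W \<and> g + w \<in> Ax B")
    case True
    then show ?thesis using W'_meets_axis by blast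
  next
    case False
    have "12 * d x y < len B" if x: "x \<in> Ax B" "x \<in> W'" and y: "y \<in> Ax B" "y \<in> W'" for x y
    proof -
      obtain g p where g: "g \<in> K'" and p: "p \<in> W \<or> (\<exists>a\<in>New. p \<in> Ax a)" and xg: "x = g + p"
        using x(2) unfolding W'_def by blast
      then obtain a where a: "a \<in> New" "p \<in> Ax a" using False x by blast
      have "- g + y \<in> mill W UNIV" by (intro W'_mill W'_K' K'_uminus g y(2))
      then obtain k z ob where k: "k \<in> K" and z: "far W UNIV ob z" and yz: "- g + y = k + z"
        unfolding mill_def by blast
      \<comment> \<open>Normalise so that \<open>y\<close> becomes the end of an alternating
        expression while \<open>x\<close> stays on a new axis.\<close>
      define h where "h = - k + - g"
      have h: "h \<in> K'" unfolding h_def using k K_K' g by (intro K'_add K'_uminus) auto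
      have hx: "h + x = - k + p" unfolding h_def xg by (simp only: group_norm)
      have hy: "h + y = z" unfolding h_def using yz by (simp only: group_norm)
      have "12 * d (h + x) (h + y) < len (conj_by h B)"
      proof (rule overlap_far)
        show "far W UNIV ob (h + y)" using z hy by simp
        show "conj_by (- k) a \<in> New" using a New_conj k K_uminus by blast
        show "h + x \<in> Ax (conj_by (- k) a)" unfolding hx using a by simp
        show "h + x \<in> Ax (conj_by h B)" "h + y \<in> Ax (conj_by h B)" using x y by simp_all
        show "g' + w \<notin> Ax (conj_by h B)" if "g' \<in> K'" "w \<in> W" for g' w
        proof
          assume "g' + w \<in> Ax (conj_by h B)"
          then have "(- h + g') + w \<in> Ax B" by (simp add: Ax_conj_shift add.assoc)
          then show False using False that h K'_add K'_uminus by blast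
        qed
      qed
      then show ?thesis by (simp add: d_left len_conj [OF x(1)])
    qed
    then show ?thesis by blast
  qed
qed

end

section \<open>Greendlinger's lemma\<close>

text \<open>A broken path. A side \<open>(c, n, z)\<close> lies on the axis \<open>c\<close> and
  ends at \<open>z\<close>; \<open>n\<close> bounds its length in the cone over the axis and is
  ignored by the geometric predicate \<open>on_axis\<close>.\<close>

fun chain :: "('g \<Rightarrow> nat \<Rightarrow> 'g \<Rightarrow> 'g \<Rightarrow> bool) \<Rightarrow> 'g \<Rightarrow> ('g \<times> nat \<times> 'g) list \<Rightarrow> 'g \<Rightarrow> bool" where
  "chain P x [] y \<longleftrightarrow> x = y"
| "chain P x ((c, n, z) # sd) y \<longleftrightarrow> P c n x z \<and> chain P z sd y"

lemma chain_append: "chain P x (A @ B) y \<longleftrightarrow> (\<exists>v. chain P x A v \<and> chain P v B y)"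
  by (induction A arbitrary: x) auto

definition weight :: "('g \<times> nat \<times> 'g) list \<Rightarrow> nat" where
  "weight sd = (\<Sum>(c, n, z)\<leftarrow>sd. n)"

lemma weight_simps [simp]: "weight [] = 0" "weight ((c, n, z) # sd) = n + weight sd"
  "weight (A @ B) = weight A + weight B"
  by (simp_all add: weight_def)

lemma not_sorted_wrt_split:
  "\<not> sorted_wrt P xs \<Longrightarrow> \<exists>A s B s' C. xs = A @ s # B @ s' # C \<and> \<not> P s s'"
proof (induction xs)
  case (Cons a xs)
  show ?case
  proof (cases "sorted_wrt P xs")
    case True
    then obtain s where "s \<in> set xs" "\<not> P a s" using Cons.prems by auto
    then obtain B C where "xs = B @ s # C" by (meson split_list)
    then have "a # xs = [] @ a # B @ s # C" by simp
    then show ?thesis using \<open>\<not> P a s\<close> by blast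
  next
    case False
    then obtain A s B s' C where "xs = A @ s # B @ s' # C" "\<not> P s s'" using Cons.IH by blast
    then have "a # xs = (a # A) @ s # B @ s' # C" by simp
    then show ?thesis using \<open>\<not> P s s'\<close> by blast
  qed
qed simp

text \<open>One step leads to a polygon with at most \<open>m\<close> sides and weight at most
  \<open>3 * w + 3 * m + 20\<close>, plus a correction of at most that size. In
  \<open>polygon_cut\<close> the new sides cost at most the old weight, a second copy of the two
  extreme sides, three times the number of sides between them, and 6; the recursion rounds this
  up.\<close>

fun polygon_bound :: "nat \<Rightarrow> nat \<Rightarrow> nat" where
  "polygon_bound 0 w = w"
| "polygon_bound (Suc m) w = polygon_bound m (3 * w + 3 * m + 20) + (3 * w + 3 * m + 20)"

lemma polygon_bound_mono_weight: "w \<le> w' \<Longrightarrow> polygon_bound m w \<le> polygon_bound m w'"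
proof (induction m arbitrary: w w')
  case (Suc m)
  have "polygon_bound m (3 * w + 3 * m + 20) \<le> polygon_bound m (3 * w' + 3 * m + 20)"
    by (rule Suc.IH) (use Suc.prems in simp)
  then show ?case using Suc.prems unfolding polygon_bound.simps by linarith
qed simp

lemma polygon_bound_mono: "m \<le> m' \<Longrightarrow> w \<le> w' \<Longrightarrow> polygon_bound m w \<le> polygon_bound m' w'"
proof (induction m' arbitrary: w')
  case 0 then show ?case by simp
next
  case (Suc m')
  show ?case
  proof (cases "m = Suc m'")
    case True then show ?thesis using Suc.prems polygon_bound_mono_weight by blast
  next
    case False
    then have "polygon_bound m w \<le> polygon_bound m' w'" using Suc by simp
    also have "\<dots> \<le> polygon_bound m' (3 * w' + 3 * m' + 20)" by (rule polygon_bound_mono_weight) simp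
    finally show ?thesis by simp
  qed
qed

lemma polygon_bound_ge: "w \<le> polygon_bound m w"
  using polygon_bound_mono [of 0 m w w] by simp

section \<open>Exhaustion of tree and normal closure by windmills\<close>

context axis_system
begin

primrec mills :: "nat \<Rightarrow> 'g set \<times> 'g set" where
  "mills 0 = ({0}, {0})"
| "mills (Suc n) = (windmill.K' Ax (fst (mills n)) (snd (mills n)),
  windmill.W' Ax (fst (mills n)) (snd (mills n)))"

lemma windmill_mills: "windmill d Ax len (fst (mills n)) (snd (mills n))"
proof (induction n)
  case 0
  show ?case by unfold_locales (auto simp: convex_sing len_pos)
next
  case (Suc n)
  then interpret windmill d Ax len "fst (mills n)" "snd (mills n)" .
  show ?case using windmill_next by simp
qed

lemma mills_mono: "n \<le> m \<Longrightarrow> fst (mills n) \<subseteq> fst (mills m) \<and> snd (mills n) \<subseteq> snd (mills m)"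
proof (induction m rule: dec_induct)
  case (step m)
  interpret windmill d Ax len "fst (mills m)" "snd (mills m)" by (rule windmill_mills)
  show ?case using step.IH K_K' W'_W by auto
qed simp

lemma mills_axis:
  assumes "x \<in> snd (mills n)" "x \<in> Ax c"
  shows "c \<in> fst (mills (Suc n))" "Ax c \<subseteq> snd (mills (Suc n))"
proof -
  interpret windmill d Ax len "fst (mills n)" "snd (mills n)" by (rule windmill_mills)
  have "0 + x \<in> Ax c" using assms by simp
  from W'_meets_axis [OF K'_zero assms(1) this]
  show "c \<in> fst (mills (Suc n))" "Ax c \<subseteq> snd (mills (Suc n))" by auto
qed

text \<open>By \<open>Ax_cover\<close> some axis joins \<open>x\<close> to a point closer to
  \<open>0\<close>. The stage after the one that contains the closer point absorbs the whole
  axis.\<close>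

lemma mills_exhaust: "\<exists>n. x \<in> snd (mills n)"
proof (induction "d 0 x" arbitrary: x rule: less_induct)
  case less
  show ?case
  proof (cases "x = 0")
    case True then show ?thesis by (intro exI [of _ 0]) simp
  next
    case False
    then obtain z c where z: "btw 0 z x" "z \<noteq> x" "z \<in> Ax c" "x \<in> Ax c" using Ax_cover [of 0 x] by metis
    have "d z x \<noteq> 0" using z(2) d_zero by simp
    then have "d 0 z < d 0 x" using z(1) unfolding btw_def by linarith
    then obtain n where "z \<in> snd (mills n)" using less by blast
    then show ?thesis using mills_axis(2) z by blast
  qed
qed

text \<open>In the application the elements with an axis are the conjugates of the words in
  \<open>RR\<close>, so this is the normal closure of \<open>RR\<close>.\<close>

definition N :: "'g set" where "N = gen {c. Ax c \<noteq> {}}"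

lemma N_mills: "\<nu> \<in> N \<Longrightarrow> \<exists>n. \<nu> \<in> fst (mills n)"
proof -
  let ?K = "\<Union>n. fst (mills n)"
  have add: "x + y \<in> ?K" if xy: "x \<in> ?K" "y \<in> ?K" for x y
  proof -
    obtain m n where "x \<in> fst (mills m)" "y \<in> fst (mills n)" using xy by blast
    then have "x \<in> fst (mills (max m n))" "y \<in> fst (mills (max m n))"
      using mills_mono [of m "max m n"] mills_mono [of n "max m n"] by auto
    then show ?thesis using windmill.K_add [OF windmill_mills] by blast
  qed
  have um: "- x \<in> ?K" if "x \<in> ?K" for x
    using that windmill.K_uminus [OF windmill_mills] by blast
  have incl: "c \<in> ?K" if c: "Ax c \<noteq> {}" for c
  proof -
    obtain x where "x \<in> Ax c" using c by blast
    then show ?thesis using mills_exhaust [of x] mills_axis(1) by blast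
  qed
  have zero: "0 \<in> ?K" using windmill.K_zero [OF windmill_mills] by blast
  assume "\<nu> \<in> N"
  then have "\<nu> \<in> ?K" unfolding N_def
  proof (rule gen_least)
    show "{c. Ax c \<noteq> {}} \<subseteq> ?K" using incl by (intro subsetI) simp
  qed (fact zero add um)+
  then show ?thesis by blast
qed

lemma N_zero: "0 \<in> N" and N_add: "x \<in> N \<Longrightarrow> y \<in> N \<Longrightarrow> x + y \<in> N" and N_uminus: "x \<in> N \<Longrightarrow> - x \<in> N"
  unfolding N_def by (rule gen_add gen_uminus gen_zero; assumption)+

lemma N_conj: "x \<in> N \<Longrightarrow> conj_by h x \<in> N"
  unfolding N_def
proof (induction rule: gen.induct)
  case (gen_plus a x)
  then have "Ax (conj_by h a) \<noteq> {}" using Ax_conj' by blast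
  with gen_plus show ?case by (simp add: conj_by_add gen.gen_plus)
next
  case (gen_minus a x)
  then have "Ax (conj_by h a) \<noteq> {}" using Ax_conj' by blast
  with gen_minus show ?case by (simp add: conj_by_add conj_by_uminus gen.gen_minus)
qed (simp add: gen_zero)

lemma Rot_N: "x \<in> Ax c \<Longrightarrow> \<rho> \<in> gen {c} \<Longrightarrow> \<rho> \<in> N"
  unfolding N_def by (erule gen_mono) auto

text \<open>Consider the first stage whose group contains \<open>\<nu>\<close>. It is not the
  initial, trivial one, so \<open>\<nu>\<close> is new with respect to the stage before.\<close>

lemma relator_exposed_zero:
  assumes "\<nu> \<in> N" "\<nu> \<noteq> 0"
  shows "\<exists>c p q. p \<in> Ax c \<and> q \<in> Ax c \<and> btw 0 p \<nu> \<and> btw 0 q \<nu> \<and> 20 * len c < 24 * d p q"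
proof -
  define n where "n = (LEAST n. \<nu> \<in> fst (mills n))"
  have n: "\<nu> \<in> fst (mills n)" unfolding n_def using N_mills [OF assms(1)] by (rule LeastI_ex)
  then have "n \<noteq> 0" using assms(2) by (intro notI) simp
  then obtain m where m: "n = Suc m" using not0_implies_Suc by blast
  then have "m < n" by simp
  then have nm: "\<nu> \<notin> fst (mills m)" unfolding n_def by (rule not_less_Least)
  interpret windmill d Ax len "fst (mills m)" "snd (mills m)" by (rule windmill_mills)
  show ?thesis using new_relator_exposed [OF _ nm] n m by auto
qed

text \<open>Greendlinger's lemma, in terms of lifts to the tree.\<close>

theorem relator_exposed:
  assumes "\<nu> \<in> N" "\<nu> \<noteq> 0"
  shows "\<exists>c p q. p \<in> Ax c \<and> q \<in> Ax c \<and> btw x p (\<nu> + x) \<and> btw x q (\<nu> + x) \<and> 20 * len c < 24 * d p q"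
proof -
  have "conj_by (- x) \<nu> \<noteq> 0" using assms(2) conj_by_eq_iff [of "- x" \<nu> 0] by simp
  from relator_exposed_zero [OF N_conj [OF assms(1)] this]
  obtain c p q where c: "p \<in> Ax c" "q \<in> Ax c" "btw 0 p (conj_by (- x) \<nu>)" "btw 0 q (conj_by (- x) \<nu>)"
    "20 * len c < 24 * d p q" by blast
  have eq: "x + conj_by (- x) \<nu> = \<nu> + x" by (simp only: conj_by_def group_norm)
  have "btw x (x + p) (\<nu> + x)" "btw x (x + q) (\<nu> + x)"
    using btw_translate [of x 0 _ "conj_by (- x) \<nu>"] c unfolding eq by auto
  then show ?thesis using c len_conj [of p c x]
    by (intro exI [of _ "conj_by x c"] exI [of _ "x + p"] exI [of _ "x + q"]) (simp add: d_left)
qed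

section \<open>Covering a geodesic by the sides of a broken path\<close>

definition on_axis :: "'g \<Rightarrow> nat \<Rightarrow> 'g \<Rightarrow> 'g \<Rightarrow> bool" where
  "on_axis c n x y \<longleftrightarrow> x \<in> Ax c \<and> y \<in> Ax c"

definition has_side where
  "has_side P x F y Q \<longleftrightarrow> (\<exists>A c n v w B. F = A @ (c, n, w) # B \<and> chain P x A v \<and> P c n v w \<and>
    chain P w B y \<and> Q c v w)"

lemma has_side_here:
  assumes "P c n x z" "chain P z F y" "Q c x z"
  shows "has_side P x ((c, n, z) # F) y Q"
proof -
  have "(c, n, z) # F = [] @ (c, n, z) # F \<and> chain P x [] x" by simp
  then show ?thesis unfolding has_side_def using assms by blast
qed

lemma has_side_later:
  assumes "P c n x z" "has_side P z F y Q"
  shows "has_side P x ((c, n, z) # F) y Q"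
proof -
  obtain A e m v w B where F: "F = A @ (e, m, w) # B" "chain P z A v" "P e m v w" "chain P w B y" "Q e v w"
    using assms(2) unfolding has_side_def by blast
  then have "(c, n, z) # F = ((c, n, z) # A) @ (e, m, w) # B \<and> chain P x ((c, n, z) # A) v"
    using assms(1) by simp
  then show ?thesis unfolding has_side_def using F by blast
qed

lemma chain_cover: "chain P x F y \<Longrightarrow> btw x p y \<Longrightarrow> F \<noteq> [] \<Longrightarrow> has_side P x F y (\<lambda>c v w. btw v p w)"
proof (induction F arbitrary: x)
  case (Cons s F)
  obtain c n z where s: "s = (c, n, z)" by (cases s)
  have P: "P c n x z" and F: "chain P z F y" using Cons.prems s by auto
  have *: "has_side P x (s # F) y (\<lambda>c v w. btw v p w)" if "btw x p z"
    unfolding s using has_side_here [OF P F, of "\<lambda>c v w. btw v p w"] that by simp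
  show ?case
  proof (cases "F = []")
    case True
    then show ?thesis using * Cons.prems F by auto
  next
    case False
    from btw_cover [OF Cons.prems(2), of z] show ?thesis
      using * Cons.IH [OF F _ False] has_side_later [of P c n x z F y, OF P] s by blast
  qed
qed simp

definition split_at where
  "split_at P x F y p q \<longleftrightarrow> (\<exists>A c n v w M c' n' v' w' B. F = A @ (c, n, w) # M @ (c', n', w') # B \<and>
    chain P x A v \<and> P c n v w \<and> chain P w M v' \<and> P c' n' v' w' \<and> chain P w' B y \<and> btw v p w \<and> btw v' q w')"

lemma split_at_alt:
  "split_at P x F y p q \<longleftrightarrow> (\<exists>A c n v w F'. F = A @ (c, n, w) # F' \<and> chain P x A v \<and> P c n v w \<and>
    btw v p w \<and> has_side P w F' y (\<lambda>c v w. btw v q w))"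
  unfolding split_at_def has_side_def by blast

lemma split_at_here:
  assumes "P c n x z" "btw x p z" "has_side P z F y (\<lambda>c v w. btw v q w)"
  shows "split_at P x ((c, n, z) # F) y p q"
proof -
  have "(c, n, z) # F = [] @ (c, n, z) # F \<and> chain P x [] x" by simp
  then show ?thesis unfolding split_at_alt using assms by blast
qed

lemma split_at_later:
  assumes "P c n x z" "split_at P z F y p q"
  shows "split_at P x ((c, n, z) # F) y p q"
proof -
  obtain A e m v w F' where F: "F = A @ (e, m, w) # F'" "chain P z A v" "P e m v w" "btw v p w"
    "has_side P w F' y (\<lambda>c v w. btw v q w)"
    using assms(2) unfolding split_at_alt by blast
  then have "(c, n, z) # F = ((c, n, z) # A) @ (e, m, w) # F' \<and> chain P x ((c, n, z) # A) v"
    using assms(1) by simp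
  then show ?thesis unfolding split_at_alt using F by blast
qed

text \<open>The path need not meet \<open>p\<close> and \<open>q\<close> in the order in which they
  lie on the geodesic, which is why both orders of \<open>split_at\<close> occur.\<close>

lemma chain_cover2:
  "chain P x F y \<Longrightarrow> btw x p y \<Longrightarrow> btw x q y \<Longrightarrow> F \<noteq> [] \<Longrightarrow>
    has_side P x F y (\<lambda>c v w. btw v p w \<and> btw v q w) \<or> split_at P x F y p q \<or> split_at P x F y q p"
proof (induction F arbitrary: x)
  case (Cons s F)
  obtain c n z where s: "s = (c, n, z)" by (cases s)
  have P: "P c n x z" and F: "chain P z F y" using Cons.prems s by auto
  show ?case
  proof (cases "F = []")
    case True
    then show ?thesis
      unfolding s using has_side_here [OF P F, of "\<lambda>c v w. btw v p w \<and> btw v q w"] Cons.prems F by simp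
  next
    case False
    have p: "btw x p z \<or> btw z p y" and q: "btw x q z \<or> btw z q y"
      using btw_cover Cons.prems by blast+
    have later: "split_at P x (s # F) y p' q'" if "btw x p' z" "btw z q' y" for p' q'
      unfolding s by (rule split_at_here [OF P that(1) chain_cover [OF F that(2) False]])
    consider "btw x p z" "btw x q z" | "btw x p z" "btw z q y" | "btw z p y"
      "btw x q z" | "btw z p y" "btw z q y"
      using p q by blast
    then show ?thesis
    proof cases
      case 1
      then show ?thesis unfolding s using has_side_here [OF P F, of "\<lambda>c v w. btw v p w \<and> btw v q w"] by simp
    next
      case 4
      from Cons.IH [OF F 4 False] show ?thesis
        unfolding s using has_side_later [of P c n x z F y, OF P] split_at_later [of P c n x z F y,
          OF P] by blast
    qed (use later in blast)+
  qed
qed simp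

lemma d_btw2: "btw v p w \<Longrightarrow> btw v q w \<Longrightarrow> d p q \<le> d v w"
proof -
  assume a: "btw v p w" "btw v q w"
  from btw_cases [OF a] show ?thesis
    using a d_comm [of p q] unfolding btw_def by (elim disjE) linarith+
qed

section \<open>Projections of sides to an axis\<close>

lemma gate_overlap:
  assumes "v \<in> Ax f" "w \<in> Ax f" "\<not> pm_eq e f" "Ax e \<noteq> {}"
  shows "gate (Ax e) v = gate (Ax e) w \<or> gate (Ax e) v \<in> Ax f \<and> gate (Ax e) w \<in> Ax f"
  using gate_image_convex [OF Ax_convex assms(4) Ax_convex assms(1,2)] by blast

fun short :: "'g \<Rightarrow> ('g \<times> nat \<times> 'g) list \<Rightarrow> bool" where
  "short x [] \<longleftrightarrow> True"
| "short x ((c, n, z) # sd) \<longleftrightarrow> 2 * d x z \<le> len c \<and> short z sd"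

lemma short_append: "chain P x A v \<Longrightarrow> short x (A @ B) \<longleftrightarrow> short x A \<and> short v B"
  by (induction A arbitrary: x) auto

lemma side_gate_length:
  assumes "v \<in> Ax f" "w \<in> Ax f" "Ax e \<noteq> {}" "2 * d v w \<le> len f"
  shows "24 * d (gate (Ax e) v) (gate (Ax e) w) \<le> len e + (if pm_eq e f then 12 * len e else 0)"
proof (cases "pm_eq e f")
  case True
  then have "Ax e = Ax f" by (rule Ax_pm_eq)
  moreover have "len e = len f" using assms(3) len_pm_eq [OF True] by blast
  ultimately show ?thesis using True assms by (simp add: gate_self [OF Ax_convex])
next
  case False
  note gin = gate_in [OF Ax_convex assms(3)]
  from gate_overlap [OF assms(1,2) False assms(3)] show ?thesis
  proof
    assume "gate (Ax e) v \<in> Ax f \<and> gate (Ax e) w \<in> Ax f"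
    then have "24 * d (gate (Ax e) v) (gate (Ax e) w) < len e"
      using Ax_overlap [of "gate (Ax e) v" e "gate (Ax e) w" f] gin False by blast
    then show ?thesis by simp
  qed simp
qed

definition count_axis :: "'g \<Rightarrow> ('g \<times> nat \<times> 'g) list \<Rightarrow> nat" where
  "count_axis e F = length (filter (\<lambda>s. pm_eq e (fst s)) F)"

lemma chain_gate_length:
  assumes "chain on_axis v A w" "Ax e \<noteq> {}" "short v A"
  shows "24 * d (gate (Ax e) v) (gate (Ax e) w) \<le> (length A + 12 * count_axis e A) * len e"
  using assms
proof (induction A arbitrary: v)
  case (Cons s A)
  obtain c n z where s: "s = (c, n, z)" by (cases s)
  have "24 * d (gate (Ax e) v) (gate (Ax e) z) \<le> len e + (if pm_eq e c then 12 * len e else 0)"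
    using Cons.prems s by (intro side_gate_length) (auto simp: on_axis_def)
  moreover have "24 * d (gate (Ax e) z) (gate (Ax e) w) \<le> (length A + 12 * count_axis e A) * len e"
    using Cons s by simp
  moreover have "d (gate (Ax e) v) (gate (Ax e) w) \<le> d (gate (Ax e) v) (gate (Ax e) z) + d (gate
    (Ax e) z) (gate (Ax e) w)"
    by (rule d_tri)
  ultimately have "24 * d (gate (Ax e) v) (gate (Ax e) w) \<le> (len e + (if pm_eq e c then 12 * len e else 0))
     + (length A + 12 * count_axis e A) * len e" by linarith
  then show ?case by (simp add: s count_axis_def algebra_simps split: if_splits)
qed simp

abbreviation distinct_axes :: "('g \<times> nat \<times> 'g) list \<Rightarrow> bool" where
  "distinct_axes \<equiv> sorted_wrt (\<lambda>s t. \<not> pm_eq (fst s) (fst t))"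

lemma count_axis_le_1: "distinct_axes F \<Longrightarrow> count_axis e F \<le> 1"
proof (induction F)
  case (Cons s F)
  have "count_axis e F = 0" if e: "pm_eq e (fst s)"
  proof -
    have "\<not> pm_eq e (fst t)" if "t \<in> set F" for t
      using Cons.prems that e pm_eq_sym [of e "fst s"] pm_eq_trans by auto
    then show ?thesis by (simp add: count_axis_def filter_empty_conv)
  qed
  then show ?case using Cons by (auto simp: count_axis_def)
qed (simp add: count_axis_def)

definition translate :: "'g \<Rightarrow> ('g \<times> nat \<times> 'g) list \<Rightarrow> ('g \<times> nat \<times> 'g) list" where
  "translate h = map (\<lambda>(c, n, z). (conj_by h c, n, h + z))"

lemma translate_simps [simp]: "length (translate h F) = length F" "weight (translate h F) = weight F"
  by (induction F) (auto simp: translate_def)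

text \<open>The geometric length, in contrast to \<open>weight\<close>; it is the measure that
  decreases when an overlong side is rotated.\<close>

fun total :: "'g \<Rightarrow> ('g \<times> nat \<times> 'g) list \<Rightarrow> nat" where
  "total x [] = 0"
| "total x ((c, n, z) # sd) = d x z + total z sd"

lemma total_append: "chain P x A v \<Longrightarrow> total x (A @ B) = total x A + total v B"
  by (induction A arbitrary: x) auto

lemma total_translate: "total (h + x) (translate h F) = total x F"
  by (induction F arbitrary: x) (auto simp: translate_def d_left)

lemma not_short_split:
  "chain P x F y \<Longrightarrow> \<not> short x F \<Longrightarrow> has_side P x F y (\<lambda>c v w. len c < 2 * d v w)"
proof (induction F arbitrary: x)
  case (Cons s F)
  obtain c n z where s: "s = (c, n, z)" by (cases s)
  have P: "P c n x z" and F: "chain P z F y" using Cons.prems s by auto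
  show ?case
  proof (cases "2 * d x z \<le> len c")
    case True
    then have "\<not> short z F" using Cons.prems s by simp
    from has_side_later [of P c n x z F y, OF P Cons.IH [OF F this]] show ?thesis unfolding s .
  next
    case False
    then show ?thesis unfolding s using has_side_here [OF P F, of "\<lambda>c v w. len c < 2 * d v w"] by simp
  qed
qed simp

end

section \<open>Polygons with sides on axes\<close>

lemma chain_unique: "chain P x A v \<Longrightarrow> chain Q x A v' \<Longrightarrow> v = v'"
  by (induction A arbitrary: x) auto

lemma polygon_bound_ge': "m + w \<le> polygon_bound m w"
proof (cases m)
  case (Suc k)
  then show ?thesis using polygon_bound_ge [of "3 * w + 3 * k + 20" k] by simp
qed simp

text \<open>\<open>reach c n x y\<close> stands for two points of the axis whose images in the cone
  have distance at most \<open>n\<close>. \<open>reach_Rot\<close> holds as the cone is a quotient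
  of the axis by its rotations, and \<open>reach_overlap\<close> as pieces are labels of cone
  edges.\<close>

locale cone_system = axis_system d Ax len
  for d :: "'g::group_add \<Rightarrow> 'g \<Rightarrow> nat" and Ax :: "'g \<Rightarrow> 'g set" and len :: "'g \<Rightarrow> nat" +
  fixes reach :: "'g \<Rightarrow> nat \<Rightarrow> 'g \<Rightarrow> 'g \<Rightarrow> bool"
  assumes reach_Ax: "reach c n x y \<Longrightarrow> x \<in> Ax c \<and> y \<in> Ax c"
    and reach_refl: "x \<in> Ax c \<Longrightarrow> reach c 0 x x"
    and reach_sym: "reach c n x y \<Longrightarrow> reach c n y x"
    and reach_trans: "reach c m x y \<Longrightarrow> reach c n y z \<Longrightarrow> reach c (m + n) x z"
    and reach_mono: "reach c m x y \<Longrightarrow> m \<le> n \<Longrightarrow> reach c n x y"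
    and reach_Rot: "reach c n x y \<Longrightarrow> \<rho> \<in> gen {c} \<Longrightarrow> reach c n x (\<rho> + y)"
    and reach_conj: "reach c n x y \<Longrightarrow> reach (conj_by h c) n (h + x) (h + y)"
    and reach_pm: "pm_eq c c' \<Longrightarrow> reach c n x y \<Longrightarrow> reach c' n x y"
    and reach_overlap: "x \<in> Ax c \<Longrightarrow> y \<in> Ax c \<Longrightarrow> x \<in> Ax c' \<Longrightarrow> y \<in> Ax c' \<Longrightarrow> \<not> pm_eq c c' \<Longrightarrow> reach c 1 x y"
begin

lemma chain_translate: "chain reach x F y \<Longrightarrow> chain reach (h + x) (translate h F) (h + y)"
  by (induction F arbitrary: x) (auto simp: translate_def reach_conj)

lemma chain_on_axis: "chain reach x F y \<Longrightarrow> chain on_axis x F y"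
  by (induction F arbitrary: x) (auto simp: on_axis_def dest: reach_Ax)

text \<open>The projection is a point or an overlap of two axes, which is one edge of the cone. The
  weight of the side does not enter.\<close>

lemma side_proj_ne:
  assumes "v \<in> Ax f" "w \<in> Ax f" "\<not> pm_eq e f" "Ax e \<noteq> {}"
  shows "reach e 1 (gate (Ax e) v) (gate (Ax e) w)"
  using gate_overlap [OF assms]
proof
  note gin = gate_in [OF Ax_convex assms(4)]
  show ?thesis if "gate (Ax e) v = gate (Ax e) w"
    using that reach_mono [OF reach_refl [OF gin]] by simp
  show ?thesis if "gate (Ax e) v \<in> Ax f \<and> gate (Ax e) w \<in> Ax f"
    using that reach_overlap [OF gin gin _ _ assms(3)] by blast
qed

lemma side_proj:
  assumes "v \<in> Ax f" "w \<in> Ax f" "pm_eq e f \<Longrightarrow> reach f n v w" "Ax e \<noteq> {}"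
  shows "reach e (n + 1) (gate (Ax e) v) (gate (Ax e) w)"
proof (cases "pm_eq e f")
  case True
  then have "reach e n v w" using assms(3) reach_pm pm_eq_sym by blast
  moreover have "Ax e = Ax f" using True by (rule Ax_pm_eq)
  ultimately show ?thesis using assms(1,2) reach_mono by (simp add: gate_self [OF Ax_convex])
next
  case False
  from reach_mono [OF side_proj_ne [OF assms(1,2) False assms(4)]] show ?thesis by simp
qed

lemma chain_proj:
  assumes "chain reach v A w" "Ax e \<noteq> {}"
  shows "reach e (weight A + length A) (gate (Ax e) v) (gate (Ax e) w)"
  using assms(1)
proof (induction A arbitrary: v)
  case Nil
  then show ?case using reach_refl [OF gate_in [OF Ax_convex assms(2)]] by simp
next
  case (Cons s A)
  obtain f n z where s: "s = (f, n, z)" by (cases s)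
  have f: "reach f n v z" and A: "chain reach z A w" using Cons.prems s by auto
  have "reach e (n + 1) (gate (Ax e) v) (gate (Ax e) z)"
    using f reach_Ax [OF f] by (intro side_proj [OF _ _ _ assms(2)]) auto
  from reach_trans [OF this Cons.IH [OF A]] show ?case by (rule reach_mono) (simp add: s)
qed

text \<open>Since no side has the axis \<open>e\<close>, each costs one. Only positions on axes are
  required, so the path may pass through points without any known cone distance;
  \<open>polygon_cut\<close> relies on this.\<close>

lemma chain_proj_ne:
  assumes "chain on_axis v A w" "\<forall>s\<in>set A. \<not> pm_eq e (fst s)" "v \<in> Ax e" "w \<in> Ax e"
  shows "reach e (length A) v w"
proof -
  have ne: "Ax e \<noteq> {}" using assms by auto
  have "reach e (length A) (gate (Ax e) v) (gate (Ax e) w)"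
    using assms(1,2)
  proof (induction A arbitrary: v)
    case Nil
    then show ?case using reach_refl [OF gate_in [OF Ax_convex ne]] by simp
  next
    case (Cons s A)
    obtain f n z where s: "s = (f, n, z)" by (cases s)
    have "reach e 1 (gate (Ax e) v) (gate (Ax e) z)"
      using Cons.prems s by (intro side_proj_ne [OF _ _ _ ne]) (auto simp: on_axis_def)
    from reach_trans [OF this Cons.IH] Cons.prems show ?case by (simp add: s)
  qed
  then show ?thesis using assms(3,4) by (simp add: gate_self [OF Ax_convex])
qed

definition prior_bound :: "nat \<Rightarrow> nat \<Rightarrow> nat" where
  "prior_bound m w = polygon_bound (m - 1) (3 * w + 3 * (m - 1) + 20)"

text \<open>The induction hypothesis. The base from \<open>x\<close> to \<open>z\<close> has unknown
  cone length, and the other sides \<open>sd\<close> lead from \<open>z\<close> to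
  \<open>\<nu> + x\<close>, so the polygon closes modulo \<open>N\<close>.\<close>

definition polygon_ok :: "nat \<Rightarrow> bool" where
  "polygon_ok m \<longleftrightarrow> (\<forall>x z sd \<nu> c. length sd < m \<longrightarrow> chain reach z sd (\<nu> + x) \<longrightarrow> \<nu> \<in> N \<longrightarrow>
    x \<in> Ax c \<longrightarrow> z \<in> Ax c \<longrightarrow> reach c (polygon_bound (length sd) (weight sd)) x z)"

lemma polygon_okD:
  assumes "polygon_ok m" "chain reach z sd (\<nu> + x)" "\<nu> \<in> N" "x \<in> Ax c" "z \<in> Ax c"
    and "length sd < m" "weight sd \<le> 3 * w + 3 * (m - 1) + 20"
  shows "reach c (prior_bound m w) x z"
proof -
  have "reach c (polygon_bound (length sd) (weight sd)) x z"
    using assms unfolding polygon_ok_def by blast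
  then show ?thesis by (rule reach_mono) (use assms polygon_bound_mono in \<open>simp add: prior_bound_def\<close>)
qed

lemma polygon_finish:
  assumes "reach c (prior_bound m w) x y" "reach c k y z" "0 < m"
    and "k \<le> 3 * w + 3 * (m - 1) + 20"
  shows "reach c (polygon_bound m w) x z"
  using reach_mono [OF reach_trans [OF assms(1,2)], of "polygon_bound m w"] assms(3,4)
  by (cases m) (auto simp: prior_bound_def)

text \<open>The side on the axis of the base becomes part of a new base from \<open>x\<close> to
  \<open>w\<close>, for which only the sides \<open>B\<close> remain. The path from \<open>z\<close>
  to \<open>v\<close> that is left out is projected to \<open>c\<close>.\<close>

lemma polygon_merge_first:
  assumes ok: "polygon_ok (length sd)" and ch: "chain reach z sd (\<nu> + x)" and \<nu>: "\<nu> \<in> N"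
    and x: "x \<in> Ax c" and z: "z \<in> Ax c" and sd: "sd = A @ (f, n, w) # B" and eq: "pm_eq c f"
  shows "reach c (polygon_bound (length sd) (weight sd)) x z"
proof -
  obtain v where A: "chain reach z A v" and f: "reach f n v w" and B: "chain reach w B (\<nu> + x)"
    using ch unfolding sd by (auto simp: chain_append)
  have cvw: "reach c n v w" using f eq reach_pm pm_eq_sym by blast
  then have v: "v \<in> Ax c" and w: "w \<in> Ax c" using reach_Ax by auto
  have 1: "reach c (prior_bound (length sd) (weight sd)) x w"
    by (rule polygon_okD [OF ok B \<nu> x w]) (simp_all add: sd)
  have "reach c (weight A + length A) z v"
    using chain_proj [OF A, of c] x z v by (auto simp: gate_self [OF Ax_convex])
  then have 2: "reach c (n + (weight A + length A)) w z"
    using reach_trans [OF reach_sym [OF cvw]] reach_sym by blast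
  show ?thesis by (rule polygon_finish [OF 1 2]) (simp_all add: sd)
qed

text \<open>The sides between the two are projected to the common axis, which bounds the cone length
  of the merged side.\<close>

lemma polygon_merge:
  assumes ok: "polygon_ok (length sd)" and ch: "chain reach z sd (\<nu> + x)" and \<nu>: "\<nu> \<in> N"
    and x: "x \<in> Ax c" and z: "z \<in> Ax c" and sd: "sd = A @ (f, n, w) # M @ (f', n', w') # B" and eq:
      "pm_eq f f'"
  shows "reach c (polygon_bound (length sd) (weight sd)) x z"
proof -
  obtain v v' where A: "chain reach z A v" and f: "reach f n v w" and M: "chain reach w M v'"
    and f': "reach f' n' v' w'" and B: "chain reach w' B (\<nu> + x)"
    using ch unfolding sd by (auto simp: chain_append)
  have f'': "reach f n' v' w'" using f' eq reach_pm pm_eq_sym by blast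
  have w: "w \<in> Ax f" and v': "v' \<in> Ax f" using reach_Ax f f'' by auto
  have "reach f (weight M + length M) w v'"
    using chain_proj [OF M, of f] w v' by (auto simp: gate_self [OF Ax_convex])
  then have "reach f (n + (weight M + length M) + n') v w'"
    using reach_trans [OF reach_trans [OF f] f''] by blast
  then have "chain reach z (A @ (f, n + (weight M + length M) + n', w') # B) (\<nu> + x)"
    using A B by (auto simp: chain_append)
  then have "reach c (prior_bound (length sd) (weight sd)) x z"
    by (rule polygon_okD [OF ok _ \<nu> x z]) (simp_all add: sd)
  then show ?thesis by (rule polygon_finish [OF _ reach_refl [OF z]]) (simp_all add: sd)
qed

text \<open>Project the path from \<open>p\<close> to \<open>q\<close> to \<open>Ax e\<close>. It
  has \<open>length M + 2\<close> sides, at most one of them on \<open>e\<close>, and must cover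
  more than 20/24; hence 20 < \<open>length M + 2 + 12\<close>.\<close>

lemma cut_length:
  assumes F: "F = A @ (f, n, w) # M @ (f', n', w') # B" and dist: "distinct_axes F"
    and f: "on_axis f n v w" and M: "chain on_axis w M v'" and f': "on_axis f' n' v' w'"
    and sh: "2 * d v w \<le> len f" "short w M" "2 * d v' w' \<le> len f'"
    and p: "btw v p w" "p \<in> Ax e" and q: "btw v' q w'" "q \<in> Ax e" and pq: "20 * len e < 24 * d p q"
  shows "7 \<le> length M"
proof -
  have pf: "p \<in> Ax f" using f p convexD [OF Ax_convex] unfolding on_axis_def by blast
  have qf: "q \<in> Ax f'" using f' q convexD [OF Ax_convex] unfolding on_axis_def by blast
  have ne: "Ax e \<noteq> {}" using p by auto
  \<comment> \<open>The extreme sides are trimmed to \<open>p\<close> and \<open>q\<close>; the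
    weights \<open>0\<close> are dummies.\<close>
  let ?L = "(f, 0, w) # M @ [(f', 0, q)]"
  have "chain on_axis p ?L q" using f M f' pf qf by (auto simp: on_axis_def chain_append)
  moreover have "d p w \<le> d v w" "d v' q \<le> d v' w'" using p q by (simp_all add: btw_def)
  then have "short p ?L" using sh short_append [OF M] by auto
  ultimately have "24 * d (gate (Ax e) p) (gate (Ax e) q) \<le> (length ?L + 12 * count_axis e ?L) * len e"
    by (rule chain_gate_length [OF _ ne])
  then have "24 * d p q \<le> (length ?L + 12 * count_axis e ?L) * len e"
    unfolding gate_self [OF Ax_convex p(2)] gate_self [OF Ax_convex q(2)] .
  moreover have "count_axis e ?L \<le> 1"
  proof -
    have "count_axis e ?L \<le> count_axis e F" by (simp add: F count_axis_def)
    then show ?thesis using count_axis_le_1 [OF dist, of e] by linarith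
  qed
  then have "(length ?L + 12 * count_axis e ?L) * len e \<le> (length M + 14) * len e"
    by (intro mult_right_mono) auto
  ultimately have "20 * len e < (length M + 14) * len e"
    using pq by linarith
  then show ?thesis by simp
qed

text \<open>The sides \<open>f\<close>, \<open>M\<close>, \<open>f'\<close> are replaced by a part
  of \<open>f\<close>, a side on \<open>e\<close> and a part of \<open>f'\<close>. If
  \<open>e\<close> is itself the axis of \<open>f\<close> or of \<open>f'\<close>, the segment on
  \<open>e\<close> is extended to the outer end of that side; this is the purpose of
  \<open>p'\<close> and \<open>q'\<close>. The number of sides drops because \<open>M\<close> has at
  least seven.\<close>

lemma polygon_cut:
  assumes ok: "polygon_ok (length sd)" and ch: "chain reach z sd (\<nu> + x)" and \<nu>: "\<nu> \<in> N"
    and x: "x \<in> Ax c" and z: "z \<in> Ax c"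
    and dist: "distinct_axes ((c, 0, z) # sd)" and sh: "short x ((c, 0, z) # sd)"
    and split: "split_at on_axis x ((c, 0, z) # sd) (\<nu> + x) p q"
    and p: "p \<in> Ax e" and q: "q \<in> Ax e" and pq: "20 * len e < 24 * d p q"
  shows "reach c (polygon_bound (length sd) (weight sd)) x z"
proof -
  from split obtain A f n v w M f' n' v' w' B
    where F: "(c, 0, z) # sd = A @ (f, n, w) # M @ (f', n', w') # B"
    and gA: "chain on_axis x A v" and gf: "on_axis f n v w" and gM: "chain on_axis w M v'"
    and gf': "on_axis f' n' v' w'" and bp: "btw v p w" and bq: "btw v' q w'"
    unfolding split_at_def by blast
  have shF: "short v ((f, n, w) # M @ (f', n', w') # B)"
    using sh short_append [OF gA] unfolding F by blast
  have len: "7 \<le> length M"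
    using shF short_append [OF gM]
    by (intro cut_length [OF F dist gf gM gf' _ _ _ bp p bq q pq]) auto
  have vf: "v \<in> Ax f" and wf: "w \<in> Ax f" and v'f: "v' \<in> Ax f'" and w'f: "w' \<in> Ax f'"
    using gf gf' by (auto simp: on_axis_def)
  have pf: "p \<in> Ax f" using convexD [OF Ax_convex vf wf bp] .
  have qf: "q \<in> Ax f'" using convexD [OF Ax_convex v'f w'f bq] .
  have ne: "Ax e \<noteq> {}" using p by auto
  have fM: "\<forall>s\<in>set M. \<not> pm_eq f (fst s)" and ff': "\<not> pm_eq f f'"
    and "\<forall>s\<in>set M. \<not> pm_eq (fst s) f'"
    using dist unfolding F by (auto simp: sorted_wrt_append)
  then have Mf': "\<forall>s\<in>set M. \<not> pm_eq f' (fst s)" using pm_eq_sym by blast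
  have f'f: "\<not> pm_eq f' f" using ff' pm_eq_sym by blast
  have not_both: "\<not> (pm_eq e f \<and> pm_eq e f')" using ff' pm_eq_sym pm_eq_trans by blast
  define p' where "p' = (if pm_eq e f then v else p)"
  define q' where "q' = (if pm_eq e f' then w' else q)"
  have p'e: "p' \<in> Ax e" and p'f: "p' \<in> Ax f" unfolding p'_def using p vf pf Ax_pm_eq by auto
  have q'e: "q' \<in> Ax e" and q'f: "q' \<in> Ax f'" unfolding q'_def using q w'f qf Ax_pm_eq by auto
  \<comment> \<open>No cone distance is known from the interior point \<open>q\<close> to the ends
    of its side. The way back along \<open>e\<close>, \<open>f\<close> and \<open>M\<close> leads
    from \<open>q\<close> to \<open>v'\<close> on axes other than \<open>f'\<close>, so its
    projection costs one per side; then \<open>n'\<close> leads on to \<open>w'\<close>.\<close>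
  have to_w': "reach f' (n' + (length M + 2)) q' w'" if f': "reach f' n' v' w'"
  proof (cases "pm_eq e f'")
    case True
    then show ?thesis unfolding q'_def using reach_mono [OF reach_refl [OF w'f]] by simp
  next
    case False
    have "chain on_axis q ((e, 0, p') # (f, 0, w) # M) v'"
      using p'e q p'f wf gM by (simp add: on_axis_def)
    then have "reach f' (length ((e, 0::nat, p') # (f, 0::nat, w) # M)) q v'"
      using False f'f Mf' qf v'f pm_eq_sym by (intro chain_proj_ne) auto
    from reach_mono [OF reach_trans [OF this f']] False show ?thesis by (simp add: q'_def)
  qed
  \<comment> \<open>The new side on \<open>e\<close> is bounded by projecting \<open>f\<close>,
    \<open>M\<close> and \<open>f'\<close>. A cone length for the part of \<open>f\<close> is
    required only if it lies on \<open>e\<close>.\<close>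
  have along_e: "reach e (k + 1 + (weight M + length M) + (n' + 1)) p' q'"
    if "pm_eq e f \<Longrightarrow> reach f k p' w" and M: "chain reach w M v'" and f': "reach f' n' v' w'" for k
  proof -
    have 1: "reach e (k + 1) p' (gate (Ax e) w)"
      using side_proj [OF p'f wf that(1) ne] p'e by (simp add: gate_self [OF Ax_convex])
    have "pm_eq e f' \<Longrightarrow> reach f' n' v' q'" using f' by (simp add: q'_def)
    then have 2: "reach e (n' + 1) (gate (Ax e) v') q'"
      using side_proj [OF v'f q'f _ ne, of n'] q'e by (simp add: gate_self [OF Ax_convex])
    show ?thesis using reach_trans [OF reach_trans [OF 1 chain_proj [OF M ne]] 2] .
  qed
  show ?thesis
  proof (cases A)
    case Nil
    \<comment> \<open>The first of the cut sides is the base, whose cone length is the unknown. The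
      smaller polygon gets the base from \<open>x\<close> to \<open>p\<close>, or to
      \<open>q\<close> if \<open>e\<close> is the axis of the base, and the remainder up to
      \<open>z\<close> is bounded by projecting sides on other axes.\<close>
    then have fc: "f = c" and wz: "w = z" and vx: "v = x" and sd: "sd = M @ (f', n', w') # B"
      using F gA by auto
    obtain u where Mu: "chain reach z M u" and f'u: "reach f' n' u w'" and B: "chain reach w' B (\<nu> + x)"
      using ch unfolding sd by (auto simp: chain_append)
    have "u = v'" using chain_unique [OF Mu gM [unfolded wz]] .
    then have M: "chain reach z M v'" and f': "reach f' n' v' w'" using Mu f'u by auto
    show ?thesis
    proof (cases "pm_eq e c")
      case False
      have p'p: "p' = p" using False fc by (simp add: p'_def)
      have "reach e (0 + 1 + (weight M + length M) + (n' + 1)) p q'"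
        using along_e [of 0] False M f' by (simp add: fc wz p'p)
      then have ch1: "chain reach p ((e, 0 + 1 + (weight M + length M) + (n' + 1),
        q') # (f', n' + (length M + 2), w') # B) (\<nu> + x)"
        using to_w' [OF f'] B by simp
      have 1: "reach c (prior_bound (length sd) (weight sd)) x p"
        by (rule polygon_okD [OF ok ch1 \<nu> x]) (use pf len fc in \<open>auto simp: sd\<close>)
      have "chain on_axis z (M @ [(f', 0, q'), (e, 0, p)]) p"
        using gM p'e p'p q'e q'f v'f by (auto simp: wz chain_append on_axis_def)
      then have "reach c (length (M @ [(f', 0::nat, q'), (e, 0, p)])) z p"
        using z pf fc fM ff' False pm_eq_sym by (intro chain_proj_ne) auto
      then have "reach c (length M + 2) p z" using reach_sym by simp
      then show ?thesis by (rule polygon_finish [OF 1]) (simp_all add: sd)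
    next
      case True
      then have nf': "\<not> pm_eq e f'" using not_both fc by blast
      then have q'q: "q' = q" by (simp add: q'_def)
      have qc: "q \<in> Ax c" using q Ax_pm_eq [OF True] by simp
      have ch1: "chain reach q ((f', n' + (length M + 2), w') # B) (\<nu> + x)"
        using to_w' [OF f'] B q'q by simp
      have 1: "reach c (prior_bound (length sd) (weight sd)) x q"
        by (rule polygon_okD [OF ok ch1 \<nu> x]) (use qc len in \<open>auto simp: sd\<close>)
      have "chain on_axis z (M @ [(f', 0, q)]) q"
        using gM qf v'f by (auto simp: wz chain_append on_axis_def)
      then have "reach c (length (M @ [(f', 0::nat, q)])) z q"
        using z qc fc fM ff' by (intro chain_proj_ne) auto
      then have "reach c (length M + 1) q z" using reach_sym by simp
      then show ?thesis by (rule polygon_finish [OF 1]) (simp_all add: sd)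
    qed
  next
    case (Cons s A')
    then have s: "s = (c, 0, z)" and sd: "sd = A' @ (f, n, w) # M @ (f', n', w') # B" using F by auto
    have gA': "chain on_axis z A' v" using gA Cons s by simp
    obtain u u' where A'u: "chain reach z A' u" and fu: "reach f n u w" and Mu: "chain reach w M u'"
      and f'u: "reach f' n' u' w'" and B: "chain reach w' B (\<nu> + x)"
      using ch unfolding sd by (auto simp: chain_append)
    have "u = v" "u' = v'" using chain_unique [OF A'u gA'] chain_unique [OF Mu gM] by auto
    then have A': "chain reach z A' v" and f: "reach f n v w" and M: "chain reach w M v'" and f':
      "reach f' n' v' w'"
      using A'u fu Mu f'u by auto
    have "pm_eq e f \<Longrightarrow> reach f n p' w" using f by (simp add: p'_def)
    note e = along_e [OF this M f']
    have to_p': "reach f (n + (length M + 2)) v p'"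
    proof (cases "pm_eq e f")
      case True
      then show ?thesis unfolding p'_def using reach_mono [OF reach_refl [OF vf]] by simp
    next
      case False
      have "chain on_axis w (M @ [(f', 0, q'), (e, 0, p)]) p"
        using gM p q'e q'f v'f by (auto simp: chain_append on_axis_def)
      then have "reach f (length (M @ [(f', 0::nat, q'), (e, 0, p)])) w p"
        using wf pf fM ff' False pm_eq_sym by (intro chain_proj_ne) auto
      from reach_mono [OF reach_trans [OF f this]] False show ?thesis by (simp add: p'_def)
    qed
    have "chain reach z (A' @ (f, n + (length M + 2),
      p') # (e, n + 1 + (weight M + length M) + (n' + 1), q') #
        (f', n' + (length M + 2), w') # B) (\<nu> + x)"
      using A' to_p' e to_w' [OF f'] B by (auto simp: chain_append)
    then have "reach c (prior_bound (length sd) (weight sd)) x z"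
      by (rule polygon_okD [OF ok _ \<nu> x z]) (use len in \<open>auto simp: sd\<close>)
    then show ?thesis by (rule polygon_finish [OF _ reach_refl [OF z]]) (simp_all add: sd)
  qed
qed

text \<open>If \<open>\<nu> = 0\<close>, the polygon closes in the tree and a projection to
  \<open>c\<close> suffices. Otherwise an axis is exposed along more than 20/24, while one short
  side contains at most 12/24 of it; so \<open>p\<close> and \<open>q\<close> are on different sides
  and the axis can be cut off.\<close>

lemma polygon_reduced:
  assumes ok: "polygon_ok (length sd)" and ch: "chain reach z sd (\<nu> + x)" and \<nu>: "\<nu> \<in> N"
    and x: "x \<in> Ax c" and z: "z \<in> Ax c" and sh: "short x ((c, 0, z) # sd)"
  shows "reach c (polygon_bound (length sd) (weight sd)) x z"
proof (cases "distinct_axes ((c, 0, z) # sd)")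
  case False
  then obtain A s M s' B where F: "(c, 0, z) # sd = A @ s # M @ s' # B" and eq: "pm_eq (fst s) (fst s')"
    using not_sorted_wrt_split by blast
  obtain f n w f' n' w' where s: "s = (f, n, w)" "s' = (f', n', w')" by (cases s, cases s')
  show ?thesis
  proof (cases A)
    case Nil
    then show ?thesis using polygon_merge_first [OF ok ch \<nu> x z, of M f' n' w' B] F s eq by simp
  next
    case (Cons t A')
    then show ?thesis using polygon_merge [OF ok ch \<nu> x z, of A' f n w M f' n' w' B] F s eq by simp
  qed
next
  case dist: True
  show ?thesis
  proof (cases "\<nu> = 0")
    case True
    have "reach c (weight sd + length sd) z x"
      using chain_proj [OF ch, of c] x z True by (auto simp: gate_self [OF Ax_convex])
    from reach_mono [OF reach_sym [OF this]] show ?thesis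
      using polygon_bound_ge' [of "length sd" "weight sd"] by simp
  next
    case False
    from relator_exposed [OF \<nu> False, of x] obtain e p q where e: "p \<in> Ax e" "q \<in> Ax e"
      and b: "btw x p (\<nu> + x)" "btw x q (\<nu> + x)" and pq: "20 * len e < 24 * d p q" by blast
    have gch: "chain on_axis x ((c, 0, z) # sd) (\<nu> + x)"
      using x z chain_on_axis [OF ch] by (simp add: on_axis_def)
    from chain_cover2 [OF gch b list.distinct(2)] show ?thesis
      unfolding has_side_def
    proof (elim disjE exE conjE)
      fix A f n v w B
      assume F: "(c, 0, z) # sd = A @ (f, n, w) # B" and A: "chain on_axis x A v" and f: "on_axis f n v w"
        and bp: "btw v p w" and bq: "btw v q w"
      have vw: "v \<in> Ax f" "w \<in> Ax f" using f by (auto simp: on_axis_def)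
      have "p \<in> Ax f" "q \<in> Ax f" using convexD [OF Ax_convex vw] bp bq by auto
      moreover have "2 * d v w \<le> len f" using sh short_append [OF A] unfolding F by auto
      ultimately have "24 * d p q \<le> 12 * len e"
        using Ax_overlap [OF e] d_btw2 [OF bp bq] len_pm_eq [of e f p] e by (cases "pm_eq e f") fastforce+
      then show ?thesis using pq by linarith
    next
      assume "split_at on_axis x ((c, 0, z) # sd) (\<nu> + x) p q"
      from polygon_cut [OF ok ch \<nu> x z dist sh this e pq] show ?thesis .
    next
      assume "split_at on_axis x ((c, 0, z) # sd) (\<nu> + x) q p"
      from polygon_cut [OF ok ch \<nu> x z dist sh this e(2,1)] pq show ?thesis by (simp add: d_comm)
    qed
  qed
qed

text \<open>An overlong side is rotated along its axis and everything after it is translated too.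
  This changes \<open>\<nu>\<close> within \<open>N\<close>, preserves number and weights of the
  sides, and decreases the geometric length.\<close>

lemma polygon_step:
  assumes ok: "polygon_ok (length sd)" and ch: "chain reach z sd (\<nu> + x)" and \<nu>: "\<nu> \<in> N"
    and x: "x \<in> Ax c" and z: "z \<in> Ax c"
  shows "reach c (polygon_bound (length sd) (weight sd)) x z"
  using assms
proof (induction "d x z + total z sd" arbitrary: z sd \<nu> rule: less_induct)
  case less
  note ch = less.prems(2) and \<nu> = less.prems(3)
  show ?case
  proof (cases "len c < 2 * d x z")
    case True
    then obtain \<rho> where \<rho>: "\<rho> \<in> gen {c}" "d x (\<rho> + z) < d x z"
      using Ax_shorten less.prems by blast
    have ch': "chain reach (\<rho> + z) (translate \<rho> sd) ((\<rho> + \<nu>) + x)"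
      using chain_translate [OF ch, of \<rho>] by (simp add: add.assoc)
    have "reach c (polygon_bound (length (translate \<rho> sd)) (weight (translate \<rho> sd))) x (\<rho> + z)"
    proof (rule less.hyps [OF _ _ ch'])
      show "d x (\<rho> + z) + total (\<rho> + z) (translate \<rho> sd) < d x z + total z sd"
        using \<rho>(2) by (simp add: total_translate)
      show "\<rho> + \<nu> \<in> N" using Rot_N [OF x \<rho>(1)] \<nu> N_add by blast
      show "\<rho> + z \<in> Ax c" using \<rho>(1) less.prems by simp
    qed (use less.prems in simp_all)
    from reach_Rot [OF this gen_uminus [OF \<rho>(1)]] show ?thesis by simp
  next
    case nc: False
    show ?thesis
    proof (cases "short z sd")
      case True
      then show ?thesis using nc polygon_reduced less.prems by simp
    next
      case False
      from not_short_split [OF ch this] obtain A f n v w B where sd: "sd = A @ (f, n, w) # B"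
        and A: "chain reach z A v" and f: "reach f n v w" and B: "chain reach w B (\<nu> + x)" and ln:
          "len f < 2 * d v w"
        unfolding has_side_def by blast
      have vw: "v \<in> Ax f" "w \<in> Ax f" using reach_Ax [OF f] by auto
      obtain \<rho> where \<rho>: "\<rho> \<in> gen {f}" "d v (\<rho> + w) < d v w" using Ax_shorten [OF vw ln] by blast
      let ?sd = "A @ (f, n, \<rho> + w) # translate \<rho> B"
      have ch': "chain reach z ?sd ((\<rho> + \<nu>) + x)"
        using A reach_Rot [OF f \<rho>(1)] chain_translate [OF B, of \<rho>] by (auto simp: chain_append add.assoc)
      have l: "length ?sd = length sd" and wt: "weight ?sd = weight sd" by (simp_all add: sd)
      have "reach c (polygon_bound (length ?sd) (weight ?sd)) x z"
      proof (rule less.hyps [OF _ _ ch'])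
        show "d x z + total z ?sd < d x z + total z sd"
          unfolding sd using \<rho>(2) total_append [OF A] by (simp add: total_translate)
        show "\<rho> + \<nu> \<in> N" using Rot_N [OF vw(1) \<rho>(1)] \<nu> N_add by blast
        show "polygon_ok (length ?sd)" unfolding l by (rule less.prems)
      qed (use less.prems in simp_all)
      then show ?thesis unfolding l wt .
    qed
  qed
qed

theorem polygon:
  assumes "chain reach z sd (\<nu> + x)" "\<nu> \<in> N" "x \<in> Ax c" "z \<in> Ax c"
  shows "reach c (polygon_bound (length sd) (weight sd)) x z"
proof -
  have "polygon_ok m" for m
  proof (induction m)
    case 0 show ?case by (simp add: polygon_ok_def)
  next
    case (Suc m)
    show ?case unfolding polygon_ok_def
    proof (intro allI impI)
      fix x z sd \<nu> c
      assume a: "length sd < Suc m" "chain reach z sd (\<nu> + x)" "\<nu> \<in> N" "x \<in> Ax c" "z \<in> Ax c"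
      have "polygon_ok (length sd)" using Suc a(1) unfolding polygon_ok_def by force
      from polygon_step [OF this a(2-)] show "reach c (polygon_bound (length sd) (weight sd)) x z" .
    qed
  qed
  from polygon_step [OF this assms] show ?thesis .
qed

end

section \<open>The Cayley tree of a free group\<close>

text \<open>The free group on all letters as a type, in order to be an instance of
  \<open>group_add\<close>. Its elements also serve as the vertices of the Cayley tree.\<close>

typedef 'a fg = "{w :: 'a word. reduced w}" morphisms word_of Abs_fg
  by (rule exI [of _ "[]"]) simp

setup_lifting type_definition_fg

lemma reduced_word_of [simp]: "reduced (word_of x)"
  using word_of by auto

instantiation fg :: (type) group_add
begin

lift_definition zero_fg :: "'a fg" is "[]" by simp
lift_definition plus_fg :: "'a fg \<Rightarrow> 'a fg \<Rightarrow> 'a fg" is "\<lambda>u v. reduce (u @ v)" by (simp add: reduced_reduce)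
lift_definition uminus_fg :: "'a fg \<Rightarrow> 'a fg" is word_inv by (rule reduced_word_inv)
lift_definition minus_fg :: "'a fg \<Rightarrow> 'a fg \<Rightarrow> 'a fg" is "\<lambda>u v. reduce (u @ word_inv v)"
  by (simp add: reduced_reduce)

instance
proof
  fix a b c :: "'a fg"
  show "a + b + c = a + (b + c)" by transfer simp
  show "0 + a = a" "a + 0 = a" by (transfer, simp add: reduce_reduced)+
  show "- a + a = 0" by transfer (rule reduce_word_inv)
  show "a + - b = a - b" by transfer simp
qed

end

lift_definition of_word :: "'a word \<Rightarrow> 'a fg" is reduce by (rule reduced_reduce)

lemma word_of_of_word: "word_of (of_word u) = reduce u"
  by transfer simp

lemma word_of_of_word_reduced [simp]: "reduced u \<Longrightarrow> word_of (of_word u) = u"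
  by (simp add: word_of_of_word reduce_reduced)

lemma of_word_word_of [simp]: "of_word (word_of x) = x"
  by transfer (simp add: reduce_reduced)

lemma of_word_append: "of_word (u @ v) = of_word u + of_word v"
  by transfer simp

lemma of_word_Nil [simp]: "of_word [] = 0"
  by transfer (simp add: reduce_reduced)

lemma of_word_word_inv: "of_word (word_inv u) = - of_word u"
proof -
  have "of_word (word_inv u) + of_word u = 0"
    unfolding of_word_append [symmetric] by transfer (simp add: reduce_word_inv reduce_reduced)
  then show ?thesis by (simp add: eq_neg_iff_add_eq_0)
qed

lemma word_of_uminus: "word_of (- x) = word_inv (word_of x)"
  by transfer simp

lemma word_of_plus: "word_of (x + y) = reduce (word_of x @ word_of y)"
  by transfer simp

lemma word_of_zero [simp]: "word_of 0 = []"
  by transfer simp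

lemma word_of_inject' [simp]: "word_of x = word_of y \<longleftrightarrow> x = y"
  by (rule word_of_inject)

lemma word_of_eq_Nil [simp]: "word_of x = [] \<longleftrightarrow> x = 0"
  using word_of_inject [of x 0] by simp

lemma length_word_inv [simp]: "length (word_inv u) = length u"
  by (simp add: word_inv_def)

lemma word_inv_word_inv [simp]: "word_inv (word_inv u) = u"
  by (simp add: word_inv_def rev_map comp_def)

lemma word_inv_eq_Nil [simp]: "word_inv u = [] \<longleftrightarrow> u = []"
  by (simp add: word_inv_def)

lemma word_inv_Cons: "word_inv (x # u) = word_inv u @ [flip x]"
  by (simp add: word_inv_def)

lemma word_inv_append: "word_inv (u @ v) = word_inv v @ word_inv u"
  by (simp add: word_inv_def)

lemma hd_word_inv: "u \<noteq> [] \<Longrightarrow> hd (word_inv u) = flip (last u)"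
  by (simp add: word_inv_def hd_rev last_map)

lemma last_word_inv: "u \<noteq> [] \<Longrightarrow> last (word_inv u) = flip (hd u)"
  by (simp add: word_inv_def last_rev hd_map)

lemma flip_neq [simp]: "flip x \<noteq> x" "x \<noteq> flip x"
  by (cases x, simp)+

definition fg_dist :: "'a fg \<Rightarrow> 'a fg \<Rightarrow> nat" where
  "fg_dist x y = length (word_of (- x + y))"

lemma fg_dist_left: "fg_dist (h + x) (h + y) = fg_dist x y"
  by (simp only: fg_dist_def group_norm)

lemma fg_dist_comm: "fg_dist x y = fg_dist y x"
proof -
  have "- x + y = - (- y + x)" by (simp only: group_norm)
  then have "word_of (- x + y) = word_inv (word_of (- y + x))" by (simp only: word_of_uminus)
  then show ?thesis unfolding fg_dist_def by simp
qed

lemma fg_dist_tri: "fg_dist x z \<le> fg_dist x y + fg_dist y z"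
proof -
  have "- x + z = (- x + y) + (- y + z)" by (simp only: group_norm)
  then have "word_of (- x + z) = reduce (word_of (- x + y) @ word_of (- y + z))"
    by (simp only: word_of_plus)
  then show ?thesis unfolding fg_dist_def
    using length_reduce [of "word_of (- x + y) @ word_of (- y + z)"] by simp
qed

text \<open>Equality in the triangle inequality means that nothing cancels in the product.\<close>

lemma fg_geodesic_prefix:
  assumes "fg_dist x p + fg_dist p y = fg_dist x y"
  shows "word_of (- x + y) = word_of (- x + p) @ word_of (- p + y)"
proof -
  have "- x + y = (- x + p) + (- p + y)" by (simp only: group_norm)
  then have w: "word_of (- x + y) = reduce (word_of (- x + p) @ word_of (- p + y))"
    by (simp only: word_of_plus)
  then have "length (reduce (word_of (- x + p) @ word_of (- p + y))) = length (word_of (- x + p) @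
    word_of (- p + y))"
    using assms unfolding fg_dist_def by simp
  from reduce_eq_self [OF this] show ?thesis using w by simp
qed

lemma common_prefix:
  "\<exists>w u' v'. u = w @ u' \<and> v = w @ v' \<and> (u' = [] \<or> v' = [] \<or> hd u' \<noteq> hd v')"
proof (induction u arbitrary: v)
  case Nil
  then show ?case by auto
next
  case (Cons a u)
  show ?case
  proof (cases "\<exists>v1. v = a # v1")
    case True
    then obtain v1 where v: "v = a # v1" by blast
    from Cons.IH [of v1] obtain w u' v'
      where "u = w @ u'" "v1 = w @ v'" "u' = [] \<or> v' = [] \<or> hd u' \<noteq> hd v'" by blast
    then have "a # u = (a # w) @ u' \<and> v = (a # w) @ v' \<and> (u' = [] \<or> v' = [] \<or> hd u' \<noteq> hd v')"
      using v by simp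
    then show ?thesis by blast
  next
    case False
    then have "a # u = [] @ a # u \<and> v = [] @ v \<and> (a # u = [] \<or> v = [] \<or> hd (a # u) \<noteq> hd v)"
      by (cases v) auto
    then show ?thesis by blast
  qed
qed

lemma fg_tree: "tree_metric fg_dist"
proof
  fix x y z p q :: "'a fg"
  show "fg_dist x y = 0 \<longleftrightarrow> x = y"
    unfolding fg_dist_def using neg_eq_iff_add_eq_0 [of "- x" y] by auto
  show "fg_dist x y = fg_dist y x" by (rule fg_dist_comm)
  show "fg_dist x z \<le> fg_dist x y + fg_dist y z" by (rule fg_dist_tri)
  show "fg_dist x p + fg_dist p q = fg_dist x q"
    if p: "fg_dist x p + fg_dist p y = fg_dist x y" and q: "fg_dist x q + fg_dist q y = fg_dist x y"
      and le: "fg_dist x p \<le> fg_dist x q"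
  proof -
    have "prefix (word_of (- x + p)) (word_of (- x + q))"
      by (rule prefix_length_prefix [OF prefixI [OF fg_geodesic_prefix [OF p]] prefixI [OF
        fg_geodesic_prefix [OF q]]])
        (use le in \<open>simp add: fg_dist_def\<close>)
    then obtain t where t: "word_of (- x + q) = word_of (- x + p) @ t" by (auto simp: prefix_def)
    then have "reduced t" using reduced_word_of [of "- x + q"] by (simp add: reduced_append)
    have eq: "- x + q = (- x + p) + of_word t"
      using arg_cong [OF t, of of_word] unfolding of_word_append of_word_word_of .
    have "- p + q = - (- x + p) + (- x + q)" by (simp only: group_norm)
    also have "\<dots> = of_word t" unfolding eq by simp
    finally have "- p + q = of_word t" .
    then show ?thesis unfolding fg_dist_def using t \<open>reduced t\<close> by simp
  qed
  show "\<exists>m. fg_dist x m + fg_dist m y = fg_dist x y \<and> fg_dist y m + fg_dist m z = fg_dist y z \<and>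
    fg_dist x m + fg_dist m z = fg_dist x z"
  proof -
    \<comment> \<open>The median is the point where the reduced words leading from \<open>x\<close>
      to \<open>y\<close> and to \<open>z\<close> branch.\<close>
    obtain w u v where u: "word_of (- x + y) = w @ u" and v: "word_of (- x + z) = w @ v"
      and h: "u = [] \<or> v = [] \<or> hd u \<noteq> hd v" using common_prefix by blast
    have r: "reduced w" "reduced u" "reduced v"
      using reduced_word_of [of "- x + y"] reduced_word_of [of "- x + z"]
        unfolding u v by (auto simp: reduced_append)
    define m where "m = x + of_word w"
    have xm: "- x + m = of_word w" unfolding m_def by simp
    have y: "- x + y = of_word w + of_word u" and z: "- x + z = of_word w + of_word v"
      using arg_cong [OF u, of of_word] arg_cong [OF v, of of_word]
        unfolding of_word_append of_word_word_of by auto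
    have "- m + y = - of_word w + (- x + y)" unfolding m_def by (simp only: group_norm)
    then have my: "- m + y = of_word u" unfolding y by simp
    have "- m + z = - of_word w + (- x + z)" unfolding m_def by (simp only: group_norm)
    then have mz: "- m + z = of_word v" unfolding z by simp
    have "- y + z = - (- m + y) + (- m + z)" by (simp only: group_norm)
    then have yz: "- y + z = of_word (word_inv u @ v)"
      unfolding my mz by (simp add: of_word_append of_word_word_inv)
    have "reduced (word_inv u @ v)"
      using r h by (auto simp: reduced_append reduced_word_inv last_word_inv)
    then show ?thesis
      using xm my mz yz u v r fg_dist_comm [of y m] unfolding fg_dist_def by (intro exI [of _ m]) simp
  qed
qed

text \<open>\<open>u\<close> is an initial segment of the infinite word \<open>r r r ...\<close>;
  rotating \<open>r\<close> records the position within the period.\<close>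

fun periodic :: "'b list \<Rightarrow> 'b list \<Rightarrow> bool" where
  "periodic r [] \<longleftrightarrow> True"
| "periodic r (s # u) \<longleftrightarrow> r \<noteq> [] \<and> s = hd r \<and> periodic (rotate1 r) u"

lemma periodic_append: "periodic r (u @ v) \<longleftrightarrow> periodic r u \<and> periodic (rotate (length u) r) v"
  by (induction u arbitrary: r) (auto simp: rotate1_rotate_swap)

lemma periodic_prefix: "periodic r u \<Longrightarrow> length u \<le> length r \<Longrightarrow> prefix u r"
proof (induction u arbitrary: r)
  case (Cons s u)
  then obtain t where r: "r = s # t" by (cases r) auto
  have "prefix u (t @ [s])" by (rule Cons.IH) (use Cons.prems r in simp_all)
  then have "prefix u t" by (rule prefix_length_prefix) (use Cons.prems r in simp_all)
  then show ?case using Cons.prems r by simp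
qed simp

lemma prefix_periodic: "prefix u r \<Longrightarrow> periodic r u"
proof (induction u arbitrary: r)
  case (Cons s u)
  then obtain t where r: "r = s # t" and p: "prefix u t" by (cases r) auto
  have "periodic (rotate1 r) u" by (rule Cons.IH) (use r p in simp)
  then show ?case using Cons.prems r by simp
qed simp

lemma periodic_long: "periodic r u \<Longrightarrow> length r \<le> length u \<Longrightarrow> \<exists>v. u = r @ v \<and> periodic r v"
proof -
  assume p: "periodic r u" and l: "length r \<le> length u"
  define a where "a = take (length r) u"
  define v where "v = drop (length r) u"
  have u: "u = a @ v" and la: "length a = length r" using l by (simp_all add: a_def v_def)
  have pa: "periodic r a" and pv: "periodic r v" using p unfolding u periodic_append la by simp_all
  have "prefix a r" using periodic_prefix [OF pa] la by simp
  then have "a = r" using la by (auto simp: prefix_def)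
  then show ?thesis using u pv by blast
qed

lemma periodic_replicate: "periodic r (concat (replicate n r))"
  by (induction n) (auto simp: periodic_append prefix_periodic)

section \<open>Axes of relators in the Cayley tree\<close>

locale relators =
  fixes RR :: "'a word set"
  assumes RR_reduced: "r \<in> RR \<Longrightarrow> reduced r"
    and RR_ne: "r \<in> RR \<Longrightarrow> r \<noteq> []"
    and RR_rotate1: "r \<in> RR \<Longrightarrow> rotate1 r \<in> RR"
    and RR_word_inv: "r \<in> RR \<Longrightarrow> word_inv r \<in> RR"
    and RR_piece: "r \<in> RR \<Longrightarrow> r' \<in> RR \<Longrightarrow> r \<noteq> r' \<Longrightarrow> prefix u r \<Longrightarrow> prefix u r' \<Longrightarrow> 24 * length u < length r"
    and RR_letter: "\<exists>r\<in>RR. hd r = s"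
begin

text \<open>The geodesic from \<open>x\<close> to \<open>c + x\<close> spells the conjugate of
  \<open>c\<close> by \<open>- x\<close>. On the axis this word is a relator, hence cyclically
  reduced, and its periodic continuation spells the axis.\<close>

definition Ax :: "'a fg \<Rightarrow> 'a fg set" where
  "Ax c = {x. word_of (conj_by (- x) c) \<in> RR}"

definition lab :: "'a fg \<Rightarrow> 'a fg \<Rightarrow> 'a word" where
  "lab x c = word_of (conj_by (- x) c)"

text \<open>The labels along an axis are rotations of one another up to inversion, so the choice of
  the point is immaterial; this is \<open>len_eq\<close>.\<close>

definition len :: "'a fg \<Rightarrow> nat" where
  "len c = length (lab (SOME x. x \<in> Ax c) c)"

lemma Ax_lab: "x \<in> Ax c \<longleftrightarrow> lab x c \<in> RR"
  by (simp add: Ax_def lab_def)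

lemma lab_uminus: "lab x (- c) = word_inv (lab x c)"
  by (simp add: lab_def conj_by_uminus word_of_uminus)

lemma lab_conj: "lab (h + x) (conj_by h c) = lab x c"
  by (simp add: lab_def minus_add add.assoc flip: diff_conv_add_uminus)

lemma of_word_lab: "of_word (lab x c) = conj_by (- x) c"
  by (simp add: lab_def)

lemma RR_word_inv_iff [simp]: "word_inv r \<in> RR \<longleftrightarrow> r \<in> RR"
  using RR_word_inv [of r] RR_word_inv [of "word_inv r"] by auto

lemma Ax_uminus [simp]: "Ax (- c) = Ax c"
  by (auto simp: Ax_lab lab_uminus)

lemma RR_cyclic: "r \<in> RR \<Longrightarrow> hd r \<noteq> flip (last r)"
proof -
  assume r: "r \<in> RR"
  obtain x t where xt: "r = x # t" using RR_ne [OF r] by (cases r) auto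
  have "reduced (t @ [x])" using RR_reduced [OF RR_rotate1 [OF r]] xt by simp
  then show ?thesis using xt by (cases "t = []") (auto simp: reduced_append)
qed

lemma RR_rotate: "r \<in> RR \<Longrightarrow> rotate n r \<in> RR"
  by (induction n) (auto simp: RR_rotate1)

lemma periodic_reduced: "r \<in> RR \<Longrightarrow> periodic r u \<Longrightarrow> reduced u"
proof (induction u arbitrary: r)
  case (Cons s u)
  then obtain t where r: "r = s # t" by (cases r) auto
  have u: "reduced u" using Cons.IH [OF RR_rotate1] Cons.prems by auto
  have "hd u \<noteq> flip s" if "u \<noteq> []"
  proof -
    have "hd u = hd (t @ [s])" using that Cons.prems r by (cases u) auto
    then show ?thesis using RR_reduced [OF Cons.prems(1)] r by (cases t) (auto simp: reduced_Cons)
  qed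
  then show ?case using u by (auto simp: reduced_Cons)
qed simp

lemma lab_step:
  assumes "x \<in> Ax c" "periodic (lab x c) [s]"
  shows "lab (x + of_word [s]) c = rotate1 (lab x c)"
proof -
  obtain t where t: "lab x c = s # t" using assms(2) by (cases "lab x c") auto
  have "conj_by (- (x + of_word [s])) c = - of_word [s] + of_word (lab x c) + of_word [s]"
    by (simp only: of_word_lab conj_by_def group_norm)
  also have "\<dots> = of_word (t @ [s])"
    using t of_word_append [of "[s]" t] of_word_append [of t "[s]"] by (simp add: add.assoc)
  finally have "conj_by (- (x + of_word [s])) c = of_word (t @ [s])" .
  moreover have "reduced (t @ [s])"
    using RR_reduced [OF RR_rotate1, of "lab x c"] assms(1) t by (simp add: Ax_lab)
  ultimately show ?thesis by (simp add: lab_def [of "x + of_word [s]"] t)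
qed

lemma lab_periodic:
  "x \<in> Ax c \<Longrightarrow> periodic (lab x c) u \<Longrightarrow> lab (x + of_word u) c = rotate (length u) (lab x c)"
proof (induction u arbitrary: x)
  case (Cons s u)
  have l: "lab (x + of_word [s]) c = rotate1 (lab x c)" using lab_step Cons.prems by simp
  then have "x + of_word [s] \<in> Ax c" using Cons.prems RR_rotate1 by (simp add: Ax_lab)
  from Cons.IH [OF this] Cons.prems l
  have "lab (x + of_word [s] + of_word u) c = rotate (length u) (rotate1 (lab x c))" by simp
  moreover have "x + of_word [s] + of_word u = x + of_word (s # u)"
    using of_word_append [of "[s]" u] by (simp add: add.assoc)
  ultimately show ?case by (simp add: rotate1_rotate_swap)
qed simp

lemma Ax_periodic: "x \<in> Ax c \<Longrightarrow> periodic (lab x c) u \<Longrightarrow> x + of_word u \<in> Ax c"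
  using lab_periodic RR_rotate by (simp add: Ax_lab)

lemma Ax_periodic_inv: "x \<in> Ax c \<Longrightarrow> periodic (word_inv (lab x c)) u \<Longrightarrow> x + of_word u \<in> Ax c"
  using Ax_periodic [of x "- c" u] by (simp add: lab_uminus)

text \<open>The path \<open>u\<close> leaves the axis with its first letter. Therefore the conjugate
  is reduced as written, and it ends with the inverse of its first letter, which no word of
  \<open>RR\<close> does.\<close>

lemma conj_not_cyclic:
  assumes "r \<in> RR" "reduced u" "u \<noteq> []" "hd u \<noteq> hd r" "hd u \<noteq> hd (word_inv r)"
  shows "word_of (- of_word u + of_word r + of_word u) \<notin> RR"
proof
  let ?w = "word_inv u @ r @ u"
  assume A: "word_of (- of_word u + of_word r + of_word u) \<in> RR"
  have r: "r \<noteq> []" "reduced r" using assms RR_ne RR_reduced by auto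
  have "reduced (r @ u)" using assms r by (auto simp: reduced_append hd_word_inv)
  then have "reduced ?w"
    using assms r by (auto simp: reduced_append [of "word_inv u"] reduced_word_inv last_word_inv)
  moreover have "- of_word u + of_word r + of_word u = of_word ?w"
    by (simp add: of_word_append of_word_word_inv add.assoc)
  ultimately have w: "?w \<in> RR" using A by simp
  have "hd ?w = flip (last ?w)" using assms(3) by (simp add: hd_append hd_word_inv)
  then show False using RR_cyclic [OF w] by simp
qed

text \<open>By \<open>conj_not_cyclic\<close> the first letter follows the axis in one of its two
  directions. A later change of direction would be a backtrack, which a reduced word
  excludes.\<close>

lemma Ax_periodic_cases:
  "x \<in> Ax c \<Longrightarrow> x + of_word u \<in> Ax c \<Longrightarrow> reduced u \<Longrightarrow> periodic (lab x c) u \<or> periodic (word_inv (lab x c)) u"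
proof (induction u arbitrary: x c)
  case (Cons s u)
  have *: "periodic (lab x e) (s # u)" if e: "e = c \<or> e = - c" and s: "s = hd (lab x e)" for e
  proof -
    have x: "x \<in> Ax e" and xu: "x + of_word (s # u) \<in> Ax e" using Cons.prems e by auto
    have ne: "lab x e \<noteq> []" using x RR_ne by (simp add: Ax_lab)
    then have p: "periodic (lab x e) [s]" using s by simp
    have l: "lab (x + of_word [s]) e = rotate1 (lab x e)" using lab_step [OF x p] .
    have eq: "x + of_word [s] + of_word u = x + of_word (s # u)"
      using of_word_append [of "[s]" u] by (simp add: add.assoc)
    have "periodic (rotate1 (lab x e)) u \<or> periodic (word_inv (rotate1 (lab x e))) u"
      using Cons.IH [of "x + of_word [s]" e] Ax_periodic [OF x p] xu Cons.prems l eq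
        by (simp add: reduced_Cons)
    then show ?thesis
    proof
      assume "periodic (rotate1 (lab x e)) u"
      then show ?thesis using s ne by simp
    next
      assume a: "periodic (word_inv (rotate1 (lab x e))) u"
      have "u = []"
      proof (rule ccontr)
        assume "u \<noteq> []"
        then have "hd u = hd (word_inv (rotate1 (lab x e)))" using a by (cases u) auto
        also have "\<dots> = flip s" using ne s by (cases "lab x e") (auto simp: hd_word_inv)
        finally show False using Cons.prems(3) \<open>u \<noteq> []\<close> by (simp add: reduced_Cons)
      qed
      then show ?thesis using p by simp
    qed
  qed
  have "s = hd (lab x c) \<or> s = hd (word_inv (lab x c))"
  proof (rule ccontr)
    assume n: "\<not> ?thesis"
    have "lab (x + of_word (s # u)) c = word_of (- of_word (s # u) + of_word (lab x c) + of_word (s # u))"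
      unfolding lab_def [of "x + of_word (s # u)"] by (simp only: of_word_lab conj_by_def group_norm)
    then show False using conj_not_cyclic [of "lab x c" "s # u"] Cons.prems n by (simp add: Ax_lab)
  qed
  then show ?case using * [of c] * [of "- c"] by (auto simp only: lab_uminus)
qed simp

lemma Ax_word_cases:
  assumes "x \<in> Ax c" "y \<in> Ax c"
  shows "periodic (lab x c) (word_of (- x + y)) \<or> periodic (word_inv (lab x c)) (word_of (- x + y))"
  using Ax_periodic_cases [OF assms(1), of "word_of (- x + y)"] assms(2) by simp

lemma Ax_sign_cases:
  assumes "x \<in> Ax c" "y \<in> Ax c"
  obtains e where "e = c \<or> e = - c" "periodic (lab x e) (word_of (- x + y))"
  using Ax_word_cases [OF assms] lab_uminus by metis

lemma len_eq: "x \<in> Ax c \<Longrightarrow> len c = length (lab x c)"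
proof -
  assume x: "x \<in> Ax c"
  define y where "y = (SOME x. x \<in> Ax c)"
  have y: "y \<in> Ax c" unfolding y_def using x by (rule someI)
  obtain e where e: "e = c \<or> e = - c" "periodic (lab x e) (word_of (- x + y))"
    using Ax_sign_cases [OF x y] by blast
  have "x \<in> Ax e" using x e by auto
  from lab_periodic [OF this e(2)] have "length (lab y e) = length (lab x e)" by simp
  then have "length (lab y c) = length (lab x c)" using e(1) by (auto simp: lab_uminus)
  then show ?thesis by (simp add: len_def y_def)
qed

text \<open>Cutting \<open>u\<close> to the length of the shorter relator gives a common prefix, so
  it is shorter than 1/24 of both; thus nothing was cut off.\<close>

lemma periodic_overlap:
  assumes "r \<in> RR" "r' \<in> RR" "r \<noteq> r'" "periodic r u" "periodic r' u"
  shows "24 * length u < length r" "prefix u r" "prefix u r'"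
proof -
  define v where "v = take (min (length r) (length r')) u"
  have u: "u = v @ drop (min (length r) (length r')) u" by (simp add: v_def)
  have "periodic r v" "periodic r' v" using assms(4,5) periodic_append u by metis+
  then have v: "prefix v r" "prefix v r'" by (auto intro: periodic_prefix simp: v_def)
  have l: "24 * length v < length r" "24 * length v < length r'"
    using RR_piece [OF assms(1-3) v] RR_piece [OF assms(2,1) _ v(2,1)] assms(3) by auto
  then have "length v < min (length r) (length r')" by linarith
  then have "v = u" by (auto simp: v_def)
  then show "24 * length u < length r" "prefix u r" "prefix u r'" using l v by auto
qed

text \<open>The signs are chosen so that both lines are traversed from \<open>x\<close> towards
  \<open>y\<close>. The labels differ because conjugation by \<open>- x\<close> is
  injective.\<close>

lemma Ax_overlap_word:
  assumes "x \<in> Ax c" "y \<in> Ax c" "x \<in> Ax c'" "y \<in> Ax c'" "\<not> pm_eq c c'"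
  obtains e e' where "e = c \<or> e = - c" "e' = c' \<or> e' = - c'" "lab x e \<in> RR" "lab x e' \<in> RR"
    "lab x e \<noteq> lab x e'"
    "periodic (lab x e) (word_of (- x + y))" "periodic (lab x e') (word_of (- x + y))"
proof -
  obtain e where e: "e = c \<or> e = - c" "periodic (lab x e) (word_of (- x + y))"
    using Ax_sign_cases [OF assms(1,2)] by blast
  obtain e' where e': "e' = c' \<or> e' = - c'" "periodic (lab x e') (word_of (- x + y))"
    using Ax_sign_cases [OF assms(3,4)] by blast
  have "e \<noteq> e'" using e(1) e'(1) assms(5) by (auto simp: pm_eq_def)
  then have "lab x e \<noteq> lab x e'" by (simp add: lab_def)
  moreover have "lab x e \<in> RR" "lab x e' \<in> RR" using e(1) e'(1) assms by (auto simp: Ax_lab lab_uminus)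
  ultimately show thesis using that e e' by blast
qed

lemma gen_powers:
  fixes r :: "'a word"
  assumes "g \<in> gen {of_word r}"
  shows "\<exists>n. g = of_word (concat (replicate n r)) \<or> g = of_word (concat (replicate n (word_inv r)))"
  using assms
proof (induction rule: gen.induct)
  case gen_zero
  show ?case by (rule exI [of _ 0]) simp
next
  have step: "\<exists>n. of_word r + g = of_word (concat (replicate n r)) \<or> of_word r + g = of_word
    (concat (replicate n (word_inv r)))"
    if "g = of_word (concat (replicate n r)) \<or> g = of_word (concat (replicate n (word_inv r)))"
      for n g and r :: "'a word"
    using that
  proof
    assume "g = of_word (concat (replicate n r))"
    then have "of_word r + g = of_word (concat (replicate (Suc n) r))" by (simp add: of_word_append)
    then show ?thesis by blast
  next
    assume g: "g = of_word (concat (replicate n (word_inv r)))"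
    show ?thesis
    proof (cases n)
      case 0
      then have "of_word r + g = of_word (concat (replicate 1 r))" using g by simp
      then show ?thesis by blast
    next
      case (Suc m)
      then have "of_word r + g = of_word (concat (replicate m (word_inv r)))"
        using g by (simp add: of_word_append of_word_word_inv)
      then show ?thesis by blast
    qed
  qed
  {
    case (gen_plus a x)
    then show ?case using step [where g = x and r = r] by auto
  next
    case (gen_minus a x)
    then obtain n where "x = of_word (concat (replicate n r)) \<or> x = of_word (concat (replicate n
      (word_inv r)))" by blast
    then have "\<exists>n. - of_word r + x = of_word (concat (replicate n (word_inv r))) \<or> - of_word r + x
      = of_word (concat (replicate n r))"
      using step [where g = x and n = n and r = "word_inv r"] by (auto simp: of_word_word_inv)
    then show ?case using gen_minus by auto
  }
qed

lemma power_length: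
  assumes "r \<in> RR" "g \<in> gen {of_word r}" "g \<noteq> 0"
  shows "length r \<le> length (word_of g)"
proof -
  have *: "length r \<le> length (word_of (of_word (concat (replicate n r))))"
    if "r \<in> RR" "of_word (concat (replicate n r)) \<noteq> 0" for r n
  proof (cases n)
    case 0 then show ?thesis using that by simp
  next
    case (Suc m)
    then show ?thesis using periodic_reduced [OF that(1) periodic_replicate [of r n]] by simp
  qed
  show ?thesis using gen_powers [OF assms(2)] * [OF assms(1)] * [OF RR_word_inv [OF assms(1)]]
    assms(3) by auto
qed

end

sublocale relators \<subseteq> axis_system fg_dist Ax len
proof -
  interpret tree_metric "fg_dist :: 'a fg \<Rightarrow> 'a fg \<Rightarrow> nat" by (rule fg_tree)
  have dist_word: "fg_dist x (\<rho> + y) = length (word_of (conj_by (- x) \<rho> + (- x + y)))" for x y \<rho> :: "'a fg"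
    by (simp only: fg_dist_def conj_by_def group_norm)
  show "axis_system fg_dist Ax len"
  proof
    fix h x y c c' \<rho> :: "'a fg"
    show "fg_dist (h + x) (h + y) = fg_dist x y" by (rule fg_dist_left)
    show "h + x \<in> Ax (conj_by h c)" if "x \<in> Ax c" using that by (simp add: Ax_lab lab_conj)
    show "len (conj_by h c) = len c" if "x \<in> Ax c"
      using that len_eq [of x c] len_eq [of "h + x" "conj_by h c"] by (simp add: Ax_lab lab_conj)
    show "Ax (- c) = Ax c" by simp
    show "len (- c) = len c" if "x \<in> Ax c"
      using that len_eq [of x c] len_eq [of x "- c"] by (simp add: lab_uminus)
    show "0 < len c" if "x \<in> Ax c" using that len_eq [OF that] RR_ne by (simp add: Ax_lab)
    show "c \<noteq> 0" if "x \<in> Ax c" using that RR_ne [of "[]"] by (auto simp: Ax_lab lab_def)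
    show "convex (Ax c)" unfolding convex_def
    proof (intro ballI allI impI)
      fix x y z assume x: "x \<in> Ax c" and y: "y \<in> Ax c" and z: "btw x z y"
      obtain e where e: "e = c \<or> e = - c" "periodic (lab x e) (word_of (- x + y))"
        using Ax_sign_cases [OF x y] by blast
      have "word_of (- x + y) = word_of (- x + z) @ word_of (- z + y)"
        using z unfolding btw_def by (rule fg_geodesic_prefix)
      then have "periodic (lab x e) (word_of (- x + z))" using e(2) by (simp add: periodic_append)
      moreover have "x \<in> Ax e" using x e(1) by auto
      ultimately have "z \<in> Ax e" using Ax_periodic by fastforce
      then show "z \<in> Ax c" using e(1) by auto
    qed
    show "len c \<le> fg_dist x (\<rho> + x)" if x: "x \<in> Ax c" and \<rho>: "\<rho> \<in> gen {c}" "\<rho> \<noteq> 0"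
    proof -
      have "conj_by (- x) \<rho> \<in> gen {of_word (lab x c)}"
        using conj_by_gen [OF \<rho>(1)] by (simp add: of_word_lab)
      moreover have "conj_by (- x) \<rho> \<noteq> 0" using \<rho>(2) conj_by_eq_iff [of "- x" \<rho> 0] by simp
      ultimately show ?thesis
        using power_length [of "lab x c"] x len_eq [OF x] by (simp add: dist_word Ax_lab)
    qed
    show "24 * fg_dist x y < len c"
      if "x \<in> Ax c" "y \<in> Ax c" "x \<in> Ax c'" "y \<in> Ax c'" "\<not> pm_eq c c'"
    proof -
      obtain e e' where e: "e = c \<or> e = - c" "lab x e \<in> RR" "lab x e' \<in> RR" "lab x e \<noteq> lab x e'"
        "periodic (lab x e) (word_of (- x + y))" "periodic (lab x e') (word_of (- x + y))"
        using Ax_overlap_word [OF \<open>x \<in> Ax c\<close> \<open>y \<in> Ax c\<close> \<open>x \<in> Ax c'\<close> \<open>y \<in> Ax c'\<close> \<open>\<not> pm_eq c c'\<close>] by metis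
      from periodic_overlap(1) [OF e(2-)] show ?thesis
        using e(1) len_eq [OF \<open>x \<in> Ax c\<close>] by (auto simp: fg_dist_def lab_uminus)
    qed
    show "\<exists>\<rho>\<in>gen {c}. fg_dist x (\<rho> + y) < fg_dist x y"
      if x: "x \<in> Ax c" and y: "y \<in> Ax c" and l: "len c < 2 * fg_dist x y"
    proof -
      obtain e where e: "e = c \<or> e = - c" "periodic (lab x e) (word_of (- x + y))"
        using Ax_sign_cases [OF x y] by blast
      have me: "- e \<in> gen {c}" using e(1) gen_incl [of c "{c}"] gen_incl_uminus [of c "{c}"] by auto
      have RR: "lab x e \<in> RR" using x e(1) by (auto simp: Ax_lab lab_uminus)
      have le: "length (lab x e) = len c" using len_eq [OF x] e(1) by (auto simp: lab_uminus)
      define u where "u = word_of (- x + y)"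
      have xy: "- x + y = of_word u" by (simp add: u_def)
      have du: "fg_dist x y = length u" by (simp add: u_def fg_dist_def)
      have m: "fg_dist x (- e + y) = length (word_of (- of_word (lab x e) + of_word u))"
        unfolding dist_word xy conj_by_uminus of_word_lab ..
      \<comment> \<open>Rotating back by one period either replaces \<open>u\<close> by the inverse
        of the complementary part \<open>t\<close> of the relator, which is shorter since
        \<open>u\<close> is more than half of it, or removes a whole period.\<close>
      have "fg_dist x (- e + y) < fg_dist x y"
      proof (cases "length u \<le> length (lab x e)")
        case True
        then obtain t where t: "lab x e = u @ t" using periodic_prefix e(2) u_def prefix_def by metis
        have "reduced t" using RR_reduced [OF RR] by (simp add: t reduced_append)
        moreover have "- of_word (lab x e) + of_word u = - of_word t"
          by (simp add: t of_word_append minus_add add.assoc)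
        ultimately show ?thesis using l le unfolding m du by (simp add: word_of_uminus t)
      next
        case False
        then obtain v where v: "u = lab x e @ v" using periodic_long [of "lab x e" u] e(2) u_def by auto
        have "reduced (lab x e @ v)" using reduced_word_of [of "- x + y"] unfolding v [symmetric] u_def .
        then have "reduced v" by (simp add: reduced_append)
        moreover have "- of_word (lab x e) + of_word u = of_word v" by (simp add: v of_word_append)
        ultimately show ?thesis unfolding m du using RR_ne [OF RR] by (simp add: v)
      qed
      then show ?thesis using me by blast
    qed
    show "\<exists>z c. btw x z y \<and> z \<noteq> y \<and> z \<in> Ax c \<and> y \<in> Ax c" if "x \<noteq> y"
    proof -
      define u where "u = word_of (- x + y)"
      have "- x + y \<noteq> 0" using that neg_eq_iff_add_eq_0 [of "- x" y] by auto
      then obtain u' s where u: "u = u' @ [s]" by (cases u rule: rev_cases) (auto simp: u_def)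
      have "reduced (u' @ [s])" using reduced_word_of [of "- x + y"] unfolding u [symmetric] u_def .
      then have red: "reduced u'" by (simp add: reduced_append)
      define z where "z = x + of_word u'"
      have "- x + y = of_word u' + of_word [s]"
        unfolding of_word_append [symmetric] u [symmetric] by (simp add: u_def)
      then have "x + (- x + y) = x + (of_word u' + of_word [s])" by simp
      then have y: "y = z + of_word [s]" by (simp add: z_def add.assoc)
      \<comment> \<open>A relator that begins with the last letter of the path gives an axis through
        the last edge.\<close>
      obtain r where r: "r \<in> RR" "hd r = s" using RR_letter by blast
      have l: "lab z (conj_by z (of_word r)) = r" using RR_reduced [OF r(1)] by (simp add: lab_def)
      have s1: "word_of (of_word [s]) = [s]" by (simp add: reduced_Cons)
      have "- x + z = of_word u'" "- z + y = of_word [s]" by (simp_all add: z_def y)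
      moreover have "length (word_of (- x + y)) = length u' + 1" unfolding u_def [symmetric] u by simp
      ultimately have "btw x z y" unfolding btw_def fg_dist_def using red s1 by simp
      moreover have "of_word [s] \<noteq> 0" using s1 by (metis word_of_zero list.distinct(1))
      then have "z \<noteq> y" using add_left_cancel [of z 0 "of_word [s]"] unfolding y by simp
      moreover have "z \<in> Ax (conj_by z (of_word r))" using l r by (simp add: Ax_lab)
      moreover from this have "y \<in> Ax (conj_by z (of_word r))" unfolding y
        using r RR_ne by (intro Ax_periodic) (auto simp: l)
      ultimately show ?thesis by blast
    qed
  qed
qed

section \<open>Cones over the axes\<close>

lemma of_word_reduce [simp]: "of_word (reduce u) = of_word u"
  by transfer (simp add: reduce_reduced reduced_reduce)

context relators
begin

text \<open>The cone edges lifted from the cycle to the axis. The two signs account for both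
  directions of reading.\<close>

definition edge :: "'a word set \<Rightarrow> 'a fg \<Rightarrow> ('a fg \<times> 'a fg) set" where
  "edge X c = {(x, y). x \<in> Ax c \<and> (\<exists>u\<in>X. y = x + of_word u \<and>
    (prefix u (lab x c) \<or> prefix u (lab x (- c))))}"

definition sedge :: "'a word set \<Rightarrow> 'a fg \<Rightarrow> ('a fg \<times> 'a fg) set" where
  "sedge X c = edge X c \<union> (edge X c)\<inverse>"

text \<open>Paths in the cone, lifted to the axis: since the cone is the quotient of the axis by the
  translations along it, the end point only matters up to these translations.\<close>

definition reach :: "'a word set \<Rightarrow> 'a fg \<Rightarrow> nat \<Rightarrow> 'a fg \<Rightarrow> 'a fg \<Rightarrow> bool" where
  "reach X c n x y \<longleftrightarrow> x \<in> Ax c \<and> y \<in> Ax c \<and> (\<exists>\<rho>\<in>gen {c}. \<exists>m\<le>n. (x, \<rho> + y) \<in> sedge X c ^^ m)"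

lemma edge_Ax: "(x, y) \<in> edge X c \<Longrightarrow> x \<in> Ax c \<and> y \<in> Ax c"
  unfolding edge_def by (auto simp: lab_uminus intro: Ax_periodic Ax_periodic_inv prefix_periodic)

lemma sedge_sym: "(x, y) \<in> sedge X c \<longleftrightarrow> (y, x) \<in> sedge X c"
  by (auto simp: sedge_def)

lemma edge_conj: "(x, y) \<in> edge X c \<Longrightarrow> (h + x, h + y) \<in> edge X (conj_by h c)"
  unfolding edge_def by (auto simp: lab_conj add.assoc simp flip: conj_by_uminus)

lemma sedge_conj: "(x, y) \<in> sedge X c \<Longrightarrow> (h + x, h + y) \<in> sedge X (conj_by h c)"
  unfolding sedge_def using edge_conj by blast

lemma sedge_path_conj: "(x, y) \<in> sedge X c ^^ m \<Longrightarrow> (h + x, h + y) \<in> sedge X (conj_by h c) ^^ m"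
proof (induction m arbitrary: y)
  case (Suc m)
  then obtain w where "(x, w) \<in> sedge X c ^^ m" "(w, y) \<in> sedge X c" by auto
  then show ?case using Suc.IH sedge_conj by (metis relpow_Suc_I)
qed simp

lemma sedge_path_Rot: "(x, y) \<in> sedge X c ^^ m \<Longrightarrow> \<rho> \<in> gen {c} \<Longrightarrow> (\<rho> + x, \<rho> + y) \<in> sedge X c ^^ m"
  using sedge_path_conj [of x y m X c \<rho>] gen_commutes [of \<rho> c] by simp

lemma sedge_path_sym: "(x, y) \<in> sedge X c ^^ m \<Longrightarrow> (y, x) \<in> sedge X c ^^ m"
proof (induction m arbitrary: y)
  case (Suc m)
  then obtain w where "(x, w) \<in> sedge X c ^^ m" "(w, y) \<in> sedge X c" by auto
  then have "(w, x) \<in> sedge X c ^^ m" "(y, w) \<in> sedge X c" using Suc.IH sedge_sym by blast+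
  then show ?case by (rule relpow_Suc_I2 [rotated])
qed simp

lemma sedge_uminus: "sedge X (- c) = sedge X c"
  unfolding sedge_def edge_def by auto

lemma reach_edge: "(x, y) \<in> edge X c \<Longrightarrow> reach X c 1 x y"
  unfolding reach_def using edge_Ax [of x y X c] gen_zero [of "{c}"]
  by (auto simp: sedge_def intro!: bexI [of _ 0] exI [of _ 1])

lemma reach_symmetric: "reach X c n x y \<Longrightarrow> reach X c n y x"
proof -
  assume "reach X c n x y"
  then obtain \<rho> m where xy: "x \<in> Ax c" "y \<in> Ax c" and \<rho>: "\<rho> \<in> gen {c}" and m: "m \<le> n"
    "(x, \<rho> + y) \<in> sedge X c ^^ m"
    unfolding reach_def by blast
  from sedge_path_Rot [OF sedge_path_sym [OF m(2)] gen_uminus [OF \<rho>]]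
  have "(y, - \<rho> + x) \<in> sedge X c ^^ m" by simp
  then show ?thesis unfolding reach_def using xy m(1) gen_uminus [OF \<rho>] by blast
qed

lemma reach_transitive:
  assumes "reach X c m x y" "reach X c n y z"
  shows "reach X c (m + n) x z"
proof -
  from assms(1) obtain \<rho> i
    where x: "x \<in> Ax c" and \<rho>: "\<rho> \<in> gen {c}" and i: "i \<le> m" "(x, \<rho> + y) \<in> sedge X c ^^ i"
    unfolding reach_def by blast
  from assms(2) obtain \<sigma> j
    where z: "z \<in> Ax c" and \<sigma>: "\<sigma> \<in> gen {c}" and j: "j \<le> n" "(y, \<sigma> + z) \<in> sedge X c ^^ j"
    unfolding reach_def by blast
  have "(\<rho> + y, (\<rho> + \<sigma>) + z) \<in> sedge X c ^^ j" using sedge_path_Rot [OF j(2) \<rho>] by (simp add: add.assoc)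
  then have "(x, (\<rho> + \<sigma>) + z) \<in> sedge X c ^^ (i + j)" using i(2) by (auto simp: relpow_add)
  moreover have "i + j \<le> m + n" using i(1) j(1) by simp
  ultimately show ?thesis unfolding reach_def using x z gen_add [OF \<rho> \<sigma>] by blast
qed

lemma reach_rotate: "reach X c n x y \<Longrightarrow> \<rho> \<in> gen {c} \<Longrightarrow> reach X c n x (\<rho> + y)"
proof -
  assume r: "reach X c n x y" and \<rho>: "\<rho> \<in> gen {c}"
  from r obtain \<sigma> m where xy: "x \<in> Ax c" "y \<in> Ax c" and \<sigma>: "\<sigma> \<in> gen {c}" and m: "m \<le> n"
    "(x, \<sigma> + y) \<in> sedge X c ^^ m"
    unfolding reach_def by blast
  have "\<sigma> + y = (\<sigma> + - \<rho>) + (\<rho> + y)" by (simp only: group_norm)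
  then have "(x, (\<sigma> + - \<rho>) + (\<rho> + y)) \<in> sedge X c ^^ m" using m(2) by simp
  then show ?thesis unfolding reach_def using xy \<rho> m(1) gen_add [OF \<sigma> gen_uminus [OF \<rho>]] by auto
qed

lemma reach_translate: "reach X c n x y \<Longrightarrow> reach X (conj_by h c) n (h + x) (h + y)"
proof -
  assume "reach X c n x y"
  then obtain \<rho> m where xy: "x \<in> Ax c" "y \<in> Ax c" and \<rho>: "\<rho> \<in> gen {c}" and m: "m \<le> n"
    "(x, \<rho> + y) \<in> sedge X c ^^ m"
    unfolding reach_def by blast
  have "(h + x, conj_by h \<rho> + (h + y)) \<in> sedge X (conj_by h c) ^^ m"
    unfolding conj_by_plus by (rule sedge_path_conj [OF m(2)])
  then show ?thesis unfolding reach_def using xy m(1) conj_by_gen [OF \<rho>] by auto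
qed

lemma reach_cong:
  assumes "\<And>u x e. x \<in> Ax c \<Longrightarrow> e = c \<or> e = - c \<Longrightarrow> prefix u (lab x e) \<Longrightarrow> u \<in> X \<longleftrightarrow> u \<in> Y"
  shows "reach X c = reach Y c"
proof -
  have "edge X c = edge Y c" unfolding edge_def using assms by blast
  then have "sedge X c = sedge Y c" by (simp add: sedge_def)
  then show ?thesis by (intro ext) (simp add: reach_def)
qed

lemma reach_word:
  assumes "reach X c n x y"
  shows "\<exists>\<rho> ws. \<rho> \<in> gen {c} \<and> length ws \<le> n \<and> set ws \<subseteq> X \<union> word_inv ` X \<and> \<rho> + y = x + of_word (concat ws)"
proof -
  obtain \<rho> m where \<rho>: "\<rho> \<in> gen {c}" and m: "m \<le> n" and p: "(x, \<rho> + y) \<in> sedge X c ^^ m"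
    using assms unfolding reach_def by blast
  have "\<exists>ws. length ws = m \<and> set ws \<subseteq> X \<union> word_inv ` X \<and> z = x + of_word (concat ws)"
    if "(x, z) \<in> sedge X c ^^ m" for z m
    using that
  proof (induction m arbitrary: z)
    case 0
    then show ?case by simp
  next
    case (Suc m)
    then obtain w where xw: "(x, w) \<in> sedge X c ^^ m" and wz: "(w, z) \<in> sedge X c" by auto
    obtain ws where ws: "length ws = m" "set ws \<subseteq> X \<union> word_inv ` X" "w = x + of_word (concat ws)"
      using Suc.IH [OF xw] by blast
    have "\<exists>u \<in> X \<union> word_inv ` X. z = w + of_word u"
    proof (cases "(w, z) \<in> edge X c")
      case True
      then show ?thesis unfolding edge_def by auto
    next
      case False
      then have "(z, w) \<in> edge X c" using wz by (auto simp: sedge_def)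
      then obtain u where "u \<in> X" "w = z + of_word u" unfolding edge_def by auto
      then have "z = w + of_word (word_inv u)" by (simp add: of_word_word_inv add.assoc)
      then show ?thesis using \<open>u \<in> X\<close> by blast
    qed
    then obtain u where "u \<in> X \<union> word_inv ` X" "z = w + of_word u" by blast
    then show ?case using ws by (intro exI [of _ "ws @ [u]"]) (simp add: of_word_append add.assoc)
  qed
  from this [OF p] show ?thesis using \<rho> m by blast
qed

end

locale relator_cones = relators +
  fixes X :: "'a word set"
  assumes X_pieces: "r \<in> RR \<Longrightarrow> r' \<in> RR \<Longrightarrow> r \<noteq> r' \<Longrightarrow> prefix u r \<Longrightarrow> prefix u r' \<Longrightarrow> u \<noteq> [] \<Longrightarrow> u \<in> X"

sublocale relator_cones \<subseteq> cone_system fg_dist Ax len "reach X"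
proof
  fix c c' h \<rho> x y z :: "'a fg" and m n :: nat
  show "x \<in> Ax c \<and> y \<in> Ax c" if "reach X c n x y" using that by (simp add: reach_def)
  show refl: "reach X c 0 x x" if "x \<in> Ax c"
    unfolding reach_def using that gen_zero [of "{c}"] by (auto intro!: bexI [of _ 0])
  show "reach X c n y x" if "reach X c n x y" using that by (rule reach_symmetric)
  show "reach X c (m + n) x z" if "reach X c m x y" "reach X c n y z" using that by (rule reach_transitive)
  show "reach X c n x y" if "reach X c m x y" "m \<le> n" using that unfolding reach_def by (meson order_trans)
  show "reach X c n x (\<rho> + y)" if "reach X c n x y" "\<rho> \<in> gen {c}" using that by (rule reach_rotate)
  show "reach X (conj_by h c) n (h + x) (h + y)" if "reach X c n x y" using that by (rule reach_translate)
  show "reach X c' n x y" if "pm_eq c c'" "reach X c n x y"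
  proof -
    have "reach X (- c) n x y = reach X c n x y" by (simp add: reach_def sedge_uminus gen_sing_uminus)
    then show ?thesis using that unfolding pm_eq_def by blast
  qed
  show "reach X c 1 x y" if A: "x \<in> Ax c" "y \<in> Ax c" "x \<in> Ax c'" "y \<in> Ax c'" "\<not> pm_eq c c'"
  proof (cases "x = y")
    case True
    then show ?thesis using gen_zero [of "{c}"] A
      by (auto simp: reach_def intro!: bexI [of _ 0] exI [of _ 0])
  next
    case False
    obtain e e' where e: "e = c \<or> e = - c" "lab x e \<in> RR" "lab x e' \<in> RR" "lab x e \<noteq> lab x e'"
      "periodic (lab x e) (word_of (- x + y))" "periodic (lab x e') (word_of (- x + y))"
      using Ax_overlap_word [OF A] by metis
    note p = periodic_overlap(2,3) [OF e(2-)]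
    have "word_of (- x + y) \<noteq> []" using False neg_eq_iff_add_eq_0 [of "- x" y] by simp
    then have "word_of (- x + y) \<in> X" using X_pieces [OF e(2-4) p] by blast
    then have "(x, y) \<in> edge X c" unfolding edge_def using A(1) p(1) e(1)
      by (auto intro!: bexI [of _ "word_of (- x + y)"])
    then show ?thesis by (rule reach_edge)
  qed
qed

context relator_cones
begin

text \<open>A prefix of a relator can be read from any vertex along a suitable axis and is then a
  single edge of its cone. So each factor becomes a side of weight 1.\<close>

lemma chain_of_words:
  assumes prefixes: "\<And>u. u \<in> X \<Longrightarrow> \<exists>r\<in>RR. prefix u r"
  shows "set ws \<subseteq> X \<union> word_inv ` X \<Longrightarrow>
    \<exists>sd. length sd = length ws \<and> weight sd = length ws \<and> chain (reach X) x sd (x + of_word (concat ws))"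
proof (induction ws arbitrary: x)
  case Nil
  show ?case by simp
next
  case (Cons w ws)
  have edge: "\<exists>c. (z, z + of_word u) \<in> edge X c" if u: "u \<in> X" for u z
  proof -
    obtain r where r: "r \<in> RR" "prefix u r" using prefixes u by blast
    have "lab z (conj_by z (of_word r)) = r" using RR_reduced [OF r(1)] by (simp add: lab_def)
    then have "(z, z + of_word u) \<in> edge X (conj_by z (of_word r))"
      unfolding edge_def using r u by (auto simp: Ax_lab)
    then show ?thesis by blast
  qed
  have "\<exists>c. reach X c 1 x (x + of_word w)"
  proof (cases "w \<in> X")
    case True
    then show ?thesis using edge reach_edge by blast
  next
    case False
    then obtain u where u: "u \<in> X" "w = word_inv u" using Cons.prems by auto
    obtain c where "(x + of_word w, x + of_word w + of_word u) \<in> edge X c" using edge u(1) by blast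
    then have "(x + of_word w, x) \<in> edge X c" unfolding u(2) by (simp add: of_word_word_inv add.assoc)
    then show ?thesis using reach_symmetric [OF reach_edge] by blast
  qed
  then obtain c where c: "reach X c 1 x (x + of_word w)" by blast
  obtain sd where sd: "length sd = length ws" "weight sd = length ws"
    "chain (reach X) (x + of_word w) sd (x + of_word w + of_word (concat ws))"
    using Cons.IH [of "x + of_word w"] Cons.prems by auto
  show ?case using c sd
    by (intro exI [of _ "(c, 1, x + of_word w) # sd"]) (simp add: of_word_append add.assoc)
qed

text \<open>The product and \<open>y\<close> agree modulo \<open>N\<close>, so the broken path
  closes up with a base from \<open>y\<close> to \<open>0\<close>; both its number of sides and its
  weight equal the number of factors.\<close>

lemma reach_of_words:
  assumes "\<And>u. u \<in> X \<Longrightarrow> \<exists>r\<in>RR. prefix u r" "set ws \<subseteq> X \<union> word_inv ` X"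
    and "of_word (concat ws) - y \<in> N" "0 \<in> Ax c" "y \<in> Ax c" "length ws \<le> n"
  shows "reach X c (polygon_bound n n) 0 y"
proof -
  obtain sd where sd: "length sd = length ws" "weight sd = length ws"
    "chain (reach X) 0 sd (0 + of_word (concat ws))"
    using chain_of_words [OF assms(1,2)] by blast
  then have "chain (reach X) 0 sd ((of_word (concat ws) - y) + y)" by simp
  from polygon [OF this assms(3,5,4)] have "reach X c (polygon_bound (length ws) (length ws)) y 0"
    by (simp add: sd)
  then have "reach X c (polygon_bound n n) y 0"
    by (rule reach_mono) (use assms(6) in \<open>simp add: polygon_bound_mono\<close>)
  then show ?thesis by (rule reach_symmetric)
qed

end

section \<open>Word lengths in groups\<close>

lemma gens_equiv_iff: "(X, Y) \<in> gens_equiv G \<longleftrightarrow> generating_set G X \<and> generating_set G Y \<and>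
  gens_le G X Y \<and> gens_le G Y X"
  by (simp add: gens_equiv_def)

context group
begin

definition letters :: "'a set \<Rightarrow> 'a set" where
  "letters X = X \<union> m_inv G ` X"

lemma letters_closed: "X \<subseteq> carrier G \<Longrightarrow> letters X \<subseteq> carrier G"
  by (auto simp: letters_def)

lemma letters_inv: "X \<subseteq> carrier G \<Longrightarrow> x \<in> letters X \<Longrightarrow> inv x \<in> letters X"
  by (auto simp: letters_def)

lemma foldr_mult_closed: "set xs \<subseteq> carrier G \<Longrightarrow> foldr (\<otimes>) xs \<one> \<in> carrier G"
  by (induction xs) auto

lemma foldr_mult_append:
  "set xs \<subseteq> carrier G \<Longrightarrow> set ys \<subseteq> carrier G \<Longrightarrow> foldr (\<otimes>) (xs @ ys) \<one> = foldr (\<otimes>) xs \<one> \<otimes> foldr (\<otimes>) ys \<one>"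
  by (induction xs) (auto simp: m_assoc foldr_mult_closed)

lemma foldr_mult_inv:
  "set xs \<subseteq> carrier G \<Longrightarrow> inv (foldr (\<otimes>) xs \<one>) = foldr (\<otimes>) (rev (map (m_inv G) xs)) \<one>"
proof (induction xs)
  case (Cons x xs)
  then have "foldr (\<otimes>) (rev (map (m_inv G) (x # xs))) \<one> = foldr (\<otimes>) (rev (map (m_inv G) xs)) \<one> \<otimes> inv x"
    using foldr_mult_append [of "rev (map (m_inv G) xs)" "[inv x]"] by auto
  then show ?case using Cons by (simp add: inv_mult_group foldr_mult_closed)
qed simp

lemma word_length_le:
  "set xs \<subseteq> letters X \<Longrightarrow> word_length G X (foldr (\<otimes>) xs \<one>) \<le> length xs"
  unfolding word_length_def letters_def by (rule Least_le) blast

lemma generate_foldr: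
  assumes "X \<subseteq> carrier G" "g \<in> generate G X"
  shows "\<exists>xs. set xs \<subseteq> letters X \<and> g = foldr (\<otimes>) xs \<one>"
  using assms(2)
proof induction
  case one
  show ?case by (rule exI [of _ "[]"]) simp
next
  case (incl h)
  then show ?case using assms(1) by (intro exI [of _ "[h]"]) (auto simp: letters_def)
next
  case (inv h)
  then show ?case using assms(1) by (intro exI [of _ "[inv h]"]) (auto simp: letters_def)
next
  case (eng g h)
  then obtain xs ys where "set xs \<subseteq> letters X" "g = foldr (\<otimes>) xs \<one>" "set ys \<subseteq> letters X"
    "h = foldr (\<otimes>) ys \<one>"
    by blast
  then show ?case using foldr_mult_append [of xs ys] letters_closed [OF assms(1)]
    by (intro exI [of _ "xs @ ys"]) auto
qed

lemma word_length_expr: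
  assumes "generating_set G X" "g \<in> carrier G"
  obtains xs where "length xs = word_length G X g" "set xs \<subseteq> letters X" "g = foldr (\<otimes>) xs \<one>"
proof -
  have "\<exists>xs. set xs \<subseteq> letters X \<and> g = foldr (\<otimes>) xs \<one>"
    using assms generate_foldr unfolding generating_set_def by blast
  then have "\<exists>n xs. length xs = n \<and> set xs \<subseteq> letters X \<and> g = foldr (\<otimes>) xs \<one>" by blast
  from LeastI_ex [OF this] show thesis using that unfolding word_length_def letters_def by blast
qed

lemma generating_subset: "generating_set G X \<Longrightarrow> X \<subseteq> carrier G"
  by (simp add: generating_set_def)

lemma word_length_mult:
  assumes "generating_set G X" "g \<in> carrier G" "h \<in> carrier G"
  shows "word_length G X (g \<otimes> h) \<le> word_length G X g + word_length G X h"
proof -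
  obtain xs where xs: "length xs = word_length G X g" "set xs \<subseteq> letters X" "g = foldr (\<otimes>) xs \<one>"
    using word_length_expr [OF assms(1,2)] .
  obtain ys where ys: "length ys = word_length G X h" "set ys \<subseteq> letters X" "h = foldr (\<otimes>) ys \<one>"
    using word_length_expr [OF assms(1,3)] .
  have "set xs \<subseteq> carrier G" "set ys \<subseteq> carrier G"
    using xs(2) ys(2) letters_closed [OF generating_subset [OF assms(1)]] by auto
  then have "g \<otimes> h = foldr (\<otimes>) (xs @ ys) \<one>" using foldr_mult_append xs(3) ys(3) by simp
  moreover have "word_length G X (foldr (\<otimes>) (xs @ ys) \<one>) \<le> length (xs @ ys)"
    by (rule word_length_le) (use xs ys in auto)
  ultimately show ?thesis using xs(1) ys(1) by simp
qed

lemma word_length_inv: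
  assumes "generating_set G X" "g \<in> carrier G"
  shows "word_length G X (inv g) \<le> word_length G X g"
proof -
  obtain xs where xs: "length xs = word_length G X g" "set xs \<subseteq> letters X" "g = foldr (\<otimes>) xs \<one>"
    using word_length_expr [OF assms] .
  have "set xs \<subseteq> carrier G" using xs(2) letters_closed [OF generating_subset [OF assms(1)]] by auto
  from foldr_mult_inv [OF this] have "inv g = foldr (\<otimes>) (rev (map (m_inv G) xs)) \<one>" using xs(3) by simp
  moreover have "word_length G X (foldr (\<otimes>) (rev (map (m_inv G) xs)) \<one>) \<le> length (rev (map (m_inv G) xs))"
    by (rule word_length_le) (use xs(2) letters_inv [OF generating_subset [OF assms(1)]] in auto)
  ultimately show ?thesis using xs(1) by simp
qed

lemma word_length_one: "word_length G X \<one> = 0"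
  using word_length_le [of "[]" X] by simp

lemma word_length_change:
  assumes X: "generating_set G X" and Y: "generating_set G Y" and g: "g \<in> carrier G"
    and B: "\<And>y. y \<in> Y \<Longrightarrow> word_length G X y \<le> B"
  shows "word_length G X g \<le> word_length G Y g * B"
proof -
  obtain ys where ys: "length ys = word_length G Y g" "set ys \<subseteq> letters Y" "g = foldr (\<otimes>) ys \<one>"
    using word_length_expr [OF Y g] .
  have YG: "Y \<subseteq> carrier G" using generating_subset [OF Y] .
  have le: "word_length G X y \<le> B" if "y \<in> letters Y" for y
    using that B word_length_inv [OF X] YG order_trans unfolding letters_def by blast
  have "word_length G X (foldr (\<otimes>) ys \<one>) \<le> length ys * B"
    using ys(2)
  proof (induction ys)
    case Nil
    show ?case by (simp add: word_length_one)
  next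
    case (Cons y ys)
    then have c: "y \<in> carrier G" "set ys \<subseteq> carrier G" using letters_closed [OF YG] by auto
    have "word_length G X (foldr (\<otimes>) (y # ys) \<one>) \<le> word_length G X y + word_length G X (foldr (\<otimes>) ys \<one>)"
      using word_length_mult [OF X c(1) foldr_mult_closed [OF c(2)]] by simp
    also have "\<dots> \<le> B + length ys * B" using Cons le [of y] by (intro add_mono) auto
    finally show ?case by simp
  qed
  then show ?thesis using ys by simp
qed

lemma gens_le_iff: "gens_le G X Y \<longleftrightarrow> (\<exists>B. \<forall>y\<in>Y. word_length G X y \<le> B)"
  by (auto simp: gens_le_def bdd_above_def)

lemma gens_le_refl: "X \<subseteq> carrier G \<Longrightarrow> gens_le G X X"
  unfolding gens_le_iff
proof (intro exI [of _ 1] ballI)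
  fix y assume "X \<subseteq> carrier G" "y \<in> X"
  then show "word_length G X y \<le> 1" using word_length_le [of "[y]" X] by (auto simp: letters_def)
qed

lemma gens_le_trans:
  assumes "generating_set G X" "generating_set G Y" "Z \<subseteq> carrier G" "gens_le G X Y" "gens_le G Y Z"
  shows "gens_le G X Z"
proof -
  obtain B C where B: "\<And>y. y \<in> Y \<Longrightarrow> word_length G X y \<le> B" and C: "\<And>z. z \<in> Z \<Longrightarrow> word_length G Y z \<le> C"
    using assms(4,5) unfolding gens_le_iff by blast
  have "word_length G X z \<le> C * B" if "z \<in> Z" for z
  proof -
    have "z \<in> carrier G" using that assms(3) by blast
    from word_length_change [OF assms(1,2) this B] have "word_length G X z \<le> word_length G Y z * B" by blast
    also have "\<dots> \<le> C * B" using C [OF that] by (rule mult_le_mono1)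
    finally show ?thesis .
  qed
  then show ?thesis unfolding gens_le_iff by blast
qed

lemma equiv_gens_equiv: "equiv (Collect (generating_set G)) (gens_equiv G)"
proof (rule equivI)
  show "gens_equiv G \<subseteq> Collect (generating_set G) \<times> Collect (generating_set G)"
    by (auto simp: gens_equiv_def)
  show "refl_on (Collect (generating_set G)) (gens_equiv G)"
    using gens_le_refl [OF generating_subset] by (auto simp: refl_on_def gens_equiv_def)
  show "sym (gens_equiv G)" by (auto simp: sym_def gens_equiv_def)
  show "trans (gens_equiv G)"
    unfolding trans_def gens_equiv_def using gens_le_trans generating_subset by blast
qed

lemma gens_class_eqI: "generating_set G X \<Longrightarrow> generating_set G Y \<Longrightarrow> gens_le G X Y \<Longrightarrow> gens_le G Y X \<Longrightarrow>
    gens_equiv G `` {X} = gens_equiv G `` {Y}"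
  by (rule equiv_class_eq [OF equiv_gens_equiv]) (simp add: gens_equiv_iff)

lemma gens_classes_eq:
  assumes "c \<in> gens_classes G" "X \<in> c"
  shows "generating_set G X" "c = gens_equiv G `` {X}"
proof -
  obtain Y where Y: "generating_set G Y" "c = gens_equiv G `` {Y}"
    using assms(1) unfolding gens_classes_def by (auto elim: quotientE)
  then show "generating_set G X" using assms(2) by (simp add: gens_equiv_iff)
  have "(Y, X) \<in> gens_equiv G" using Y assms(2) by simp
  then show "c = gens_equiv G `` {X}" unfolding Y(2) by (rule equiv_class_eq [OF equiv_gens_equiv])
qed

lemma gens_class_le_iff:
  assumes "generating_set G X" "generating_set G Y"
  shows "gens_class_le G (gens_equiv G `` {X}) (gens_equiv G `` {Y}) \<longleftrightarrow> gens_le G X Y"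
proof
  assume "gens_class_le G (gens_equiv G `` {X}) (gens_equiv G `` {Y})"
  then obtain X' Y' where *: "(X, X') \<in> gens_equiv G" "(Y, Y') \<in> gens_equiv G" "gens_le G X' Y'"
    unfolding gens_class_le_def by blast
  then have g: "generating_set G X'" "generating_set G Y'" and le: "gens_le G X X'" "gens_le G Y' Y"
    by (auto simp: gens_equiv_iff)
  have "gens_le G X Y'" using gens_le_trans [OF assms(1) g(1) generating_subset [OF g(2)] le(1) *(3)] .
  then show "gens_le G X Y"
    using gens_le_trans [OF assms(1) g(2) generating_subset [OF assms(2)] _ le(2)] by blast
next
  assume "gens_le G X Y"
  then show "gens_class_le G (gens_equiv G `` {X}) (gens_equiv G `` {Y})"
    unfolding gens_class_le_def using assms gens_le_refl [OF generating_subset]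
    by (intro bexI [of _ X] bexI [of _ Y]) (auto simp: gens_equiv_iff)
qed

end

lemma Pomega_Fin_cases:
  assumes "a \<in> Pomega_Fin"
  obtains A where "a = fin_class A"
  using assms unfolding Pomega_Fin_def fin_class_def by (auto elim: quotientE)

lemma mem_fin_class: "B \<in> fin_class A \<longleftrightarrow> finite (A - B) \<and> finite (B - A)"
  by (auto simp: fin_class_def eq_mod_fin_def)

lemma Pomega_Fin_le_iff: "Pomega_Fin_le (fin_class A) (fin_class B) \<longleftrightarrow> finite (A - B)"
proof
  assume "Pomega_Fin_le (fin_class A) (fin_class B)"
  then obtain A' B' where "A' \<in> fin_class A" "B' \<in> fin_class B" "finite (A' - B')"
    unfolding Pomega_Fin_le_def by blast
  then have "finite ((A - A') \<union> (A' - B') \<union> (B' - B))" by (simp add: mem_fin_class)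
  then show "finite (A - B)" by (rule rev_finite_subset) auto
next
  assume "finite (A - B)"
  then show "Pomega_Fin_le (fin_class A) (fin_class B)"
    unfolding Pomega_Fin_le_def by (intro bexI [of _ A] bexI [of _ B]) (auto simp: mem_fin_class)
qed

text \<open>\<open>lev k\<close> is the rank of the value \<open>h k\<close> among all values in
  increasing order. Ranks exhaust the natural numbers, and a strictly increasing sequence dominates
  its index.\<close>

lemma infinite_levels:
  fixes h :: "'k \<Rightarrow> nat"
  assumes "infinite (h ` A)"
  obtains lev where "\<And>k l. k \<in> A \<Longrightarrow> l \<in> A \<Longrightarrow> lev k = lev l \<Longrightarrow> h k = h l"
    "\<And>n. \<exists>k\<in>A. lev k = (n::nat)" "\<And>k. k \<in> A \<Longrightarrow> lev k \<le> h k"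
proof -
  let ?e = "enumerate (h ` A)"
  define lev where "lev k = inv_into UNIV ?e (h k)" for k
  have bij: "bij_betw ?e UNIV (h ` A)" using bij_enumerate [OF assms] .
  have e: "?e (lev k) = h k" if "k \<in> A" for k
    unfolding lev_def using that bij by (intro f_inv_into_f) (auto simp: bij_betw_def)
  show thesis
  proof
    show "h k = h l" if "k \<in> A" "l \<in> A" "lev k = lev l" for k l using e that by metis
    show "\<exists>k\<in>A. lev k = n" for n
    proof -
      have "?e n \<in> h ` A" using bij by (auto simp: bij_betw_def)
      then obtain k where k: "k \<in> A" "?e n = h k" by blast
      then have "lev k = n" unfolding lev_def
        using bij inv_into_f_f [of ?e UNIV n] by (simp add: bij_betw_def)
      then show ?thesis using k(1) by blast
    qed
    show "lev k \<le> h k" if "k \<in> A" for k using le_enumerate [OF assms, of "lev k"] e [OF that] by simp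
  qed
qed

section \<open>Small cancellation presentations\<close>

lemma reduced_singleton [simp]: "reduced [x]"
  by (simp add: reduced_Cons)

lemma cyclically_reduced_rotate1:
  assumes "cyclically_reduced r"
  shows "cyclically_reduced (rotate1 r)"
proof (cases r)
  case (Cons x t)
  show ?thesis
  proof (cases "t = []")
    case True
    then show ?thesis using Cons by (simp add: cyclically_reduced_def)
  next
    case False
    then show ?thesis using assms Cons
      by (auto simp: cyclically_reduced_def reduced_append reduced_Cons)
  qed
qed (simp add: cyclically_reduced_def)

lemma cyclically_reduced_rotate: "cyclically_reduced r \<Longrightarrow> cyclically_reduced (rotate k r)"
  by (induction k) (auto intro: cyclically_reduced_rotate1)

lemma cyclically_reduced_word_inv: "cyclically_reduced r \<Longrightarrow> cyclically_reduced (word_inv r)"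
  unfolding cyclically_reduced_def by (auto simp: reduced_word_inv hd_word_inv last_word_inv)

lemma mem_symmetrized: "w \<in> symmetrized R \<longleftrightarrow> (\<exists>r\<in>R. \<exists>k. w = rotate k r \<or> w = rotate k (word_inv r))"
  by (auto simp: symmetrized_def cyclic_conjugates_def)

lemma symmetrized_self: "r \<in> symmetrized {r}"
  unfolding mem_symmetrized by (intro bexI exI [of _ 0]) auto

lemma symmetrized_Union: "w \<in> symmetrized R \<longleftrightarrow> (\<exists>r\<in>R. w \<in> symmetrized {r})"
  by (simp add: mem_symmetrized)

lemma symmetrized_rotate: "w \<in> symmetrized R \<Longrightarrow> rotate k w \<in> symmetrized R"
  unfolding mem_symmetrized by (metis rotate_rotate)

lemma word_inv_rotate1: "word_inv (rotate1 r) = rotate (length r - 1) (word_inv r)"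
proof (cases r)
  case (Cons x t)
  have "rotate (length (word_inv t)) (word_inv t @ [flip x]) = [flip x] @ word_inv t"
    by (rule rotate_append)
  then show ?thesis using Cons by (simp add: word_inv_append word_inv_Cons)
qed (simp add: word_inv_def)

lemma word_inv_rotate: "\<exists>j. word_inv (rotate k r) = rotate j (word_inv r)"
proof (induction k)
  case 0
  show ?case by (rule exI [of _ 0]) simp
next
  case (Suc k)
  then obtain j where "word_inv (rotate k r) = rotate j (word_inv r)" by blast
  then have "word_inv (rotate (Suc k) r) = rotate (length r - 1 + j) (word_inv r)"
    by (simp add: word_inv_rotate1 rotate_rotate)
  then show ?case by blast
qed

lemma symmetrized_word_inv: "w \<in> symmetrized R \<Longrightarrow> word_inv w \<in> symmetrized R"
  unfolding mem_symmetrized by (metis word_inv_rotate word_inv_word_inv)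

lemma rotate_back: "\<exists>j. rotate j (rotate k r) = r"
proof (cases "r = []")
  case False
  then have "k \<le> length r * k" by (cases "length r") auto
  then have "rotate (length r * k - k) (rotate k r) = rotate (length r * k) r"
    by (simp add: rotate_rotate)
  also have "\<dots> = r" by (subst rotate_conv_mod) simp
  finally show ?thesis by blast
qed simp

text \<open>Being equal up to rotation and inversion is an equivalence relation with these sets as
  classes.\<close>

lemma symmetrized_eq: "w \<in> symmetrized {r} \<Longrightarrow> symmetrized {w} = symmetrized {r}"
proof -
  have sub: "symmetrized {w} \<subseteq> symmetrized {r}" if "w \<in> symmetrized {r}" for w r :: "'a word"
  proof
    fix v assume "v \<in> symmetrized {w}"
    then obtain k where "v = rotate k w \<or> v = rotate k (word_inv w)" by (auto simp: mem_symmetrized)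
    then show "v \<in> symmetrized {r}" using that symmetrized_rotate symmetrized_word_inv by blast
  qed
  assume w: "w \<in> symmetrized {r}"
  then obtain k where "w = rotate k r \<or> w = rotate k (word_inv r)" by (auto simp: mem_symmetrized)
  then have "r \<in> symmetrized {w}"
  proof
    assume "w = rotate k r"
    then obtain j where "r = rotate j w" using rotate_back by metis
    then show ?thesis using symmetrized_rotate [OF symmetrized_self] by simp
  next
    assume "w = rotate k (word_inv r)"
    then obtain j where "word_inv r = rotate j w" using rotate_back by metis
    then have "r = word_inv (rotate j w)" by (metis word_inv_word_inv)
    then show ?thesis using symmetrized_word_inv [OF symmetrized_rotate [OF symmetrized_self]] by simp
  qed
  then show ?thesis using sub w by blast
qed

definition subwords :: "'a word set \<Rightarrow> 'a word set" where
  "subwords K = {u. \<exists>w\<in>K. sublist u w}"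

lemma subwords_at_eq: "subwords_at X r = X \<inter> subwords (symmetrized {r})"
  by (auto simp: subwords_at_def subwords_def)

lemma subwords_prefix:
  assumes "u \<in> subwords (symmetrized R)"
  obtains w where "w \<in> symmetrized R" "prefix u w"
proof -
  obtain w a b where w: "w \<in> symmetrized R" "w = a @ u @ b"
    using assms unfolding subwords_def sublist_def by blast
  have "rotate (length a) w = u @ b @ a" unfolding w(2) rotate_append by simp
  then show thesis using that symmetrized_rotate [OF w(1), of "length a"] by simp
qed

lemma prefix_subwords: "w \<in> K \<Longrightarrow> prefix u w \<Longrightarrow> u \<in> subwords K"
  unfolding subwords_def by auto

lemma finite_subwords_symmetrized: "finite (subwords (symmetrized {r}))"
proof -
  have "set w \<subseteq> set r \<union> set (word_inv r) \<and> length w = length r" if "w \<in> symmetrized {r}" for w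
    using that by (auto simp: mem_symmetrized)
  then have "subwords (symmetrized {r}) \<subseteq> {u. set u \<subseteq> set r \<union> set (word_inv r) \<and> length u \<le> length r}"
    unfolding subwords_def using set_mono_sublist sublist_length_le by fastforce
  then show ?thesis by (rule finite_subset) (intro finite_lists_length_le, simp)
qed

text \<open>The nondegenerate case; an empty relator is dealt with in
  \<open>trivial_thin_cones\<close>.\<close>

locale small_cancellation_presentation =
  fixes S :: "'a set" and R :: "'a word set"
  assumes presentation: "presentation S R" and small_cancellation: "small_cancellation (1 / 24) R"
    and nontrivial: "[] \<notin> R"
begin

abbreviation symR :: "'a word set" where "symR \<equiv> symmetrized R"

text \<open>A relator of length one for every letter outside \<^term>\<open>S\<close> preserves small cancellation; the axes
  then cover the Cayley tree of the free group on the whole type.\<close>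

definition RR :: "'a word set" where
  "RR = symR \<union> {[(s, b)] |s b. s \<notin> S}"

lemma sym_RR: "w \<in> symR \<Longrightarrow> w \<in> RR"
  by (simp add: RR_def)

lemma R_carrier: "R \<subseteq> carrier (free_group S)"
  using presentation by (simp add: presentation_def)

lemma sym_word:
  assumes "w \<in> symR"
  shows "cyclically_reduced w" "reduced w" "fst ` set w \<subseteq> S" "w \<noteq> []"
proof -
  obtain r k where r: "r \<in> R" and w: "w = rotate k r \<or> w = rotate k (word_inv r)"
    using assms by (auto simp: mem_symmetrized)
  have "cyclically_reduced r" using r presentation by (simp add: presentation_def)
  then show "cyclically_reduced w" using w cyclically_reduced_rotate cyclically_reduced_word_inv by blast
  then show "reduced w" by (simp add: cyclically_reduced_def)
  have "fst ` set r \<subseteq> S" using r R_carrier by (auto simp: free_group_def)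
  moreover have "fst ` set (word_inv r) = fst ` set r" by (simp add: word_inv_def image_image)
  ultimately show "fst ` set w \<subseteq> S" using w by (elim disjE) simp_all
  have "r \<noteq> []" using r nontrivial by blast
  then show "w \<noteq> []" using w by (elim disjE) simp_all
qed

lemma sym_carrier: "w \<in> symR \<Longrightarrow> w \<in> carrier (free_group S)"
  using sym_word by (simp add: free_group_def)

lemma sym_letter: "fst s \<in> S \<Longrightarrow> \<exists>r\<in>symR. hd r = s"
proof -
  assume "fst s \<in> S"
  then obtain r where r: "r \<in> R" "fst s \<in> fst ` set r"
    using presentation unfolding presentation_def by blast
  then obtain b where b: "(fst s, b) \<in> set r" by auto
  have *: "\<exists>r\<in>symR. hd r = s" if w: "w \<in> symR" "s \<in> set w" for w
  proof -
    obtain i where i: "i < length w" "w ! i = s" using w(2) by (auto simp: in_set_conv_nth)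
    then have "hd (rotate i w) = s" using hd_rotate_conv_nth [of w i] sym_word(4) [OF w(1)] by simp
    then show ?thesis using symmetrized_rotate w(1) by blast
  qed
  have "r \<in> symR" using r(1) symmetrized_self symmetrized_Union by blast
  show ?thesis
  proof (cases "b = snd s")
    case True
    then show ?thesis using * [OF \<open>r \<in> symR\<close>] b by simp
  next
    case False
    then have "s = flip (fst s, b)" by (cases s) auto
    then have "s \<in> flip ` set r" using b by (rule image_eqI)
    then have "s \<in> set (word_inv r)" by (simp add: word_inv_def)
    then show ?thesis using * [OF symmetrized_word_inv [OF \<open>r \<in> symR\<close>]] by blast
  qed
qed

lemma sym_piece:
  "r \<in> symR \<Longrightarrow> r' \<in> symR \<Longrightarrow> r \<noteq> r' \<Longrightarrow> prefix u r \<Longrightarrow> prefix u r' \<Longrightarrow> is_piece R u"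
  unfolding is_piece_def by blast

text \<open>Words of \<open>symR\<close> have all their letters over \<open>S\<close>, and an added
  relator is a single letter outside, so its first letter determines it within
  \<open>RR\<close>.\<close>

lemma RR_common_prefix:
  assumes "r \<in> RR" "r' \<in> RR" "r \<noteq> r'" "prefix u r" "prefix u r'" "u \<noteq> []"
  shows "r \<in> symR \<and> r' \<in> symR"
proof -
  obtain s v where u: "u = s # v" using assms(6) by (cases u) auto
  then have s: "r \<noteq> []" "r' \<noteq> []" "hd r = s" "hd r' = s" using assms(4,5) by (auto simp: prefix_def)
  have in_S: "fst s \<in> S" if "w \<in> symR" "w \<noteq> []" "hd w = s" for w
    using that sym_word(3) [of w] hd_in_set [of w] by auto
  then have "w \<in> symR \<or> w = [s] \<and> fst s \<notin> S" if "w \<in> RR" "hd w = s" for w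
    using that unfolding RR_def by auto
  from this [OF assms(1) s(3)] this [OF assms(2) s(4)] show ?thesis
    using in_S s assms(3) by blast
qed

sublocale relators RR
proof
  fix r r' u :: "'a word" and s :: "'a letter"
  show "reduced r" if "r \<in> RR" using that sym_word(2) by (auto simp: RR_def)
  show ne: "r \<noteq> []" if "r \<in> RR" for r using that sym_word(4) by (auto simp: RR_def)
  show "rotate1 r \<in> RR" if "r \<in> RR"
    using that symmetrized_rotate [of r R 1] by (auto simp: RR_def)
  show "word_inv r \<in> RR" if "r \<in> RR"
    using that symmetrized_word_inv by (auto simp: RR_def word_inv_def)
  show "24 * length u < length r" if a: "r \<in> RR" "r' \<in> RR" "r \<noteq> r'" "prefix u r" "prefix u r'"
  proof (cases "u = []")
    case True
    then show ?thesis using ne [OF a(1)] by simp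
  next
    case False
    from RR_common_prefix [OF a this] have "r \<in> symR" "r' \<in> symR" by auto
    moreover from this have "is_piece R u" using sym_piece a by blast
    ultimately have "real (length u) < 1 / 24 * real (length r)"
      using small_cancellation a(4) unfolding small_cancellation_def by blast
    then show ?thesis by linarith
  qed
  show "\<exists>r\<in>RR. hd r = s"
  proof (cases "fst s \<in> S")
    case True
    then show ?thesis using sym_letter unfolding RR_def by blast
  next
    case False
    then have "[s] \<in> RR" unfolding RR_def by (cases s) auto
    then show ?thesis by (intro bexI [of _ "[s]"]) auto
  qed
qed

section \<open>The presented group as a quotient of the free group\<close>

abbreviation F where "F \<equiv> free_group S"
abbreviation ncl where "ncl \<equiv> normal_closure F R"
abbreviation G where "G \<equiv> presented_group S R"

definition im :: "'a word \<Rightarrow> 'a word set" where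
  "im w = ncl #>\<^bsub>F\<^esub> w"

lemma image_in_group_eq: "image_in_group S R X = im ` X"
  by (simp add: image_in_group_def im_def)

sublocale F: group F
  by (rule group_free_group)

sublocale ncl: normal ncl F
  by (rule normal_normal_closure [OF group_free_group R_carrier])

sublocale G: group G
  unfolding presented_group_def by (rule ncl.factorgroup_is_group)

lemma im_hom: "im \<in> hom F G"
  using ncl.r_coset_hom_Mod by (simp add: presented_group_def im_def [abs_def])

lemma im_closed: "w \<in> carrier F \<Longrightarrow> im w \<in> carrier G"
  using im_hom by (rule hom_in_carrier)

lemma im_mult: "u \<in> carrier F \<Longrightarrow> v \<in> carrier F \<Longrightarrow> im (u \<otimes>\<^bsub>F\<^esub> v) = im u \<otimes>\<^bsub>G\<^esub> im v"
  using im_hom by (rule hom_mult)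

lemma im_one: "im \<one>\<^bsub>F\<^esub> = \<one>\<^bsub>G\<^esub>"
  using group_hom.hom_one [of F G im] im_hom F.group_axioms G.group_axioms
    by (simp add: group_hom_def group_hom_axioms_def)

lemma im_inv: "w \<in> carrier F \<Longrightarrow> im (word_inv w) = inv\<^bsub>G\<^esub> (im w)"
  using group_hom.hom_inv [of F G im w] im_hom F.group_axioms G.group_axioms
  by (simp add: group_hom_def group_hom_axioms_def inv_free_group)

lemma im_surj: "g \<in> carrier G \<Longrightarrow> \<exists>w\<in>carrier F. g = im w"
  by (auto simp: presented_group_def FactGroup_def RCOSETS_def im_def)

lemma im_ncl: "w \<in> ncl \<Longrightarrow> im w = \<one>\<^bsub>G\<^esub>"
  using F.coset_join2 [OF ncl.mem_carrier ncl.subgroup_axioms]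
    by (simp add: im_def presented_group_def FactGroup_def)

lemma im_eq: "u \<in> carrier F \<Longrightarrow> v \<in> carrier F \<Longrightarrow> im u = im v \<Longrightarrow> u \<otimes>\<^bsub>F\<^esub> word_inv v \<in> ncl"
proof -
  assume u: "u \<in> carrier F" and v: "v \<in> carrier F" and eq: "im u = im v"
  have "u \<in> ncl #>\<^bsub>F\<^esub> v" using F.rcos_self [OF u ncl.subgroup_axioms] eq by (simp add: im_def)
  then obtain h where h: "h \<in> ncl" "u = h \<otimes>\<^bsub>F\<^esub> v" by (auto simp: r_coset_def)
  have "h \<in> carrier F" using h(1) by (rule ncl.mem_carrier)
  then have "u \<otimes>\<^bsub>F\<^esub> inv\<^bsub>F\<^esub> v = h" using h(2) v by (simp add: F.m_assoc)
  then show ?thesis using h(1) v by (simp add: inv_free_group)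
qed

lemma F_mult: "u \<otimes>\<^bsub>F\<^esub> v = reduce (u @ v)" and F_one: "\<one>\<^bsub>F\<^esub> = []"
  by (simp_all add: free_group_def)

lemma F_reduced: "w \<in> carrier F \<Longrightarrow> reduced w"
  by (simp add: free_group_def)

lemma R_ncl: "R \<subseteq> ncl"
  by (auto simp: normal_closure_def)

text \<open>The preimage of \<open>N\<close> is a normal subgroup containing \<open>R\<close>. This
  passes from the normal closure in the free group on \<open>S\<close> to the one in the free group
  on all letters.\<close>

lemma of_word_ncl: "w \<in> ncl \<Longrightarrow> of_word w \<in> N"
proof -
  let ?M = "{w \<in> carrier F. of_word w \<in> N}"
  have "subgroup ?M F"
  proof (rule F.subgroupI)
    show "?M \<noteq> {}" using N_zero F.one_closed by (auto simp: F_one intro!: exI [of _ "[]"])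
    show "inv\<^bsub>F\<^esub> a \<in> ?M" if "a \<in> ?M" for a
      using that F.inv_closed [of a] N_uminus by (auto simp: inv_free_group of_word_word_inv)
    show "a \<otimes>\<^bsub>F\<^esub> b \<in> ?M" if "a \<in> ?M" "b \<in> ?M" for a b
      using that F.m_closed [of a b] N_add by (auto simp: F_mult of_word_append)
  qed auto
  moreover have "x \<otimes>\<^bsub>F\<^esub> h \<otimes>\<^bsub>F\<^esub> inv\<^bsub>F\<^esub> x \<in> ?M" if "x \<in> carrier F" "h \<in> ?M" for x h
  proof -
    have "of_word (x \<otimes>\<^bsub>F\<^esub> h \<otimes>\<^bsub>F\<^esub> inv\<^bsub>F\<^esub> x) = conj_by (of_word x) (of_word h)"
      by (simp only: F_mult inv_free_group [OF that(1)] of_word_reduce of_word_append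
        of_word_word_inv conj_by_def group_norm)
    then show ?thesis using that N_conj by auto
  qed
  ultimately have "?M \<lhd> F" by (simp add: F.normal_inv_iff)
  moreover have "R \<subseteq> ?M"
  proof
    fix r assume r: "r \<in> R"
    then have rs: "r \<in> symR" using symmetrized_self symmetrized_Union by blast
    then have "lab 0 (of_word r) \<in> RR" using sym_word(2) by (simp add: lab_def RR_def)
    then have "of_word r \<in> N"
      using Rot_N [of 0 "of_word r"] gen_incl [of "of_word r" "{of_word r}"] by (simp add: Ax_lab)
    then show "r \<in> ?M" using r R_carrier by auto
  qed
  ultimately have "ncl \<subseteq> ?M" unfolding normal_closure_def by blast
  then show "w \<in> ncl \<Longrightarrow> of_word w \<in> N" by blast
qed

text \<open>Rotating a word by one letter is conjugation by that letter.\<close>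

lemma sym_ncl: "w \<in> symR \<Longrightarrow> w \<in> ncl"
proof -
  have rot: "rotate k r \<in> ncl" if r: "r \<in> symR" "r \<in> ncl" for k r
  proof (induction k)
    case 0
    show ?case using r by simp
  next
    case (Suc k)
    let ?w = "rotate k r"
    have w: "?w \<in> symR" "rotate1 ?w \<in> symR"
      using symmetrized_rotate [OF r(1), of k] symmetrized_rotate [OF r(1), of "Suc k"] by auto
    obtain x t where xt: "?w = x # t" using sym_word(4) [OF w(1)] by (cases ?w) auto
    have x: "[x] \<in> carrier F" using sym_word(3) [OF w(1)] xt by (simp add: free_group_def)
    have "inv\<^bsub>F\<^esub> [x] \<otimes>\<^bsub>F\<^esub> ?w \<otimes>\<^bsub>F\<^esub> [x] \<in> ncl" by (rule ncl.inv_op_closed1 [OF x Suc])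
    moreover have "inv\<^bsub>F\<^esub> [x] \<otimes>\<^bsub>F\<^esub> ?w \<otimes>\<^bsub>F\<^esub> [x] = word_of (of_word (word_inv [x] @ ([x] @ t) @ [x]))"
      by (simp add: inv_free_group [OF x] F_mult xt word_of_of_word)
    moreover have "of_word (word_inv [x] @ ([x] @ t) @ [x]) = of_word (rotate1 ?w)"
      by (simp only: xt rotate1.simps of_word_append of_word_word_inv group_norm)
    ultimately show ?case using sym_word(2) [OF w(2)] by simp
  qed
  assume "w \<in> symR"
  then obtain r k where r: "r \<in> R" and w: "w = rotate k r \<or> w = rotate k (word_inv r)"
    by (auto simp: mem_symmetrized)
  have rs: "r \<in> symR" using r symmetrized_self symmetrized_Union by blast
  have rn: "r \<in> ncl" using r R_ncl by blast
  have "word_inv r \<in> ncl" using ncl.m_inv_closed [OF rn] r R_carrier by (auto simp: inv_free_group)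
  then show ?thesis using w rot [OF rs rn] rot [OF symmetrized_word_inv [OF rs]] by blast
qed

lemma gen_ncl:
  assumes "w \<in> symR" "\<rho> \<in> gen {of_word w}"
  shows "word_of \<rho> \<in> ncl"
  using assms(2)
proof induction
  case gen_zero
  then show ?case using ncl.one_closed by (simp add: F_one)
next
  case (gen_plus a x)
  then have "word_of (a + x) = w \<otimes>\<^bsub>F\<^esub> word_of x"
    using sym_word(2) [OF assms(1)] by (simp add: word_of_plus F_mult)
  then show ?case using ncl.m_closed [OF sym_ncl [OF assms(1)] gen_plus.IH] by simp
next
  case (gen_minus a x)
  then have "word_of (- a + x) = inv\<^bsub>F\<^esub> w \<otimes>\<^bsub>F\<^esub> word_of x"
    using sym_word(2) [OF assms(1)] sym_carrier [OF assms(1)]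
      by (simp add: word_of_plus word_of_uminus F_mult inv_free_group)
  then show ?case using ncl.m_closed [OF ncl.m_inv_closed [OF sym_ncl [OF assms(1)]] gen_minus.IH] by simp
qed

text \<open>The conditions that \<open>thin_cones\<close> puts on a representative, apart from
  hyperbolicity and class membership.\<close>

definition admissible :: "'a word set \<Rightarrow> bool" where
  "admissible X \<longleftrightarrow> basis_words S \<union> four_piece_words S R \<subseteq> X \<and> X \<subseteq> initial_words S R"

lemma initial_words_prefix: "u \<in> initial_words S R \<Longrightarrow> \<exists>r\<in>symR. prefix u r"
proof -
  assume "u \<in> initial_words S R"
  then consider s where "s \<in> S" "u = [(s, True)]" | "\<exists>r\<in>symR. prefix u r"
    by (auto simp: initial_words_def basis_words_def)
  then show ?thesis
  proof cases
    case 1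
    then obtain r where "r \<in> symR" "hd r = (s, True)" using sym_letter [of "(s, True)"] by auto
    then show ?thesis using 1 sym_word(4) by (intro bexI [of _ r]) (cases r; auto)+
  qed
qed

lemma prefix_carrier: "r \<in> symR \<Longrightarrow> prefix u r \<Longrightarrow> u \<in> carrier F"
  using sym_word(2,3) [of r] by (elim prefixE) (simp add: free_group_def reduced_append image_Un)

lemma admissible_carrier: "admissible X \<Longrightarrow> X \<subseteq> carrier F"
  using initial_words_prefix prefix_carrier unfolding admissible_def by blast

lemma piece_four: "r \<in> symR \<Longrightarrow> prefix u r \<Longrightarrow> is_piece R u \<Longrightarrow> u \<in> four_piece_words S R"
proof -
  assume r: "r \<in> symR" "prefix u r" and p: "is_piece R u"
  have "u = foldr (mult F) [u] (one F)"
    using F_reduced [OF prefix_carrier [OF r]] by (simp add: F_mult F_one reduce_reduced)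
  moreover have "u \<in> initial_words S R" using r by (auto simp: initial_words_def)
  ultimately show ?thesis unfolding four_piece_words_def using p
    by (intro CollectI conjI exI [of _ "[u]"]) auto
qed

lemma admissible_cones: "admissible X \<Longrightarrow> relator_cones RR X"
proof
  fix r r' u
  assume X: "admissible X" and a: "r \<in> RR" "r' \<in> RR" "r \<noteq> r'" "prefix u r" "prefix u r'" "u \<noteq> []"
  from RR_common_prefix [OF a] have s: "r \<in> symR" "r' \<in> symR" by auto
  then show "u \<in> X" using piece_four [OF s(1) a(4)] sym_piece [OF s a(3-5)] X by (auto simp: admissible_def)
qed

lemma concat_words:
  assumes "set ws \<subseteq> carrier F"
  shows "reduce (concat ws) \<in> carrier F" "foldr (\<otimes>\<^bsub>G\<^esub>) (map im ws) \<one>\<^bsub>G\<^esub> = im (reduce (concat ws))"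
proof -
  have "reduce (concat ws) \<in> carrier F \<and> foldr (\<otimes>\<^bsub>G\<^esub>) (map im ws) \<one>\<^bsub>G\<^esub> = im (reduce (concat ws))"
    using assms
  proof (induction ws)
    case Nil
    then show ?case using im_one F.one_closed by (simp add: F_one reduce_reduced)
  next
    case (Cons w ws)
    then have IH: "reduce (concat ws) \<in> carrier F" "foldr (\<otimes>\<^bsub>G\<^esub>) (map im ws) \<one>\<^bsub>G\<^esub> = im (reduce (concat ws))"
      and w: "w \<in> carrier F" by auto
    have "reduce (concat (w # ws)) = w \<otimes>\<^bsub>F\<^esub> reduce (concat ws)" by (simp add: F_mult)
    then show ?case using F.m_closed [OF w IH(1)] im_mult [OF w IH(1)] IH(2) by simp
  qed
  then show "reduce (concat ws) \<in> carrier F"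
    "foldr (\<otimes>\<^bsub>G\<^esub>) (map im ws) \<one>\<^bsub>G\<^esub> = im (reduce (concat ws))" by auto
qed

lemma letters_im: "X \<subseteq> carrier F \<Longrightarrow> G.letters (im ` X) = im ` (X \<union> word_inv ` X)"
proof -
  assume X: "X \<subseteq> carrier F"
  have "m_inv G ` im ` X = im ` word_inv ` X"
    unfolding image_image using im_inv X by (intro image_cong) auto
  then show ?thesis by (simp add: G.letters_def image_Un)
qed

lemma words_carrier: "X \<subseteq> carrier F \<Longrightarrow> X \<union> word_inv ` X \<subseteq> carrier F"
  using word_inv_closed by blast

lemma generating_im:
  assumes "admissible X"
  shows "generating_set G (im ` X)"
  unfolding generating_set_def
proof
  have X: "X \<subseteq> carrier F" using admissible_carrier [OF assms] .
  show sub: "im ` X \<subseteq> carrier G" using X im_closed by blast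
  have letter: "im [(s, b)] \<in> generate G (im ` X)" if "s \<in> S" for s b
  proof -
    have s: "[(s, True)] \<in> X" using that assms by (auto simp: admissible_def basis_words_def)
    then have "im (word_inv [(s, True)]) \<in> generate G (im ` X)"
      using im_inv X generate.inv [of "im [(s, True)]" "im ` X" G] by auto
    then show ?thesis using s generate.incl [of "im [(s, True)]" "im ` X" G]
      by (cases b) (auto simp: word_inv_def)
  qed
  have "im w \<in> generate G (im ` X)" if "w \<in> carrier F" for w
    using that
  proof (induction w)
    case Nil
    then show ?case using im_one generate.one [of G "im ` X"] by (simp add: F_one)
  next
    case (Cons a w)
    then have a: "[a] \<in> carrier F" "w \<in> carrier F" "fst a \<in> S" by (auto simp: free_group_def reduced_Cons)
    have "a # w = [a] \<otimes>\<^bsub>F\<^esub> w" using F_reduced [OF Cons.prems] by (simp add: F_mult reduce_reduced)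
    then have "im (a # w) = im [a] \<otimes>\<^bsub>G\<^esub> im w" using im_mult a by simp
    then show ?case using generate.eng [OF letter [OF a(3), of "snd a"] Cons.IH [OF a(2)]] by simp
  qed
  then show "generate G (im ` X) = carrier G"
    using G.generate_incl [OF sub] im_surj by blast
qed

lemma words_of_length:
  assumes "admissible X" "y \<in> carrier F" "word_length G (im ` X) (im y) \<le> n"
  obtains ws where "length ws \<le> n" "set ws \<subseteq> X \<union> word_inv ` X" "im y = im (reduce (concat ws))"
proof -
  have X: "X \<subseteq> carrier F" using admissible_carrier [OF assms(1)] .
  obtain xs where xs: "length xs = word_length G (im ` X) (im y)" "set xs \<subseteq> G.letters (im ` X)"
    "im y = foldr (\<otimes>\<^bsub>G\<^esub>) xs \<one>\<^bsub>G\<^esub>"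
    using G.word_length_expr [OF generating_im [OF assms(1)] im_closed [OF assms(2)]] .
  have "xs \<in> lists (im ` (X \<union> word_inv ` X))"
    using xs(2) unfolding letters_im [OF X] by (simp add: in_lists_conv_set subset_iff)
  then obtain ws where "ws \<in> lists (X \<union> word_inv ` X)" and wsx: "xs = map im ws"
    unfolding lists_image by blast
  then have ws: "set ws \<subseteq> X \<union> word_inv ` X" "xs = map im ws" by auto
  have "set ws \<subseteq> carrier F" using ws(1) words_carrier [OF X] by blast
  from concat_words(2) [OF this] have eq: "im y = im (reduce (concat ws))" using xs(3) ws(2) by simp
  have "length ws \<le> n" using ws(2) xs(1) assms(3) by simp
  from that [OF this ws(1) eq] show thesis .
qed

section \<open>Word length in the group against distance in the cone\<close>

lemma lab_zero: "w \<in> symR \<Longrightarrow> lab 0 (of_word w) = w"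
  by (simp add: lab_def sym_word(2))

lemma zero_Ax: "w \<in> symR \<Longrightarrow> 0 \<in> Ax (of_word w)"
  using sym_RR by (simp add: Ax_lab lab_zero)

lemma prefix_Ax: "w \<in> symR \<Longrightarrow> prefix y w \<Longrightarrow> of_word y \<in> Ax (of_word w)"
  using Ax_periodic [OF zero_Ax, of w y] lab_zero [of w] prefix_periodic [of y w] by simp

text \<open>The deep half of the comparison: an expression of \<open>y\<close> in the group by
  \<open>n\<close> letters is a polygon modulo \<open>N\<close>, to which \<open>polygon\<close>
  applies.\<close>

lemma reach_if_short:
  assumes "admissible X" "w \<in> symR" "prefix y w" "word_length G (im ` X) (im y) \<le> n"
  shows "reach X (of_word w) (polygon_bound n n) 0 (of_word y)"
proof -
  interpret relator_cones RR X using assms(1) by (rule admissible_cones)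
  have y: "y \<in> carrier F" using prefix_carrier [OF assms(2,3)] .
  have X: "X \<subseteq> carrier F" using admissible_carrier [OF assms(1)] .
  obtain ws where ws: "length ws \<le> n" "set ws \<subseteq> X \<union> word_inv ` X" "im y = im (reduce (concat ws))"
    using words_of_length [OF assms(1) y assms(4)] .
  have c: "reduce (concat ws) \<in> carrier F" using concat_words(1) ws(2) words_carrier [OF X] by blast
  have "of_word (reduce (concat ws) \<otimes>\<^bsub>F\<^esub> word_inv y) \<in> N"
    using of_word_ncl [OF im_eq [OF c y ws(3) [symmetric]]] .
  then have N: "of_word (concat ws) - of_word y \<in> N" by (simp add: F_mult of_word_append of_word_word_inv)
  have "\<exists>r\<in>RR. prefix u r" if "u \<in> X" for u
    using that assms(1) initial_words_prefix unfolding admissible_def RR_def by blast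
  from reach_of_words [OF this ws(2) N zero_Ax [OF assms(2)] prefix_Ax [OF assms(2,3)] ws(1)] show ?thesis .
qed

text \<open>The labels along a lifted path multiply to \<open>y\<close> up to a rotation about the
  axis, which is a power of a relator and vanishes in the group.\<close>

lemma short_if_reach:
  assumes "admissible X" "w \<in> symR" "y \<in> carrier F" "reach X (of_word w) n 0 (of_word y)"
  shows "word_length G (im ` X) (im y) \<le> n"
proof -
  have X: "X \<subseteq> carrier F" using admissible_carrier [OF assms(1)] .
  obtain \<rho> ws where \<rho>: "\<rho> \<in> gen {of_word w}" and ws: "length ws \<le> n" "set ws \<subseteq> X \<union> word_inv ` X"
    and eq: "\<rho> + of_word y = 0 + of_word (concat ws)"
    using reach_word [OF assms(4)] by blast
  have wF: "set ws \<subseteq> carrier F" using ws(2) words_carrier [OF X] by blast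
  have \<rho>n: "word_of \<rho> \<in> ncl" using gen_ncl [OF assms(2) \<rho>] .
  then have \<rho>F: "word_of \<rho> \<in> carrier F" by (rule ncl.mem_carrier)
  have "word_of (of_word (concat ws)) = word_of (\<rho> + of_word y)" using eq by simp
  then have "reduce (concat ws) = word_of \<rho> \<otimes>\<^bsub>F\<^esub> y"
    using F_reduced [OF assms(3)] by (simp add: word_of_of_word word_of_plus F_mult)
  then have "im (reduce (concat ws)) = im (word_of \<rho>) \<otimes>\<^bsub>G\<^esub> im y" using im_mult \<rho>F assms(3) by simp
  then have "im y = foldr (\<otimes>\<^bsub>G\<^esub>) (map im ws) \<one>\<^bsub>G\<^esub>"
    using concat_words(2) [OF wF] im_ncl [OF \<rho>n] im_closed [OF assms(3)] by simp
  moreover have "set (map im ws) \<subseteq> G.letters (im ` X)" unfolding letters_im [OF X] using ws(2) by auto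
  ultimately show ?thesis using G.word_length_le [of "map im ws" "im ` X"] ws(1) by simp
qed

lemma lab_symmetrized:
  assumes "w \<in> symR" "x \<in> Ax (of_word w)" "e = of_word w \<or> e = - of_word w"
  shows "lab x e \<in> symmetrized {w}"
proof -
  obtain e0 where e0: "e0 = of_word w \<or> e0 = - of_word w" "periodic (lab 0 e0) (word_of (- 0 + x))"
    using Ax_sign_cases [OF zero_Ax [OF assms(1)] assms(2)] by blast
  have "0 \<in> Ax e0" using zero_Ax [OF assms(1)] e0(1) by auto
  from lab_periodic [OF this e0(2)] have l: "lab x e0 = rotate (length (word_of x)) (lab 0 e0)" by simp
  have "lab 0 e0 \<in> symmetrized {w}"
    using e0(1) lab_zero [OF assms(1)] symmetrized_self symmetrized_word_inv [OF symmetrized_self]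
      by (auto simp: lab_uminus)
  then have 1: "lab x e0 \<in> symmetrized {w}" unfolding l by (rule symmetrized_rotate)
  have "e = e0 \<or> e = - e0" using assms(3) e0(1) by auto
  then show ?thesis using 1 symmetrized_word_inv by (auto simp: lab_uminus)
qed

text \<open>Within one relator, the word length with respect to \<^term>\<open>X\<close> only depends, up to a uniform
  change, on the elements of \<^term>\<open>X\<close> that are subwords of that relator.\<close>

lemma short_transfer:
  assumes "admissible X" "admissible Y" "w \<in> symR" "prefix y w" "word_length G (im ` X) (im y) \<le> n"
    and "X \<inter> subwords (symmetrized {w}) = Y \<inter> subwords (symmetrized {w})"
  shows "word_length G (im ` Y) (im y) \<le> polygon_bound n n"
proof -
  have "reach X (of_word w) = reach Y (of_word w)"
  proof (rule reach_cong)
    fix u x e assume "x \<in> Ax (of_word w)" "e = of_word w \<or> e = - of_word w" "prefix u (lab x e)"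
    then have "u \<in> subwords (symmetrized {w})" using lab_symmetrized [OF assms(3)] prefix_subwords by blast
    then show "u \<in> X \<longleftrightarrow> u \<in> Y" using assms(6) by blast
  qed
  then show ?thesis
    using reach_if_short [OF assms(1,3-5)] short_if_reach [OF assms(2,3) prefix_carrier [OF
      assms(3,4)]] by simp
qed

end

section \<open>The embedding\<close>

lemma hyperbolic_graph_mono: "hyperbolic_graph \<delta> V E \<Longrightarrow> \<delta> \<le> \<delta>' \<Longrightarrow> hyperbolic_graph \<delta>' V E"
  unfolding hyperbolic_graph_def hyperbolic_def by (smt (verit))

lemma cone_adj_cong: "subwords_at X r = subwords_at Y r \<Longrightarrow> cone_adj X r = cone_adj Y r"
  by (simp add: cone_adj_def)

context small_cancellation_presentation
begin

text \<open>Relators are identified up to rotation and inversion: such relators have the same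
  subwords, and common subwords of different classes are pieces.\<close>

definition cones :: "'a word set set" where
  "cones = (\<lambda>r. symmetrized {r}) ` R"

lemma cones_mem:
  assumes "K \<in> cones" "w \<in> K"
  shows "w \<in> symR" "symmetrized {w} = K"
proof -
  obtain r where r: "r \<in> R" "K = symmetrized {r}" using assms(1) by (auto simp: cones_def)
  then show "w \<in> symR" using assms(2) symmetrized_Union by blast
  show "symmetrized {w} = K" using r assms(2) symmetrized_eq by blast
qed

lemma cones_subwords:
  assumes "K \<in> cones" "u \<in> subwords K"
  obtains w where "w \<in> K" "prefix u w"
  using assms subwords_prefix unfolding cones_def by blast

lemma admissible_in_cone:
  assumes "admissible X" "x \<in> X"
  obtains K where "K \<in> cones" "x \<in> subwords K"
proof -
  obtain w where w: "w \<in> symR" "prefix x w"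
    using assms initial_words_prefix unfolding admissible_def by blast
  then obtain r where r: "r \<in> R" "w \<in> symmetrized {r}" using symmetrized_Union by blast
  then show thesis using that [of "symmetrized {r}"] prefix_subwords [OF r(2) w(2)]
    by (auto simp: cones_def)
qed

lemma short_transfer_cone:
  assumes "admissible X" "admissible Y" "K \<in> cones" "u \<in> subwords K" "X \<inter> subwords K = Y \<inter> subwords K"
    and "word_length G (im ` X) (im u) \<le> n"
  shows "word_length G (im ` Y) (im u) \<le> polygon_bound n n"
proof -
  obtain w where w: "w \<in> K" "prefix u w" using cones_subwords [OF assms(3,4)] .
  show ?thesis
    by (rule short_transfer [OF assms(1,2) cones_mem(1) [OF assms(3) w(1)] w(2) assms(6)])
      (simp add: cones_mem(2) [OF assms(3) w(1)] assms(5))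
qed

lemma word_length_mem: "admissible X \<Longrightarrow> x \<in> X \<Longrightarrow> word_length G (im ` X) (im x) \<le> 1"
proof -
  assume X: "admissible X" "x \<in> X"
  have "im x \<in> carrier G" using X admissible_carrier im_closed by blast
  moreover have "im x \<in> G.letters (im ` X)" using X by (simp add: G.letters_def)
  ultimately show ?thesis using G.word_length_le [of "[im x]" "im ` X"] by simp
qed

definition mix :: "('a word set \<Rightarrow> nat) \<Rightarrow> 'a word set \<Rightarrow> 'a word set \<Rightarrow> nat set \<Rightarrow> 'a word set" where
  "mix lev X1 X2 A = basis_words S \<union> four_piece_words S R \<union>
     {x \<in> X2. \<exists>K\<in>cones. lev K \<in> A \<and> x \<in> subwords K} \<union> {x \<in> X1. \<exists>K\<in>cones. lev K \<notin> A \<and> x \<in> subwords K}"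

lemma mix_admissible: "admissible X1 \<Longrightarrow> admissible X2 \<Longrightarrow> admissible (mix lev X1 X2 A)"
  unfolding admissible_def mix_def by auto

lemma admissible_all_cones: "admissible X \<Longrightarrow> {x \<in> X. \<exists>K\<in>cones. x \<in> subwords K} = X"
  using admissible_in_cone by blast

lemma mix_empty: "admissible X1 \<Longrightarrow> mix lev X1 X2 {} = X1"
  using admissible_all_cones [of X1] by (auto simp: mix_def admissible_def)

lemma mix_UNIV: "admissible X2 \<Longrightarrow> mix lev X1 X2 UNIV = X2"
  using admissible_all_cones [of X2] by (auto simp: mix_def admissible_def)

text \<open>A word that is a subword of two different relators is a piece, so that the choices made for
  different relators do not interfere.\<close>

lemma shared_subword:
  assumes "K \<in> cones" "K' \<in> cones" "K \<noteq> K'" "u \<in> subwords K" "u \<in> subwords K'"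
  shows "u \<in> four_piece_words S R"
proof -
  obtain w where w: "w \<in> K" "prefix u w" using cones_subwords [OF assms(1,4)] .
  obtain w' where w': "w' \<in> K'" "prefix u w'" using cones_subwords [OF assms(2,5)] .
  have "w \<noteq> w'" using cones_mem(2) [OF assms(1) w(1)] cones_mem(2) [OF assms(2) w'(1)] assms(3) by auto
  moreover have "w \<in> symR" "w' \<in> symR" using cones_mem(1) assms w w' by blast+
  ultimately show ?thesis using sym_piece piece_four w w' by blast
qed

text \<open>A word selected for another relator but occurring in this one as well is a piece by
  \<open>shared_subword\<close>, hence in both \<open>X1\<close> and \<open>X2\<close>
  anyway.\<close>

lemma mix_on_cone:
  assumes "admissible X1" "admissible X2" "K \<in> cones"
  shows "mix lev X1 X2 A \<inter> subwords K = (if lev K \<in> A then X2 else X1) \<inter> subwords K"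
proof
  show "(if lev K \<in> A then X2 else X1) \<inter> subwords K \<subseteq> mix lev X1 X2 A \<inter> subwords K"
    using assms(3) unfolding mix_def by auto
  show "mix lev X1 X2 A \<inter> subwords K \<subseteq> (if lev K \<in> A then X2 else X1) \<inter> subwords K"
  proof
    fix u assume u: "u \<in> mix lev X1 X2 A \<inter> subwords K"
    have sub: "basis_words S \<union> four_piece_words S R \<subseteq> (if lev K \<in> A then X2 else X1)"
      using assms by (simp add: admissible_def)
    show "u \<in> (if lev K \<in> A then X2 else X1) \<inter> subwords K"
    proof (cases "u \<in> basis_words S \<union> four_piece_words S R")
      case True
      then show ?thesis using sub u by blast
    next
      case False
      then obtain K' where K': "K' \<in> cones" "u \<in> subwords K'" "u \<in> (if lev K' \<in> A then X2 else X1)"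
        using u unfolding mix_def by auto
      have "K' = K" using shared_subword [OF assms(3) K'(1) _ _ K'(2)] u False by blast
      then show ?thesis using K' by simp
    qed
  qed
qed

text \<open>Each cone of the mixed set is literally that of \<open>X1\<close> or that of
  \<open>X2\<close>, so the larger of the two constants works for all.\<close>

lemma mix_thin_cones:
  assumes "admissible X1" "admissible X2" "0 \<le> \<delta>1" "0 \<le> \<delta>2"
    and "\<forall>r\<in>R. hyperbolic_graph \<delta>1 (cone_vertices r) (cone_adj X1 r)"
    and "\<forall>r\<in>R. hyperbolic_graph \<delta>2 (cone_vertices r) (cone_adj X2 r)"
  shows "gens_equiv G `` {im ` mix lev X1 X2 A} \<in> thin_cones S R"
proof -
  let ?X = "mix lev X1 X2 A"
  have adm: "admissible ?X" using mix_admissible assms by blast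
  have gen: "generating_set G (im ` ?X)" using generating_im [OF adm] .
  have "hyperbolic_graph (max \<delta>1 \<delta>2) (cone_vertices r) (cone_adj ?X r)" if r: "r \<in> R" for r
  proof -
    have "symmetrized {r} \<in> cones" using r by (simp add: cones_def)
    from mix_on_cone [OF assms(1,2) this, of lev A]
    have "cone_adj ?X r = cone_adj X1 r \<or> cone_adj ?X r = cone_adj X2 r"
      using cone_adj_cong [of ?X r X1] cone_adj_cong [of ?X r X2]
        by (auto simp: subwords_at_eq split: if_splits)
    moreover have "hyperbolic_graph (max \<delta>1 \<delta>2) (cone_vertices r) (cone_adj X1 r)"
      by (rule hyperbolic_graph_mono [OF bspec [OF assms(5) r]]) simp
    moreover have "hyperbolic_graph (max \<delta>1 \<delta>2) (cone_vertices r) (cone_adj X2 r)"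
      by (rule hyperbolic_graph_mono [OF bspec [OF assms(6) r]]) simp
    ultimately show ?thesis by auto
  qed
  moreover have "0 \<le> max \<delta>1 \<delta>2" using assms(3) by simp
  moreover have "im ` ?X \<in> gens_equiv G `` {im ` ?X}"
    using gen G.gens_le_refl [OF G.generating_subset [OF gen]] by (simp add: gens_equiv_iff)
  moreover have "gens_equiv G `` {im ` ?X} \<in> gens_classes G"
    unfolding gens_classes_def using gen by (intro quotientI) simp
  ultimately show ?thesis
    unfolding thin_cones_def image_in_group_eq using adm unfolding admissible_def by blast
qed

text \<open>The value \<open>0\<close> is inserted to have a maximum of a nonempty set; finiteness
  comes from the finitely many subwords of a relator.\<close>

definition excess :: "'a word set \<Rightarrow> 'a word set \<Rightarrow> 'a word set \<Rightarrow> nat" where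
  "excess X1 X2 K = Max (insert 0 ((\<lambda>x. word_length G (im ` X2) (im x)) ` (X1 \<inter> subwords K)))"

lemma finite_subwords_cone: "K \<in> cones \<Longrightarrow> finite (subwords K)"
  by (auto simp: cones_def finite_subwords_symmetrized)

lemma excess_ge: "K \<in> cones \<Longrightarrow> x \<in> X1 \<Longrightarrow> x \<in> subwords K \<Longrightarrow> word_length G (im ` X2) (im x) \<le> excess X1 X2 K"
  unfolding excess_def using finite_subwords_cone by (intro Max_ge) auto

lemma excess_attained:
  assumes "K \<in> cones" "0 < excess X1 X2 K"
  obtains x where "x \<in> X1" "x \<in> subwords K" "word_length G (im ` X2) (im x) = excess X1 X2 K"
proof -
  let ?M = "insert 0 ((\<lambda>x. word_length G (im ` X2) (im x)) ` (X1 \<inter> subwords K))"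
  have "Max ?M \<in> ?M" using finite_subwords_cone [OF assms(1)] by (intro Max_in) auto
  then show thesis using that assms(2) unfolding excess_def by auto
qed

lemma infinite_excess:
  assumes "admissible X1" "\<not> gens_le G (im ` X2) (im ` X1)"
  shows "infinite (excess X1 X2 ` cones)"
proof
  assume fin: "finite (excess X1 X2 ` cones)"
  have "word_length G (im ` X2) (im x) \<le> Max (insert 0 (excess X1 X2 ` cones))" if x: "x \<in> X1" for x
  proof -
    obtain K where K: "K \<in> cones" "x \<in> subwords K" using admissible_in_cone [OF assms(1) x] .
    have "word_length G (im ` X2) (im x) \<le> excess X1 X2 K" using excess_ge K x by blast
    also have "\<dots> \<le> Max (insert 0 (excess X1 X2 ` cones))" using fin K(1) by (intro Max_ge) auto
    finally show ?thesis .
  qed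
  then show False using assms(2) unfolding G.gens_le_iff by blast
qed

text \<open>At levels in \<open>A - B\<close> the first set uses \<open>X2\<close> and the second
  \<open>X1\<close>, so the comparison is governed by the excess, which is at least the level and
  constant on it. At all other levels the two sets agree on the cone or the bound of
  \<open>X2\<close> in terms of \<open>X1\<close> applies. \<open>short_transfer_cone\<close> passes
  between the mixed sets and \<open>X1\<close>, \<open>X2\<close>.\<close>

lemma mix_le_iff:
  assumes X: "admissible X1" "admissible X2" and le: "gens_le G (im ` X1) (im ` X2)"
    and lev: "\<And>K L. K \<in> cones \<Longrightarrow> L \<in> cones \<Longrightarrow> lev K = lev L \<Longrightarrow> excess X1 X2 K = excess X1 X2 L"
      "\<And>n. \<exists>K\<in>cones. lev K = n" "\<And>K. K \<in> cones \<Longrightarrow> lev K \<le> excess X1 X2 K"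
  shows "gens_le G (im ` mix lev X1 X2 A) (im ` mix lev X1 X2 B) \<longleftrightarrow> finite (A - B)"
proof
  let ?XA = "mix lev X1 X2 A" and ?XB = "mix lev X1 X2 B"
  have adm: "admissible ?XA" using mix_admissible X by blast
  show "finite (A - B)" if "gens_le G (im ` ?XA) (im ` ?XB)"
  proof (rule ccontr)
    assume inf: "infinite (A - B)"
    obtain b where b: "\<And>y. y \<in> ?XB \<Longrightarrow> word_length G (im ` ?XA) (im y) \<le> b"
      using \<open>gens_le G (im ` ?XA) (im ` ?XB)\<close> unfolding G.gens_le_iff by blast
    \<comment> \<open>At level \<open>n\<close> some element of \<open>X1\<close> has
      \<open>X2\<close>-length at least \<open>n\<close>, more than the transferred bound
      permits.\<close>
    obtain n where n: "n \<in> A - B" "polygon_bound b b < n"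
      using inf unfolding infinite_nat_iff_unbounded by blast
    obtain K where K: "K \<in> cones" "lev K = n" using lev(2) by blast
    have nK: "n \<le> excess X1 X2 K" using lev(3) [OF K(1)] K(2) by simp
    then have "0 < excess X1 X2 K" using n(2) by linarith
    then obtain x where x: "x \<in> X1" "x \<in> subwords K" "word_length G (im ` X2) (im x) = excess X1 X2 K"
      using excess_attained [OF K(1)] by blast
    have "x \<in> ?XB" using mix_on_cone [OF X K(1), of lev B] x K(2) n(1) by auto
    moreover have "?XA \<inter> subwords K = X2 \<inter> subwords K"
      using mix_on_cone [OF X K(1), of lev A] K(2) n(1) by auto
    ultimately have "word_length G (im ` X2) (im x) \<le> polygon_bound b b"
      using short_transfer_cone [OF adm X(2) K(1) x(2)] b by blast
    then show False using x(3) nK n(2) by linarith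
  qed
  show "gens_le G (im ` ?XA) (im ` ?XB)" if fin: "finite (A - B)"
  proof -
    obtain b where b: "\<And>y. y \<in> X2 \<Longrightarrow> word_length G (im ` X1) (im y) \<le> b"
      using le unfolding G.gens_le_iff by blast
    have "finite (excess X1 X2 ` {K \<in> cones. lev K \<in> A - B})"
    proof -
      \<comment> \<open>A level may contain infinitely many relators, but the excess is constant on
        it, so finitely many levels give finitely many values.\<close>
      define f where "f n = excess X1 X2 (SOME K. K \<in> cones \<and> lev K = n)" for n
      have "excess X1 X2 K = f (lev K)" if K: "K \<in> cones" for K
      proof -
        have "(SOME L. L \<in> cones \<and> lev L = lev K) \<in> cones \<and> lev (SOME L. L \<in> cones \<and> lev L = lev K) = lev K"
          by (rule someI [of _ K]) (use K in simp)
        then show ?thesis unfolding f_def using lev(1) [OF K] by metis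
      qed
      then have "excess X1 X2 ` {K \<in> cones. lev K \<in> A - B} \<subseteq> f ` (A - B)" by auto
      then show ?thesis using fin finite_surj by blast
    qed
    then obtain m where m: "\<And>K. K \<in> cones \<Longrightarrow> lev K \<in> A - B \<Longrightarrow> excess X1 X2 K \<le> m"
      unfolding finite_nat_set_iff_bounded_le by blast
    have "word_length G (im ` ?XA) (im y) \<le> 1 + polygon_bound b b + polygon_bound m m" if y: "y \<in> ?XB" for y
    proof (cases "y \<in> ?XA")
      case True
      then show ?thesis using word_length_mem [OF adm] by fastforce
    next
      case False
      obtain K where K: "K \<in> cones" "y \<in> subwords K" using admissible_in_cone [OF mix_admissible [OF X] y] .
      have yB: "y \<in> (if lev K \<in> B then X2 else X1)" using mix_on_cone [OF X K(1), of lev B] y K(2) by blast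
      have yA: "y \<notin> (if lev K \<in> A then X2 else X1)"
        using mix_on_cone [OF X K(1), of lev A] False K(2) by blast
      show ?thesis
      proof (cases "lev K \<in> A")
        case True
        then have KB: "lev K \<notin> B" and y1: "y \<in> X1" using yA yB by (auto split: if_splits)
        have "word_length G (im ` X2) (im y) \<le> m"
          using excess_ge [OF K(1) y1 K(2), of X2] m [OF K(1)] True KB by force
        moreover have "X2 \<inter> subwords K = ?XA \<inter> subwords K"
          using mix_on_cone [OF X K(1), of lev A] True by simp
        ultimately have "word_length G (im ` ?XA) (im y) \<le> polygon_bound m m"
          using short_transfer_cone [OF X(2) adm K] by blast
        then show ?thesis by simp
      next
        case nA: False
        then have y2: "y \<in> X2" using yA yB by (auto split: if_splits)
        have "X1 \<inter> subwords K = ?XA \<inter> subwords K" using mix_on_cone [OF X K(1), of lev A] nA by simp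
        then have "word_length G (im ` ?XA) (im y) \<le> polygon_bound b b"
          using short_transfer_cone [OF X(1) adm K _ b [OF y2]] by blast
        then show ?thesis by simp
      qed
    qed
    then show ?thesis unfolding G.gens_le_iff by blast
  qed
qed

theorem thin_cones_interval:
  assumes "c1 \<in> thin_cones S R" "c2 \<in> thin_cones S R" "c1 \<noteq> c2" "gens_class_le G c1 c2"
  shows "\<exists>\<phi>. poset_embedding Pomega_Fin Pomega_Fin_le (thin_cones S R) (gens_class_le G) \<phi> \<and>
             \<phi> (fin_class {}) = c1 \<and> \<phi> (fin_class UNIV) = c2 \<and>
             (\<forall>A. gens_class_le G c1 (\<phi> (fin_class A)) \<and> gens_class_le G (\<phi> (fin_class A)) c2)"
proof -
  have rep: "\<exists>X \<delta>. c = gens_equiv G `` {im ` X} \<and> admissible X \<and> 0 \<le> \<delta> \<and>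
      (\<forall>r\<in>R. hyperbolic_graph \<delta> (cone_vertices r) (cone_adj X r))" if "c \<in> thin_cones S R" for c
    using that G.gens_classes_eq(2) unfolding thin_cones_def image_in_group_eq admissible_def by blast
  obtain X1 \<delta>1 where X1: "c1 = gens_equiv G `` {im ` X1}" "admissible X1" "0 \<le> \<delta>1"
      "\<forall>r\<in>R. hyperbolic_graph \<delta>1 (cone_vertices r) (cone_adj X1 r)"
    using rep [OF assms(1)] by blast
  obtain X2 \<delta>2 where X2: "c2 = gens_equiv G `` {im ` X2}" "admissible X2" "0 \<le> \<delta>2"
      "\<forall>r\<in>R. hyperbolic_graph \<delta>2 (cone_vertices r) (cone_adj X2 r)"
    using rep [OF assms(2)] by blast
  note g1 = generating_im [OF X1(2)] and g2 = generating_im [OF X2(2)]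
  have le: "gens_le G (im ` X1) (im ` X2)"
    using assms(4) G.gens_class_le_iff [OF g1 g2] X1(1) X2(1) by simp
  have "\<not> gens_le G (im ` X2) (im ` X1)"
    using assms(3) G.gens_class_eqI [OF g1 g2 le] X1(1) X2(1) by blast
  from infinite_levels [OF infinite_excess [OF X1(2) this]] obtain lev where lev:
    "\<And>K L. K \<in> cones \<Longrightarrow> L \<in> cones \<Longrightarrow> lev K = lev L \<Longrightarrow> excess X1 X2 K = excess X1 X2 L"
    "\<And>n. \<exists>K\<in>cones. lev K = n" "\<And>K. K \<in> cones \<Longrightarrow> lev K \<le> excess X1 X2 K"
    by blast
  define X where "X A = mix lev X1 X2 A" for A
  have X_le: "gens_le G (im ` X A) (im ` X B) \<longleftrightarrow> finite (A - B)" for A B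
    unfolding X_def by (rule mix_le_iff [OF X1(2) X2(2) le lev])
  have gX: "generating_set G (im ` X A)" for A
    unfolding X_def by (rule generating_im [OF mix_admissible [OF X1(2) X2(2)]])
  \<comment> \<open>The choice of the representative is harmless: sets with finite difference give
    equivalent generating sets by \<open>X_le\<close>.\<close>
  define \<phi> where "\<phi> a = gens_equiv G `` {im ` X (SOME A. A \<in> a)}" for a
  have \<phi>: "\<phi> (fin_class A) = gens_equiv G `` {im ` X A}" for A
  proof -
    have "A \<in> fin_class A" by (simp add: mem_fin_class)
    then have "(SOME B. B \<in> fin_class A) \<in> fin_class A" by (rule someI)
    then show ?thesis unfolding \<phi>_def mem_fin_class
      by (intro G.gens_class_eqI gX) (simp_all add: X_le)
  qed
  have \<phi>_le: "gens_class_le G (\<phi> (fin_class A)) (\<phi> (fin_class B)) \<longleftrightarrow> finite (A - B)" for A B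
    unfolding \<phi> G.gens_class_le_iff [OF gX gX] by (rule X_le)
  have empty: "\<phi> (fin_class {}) = c1" unfolding \<phi> X_def mix_empty [OF X1(2)] X1(1) ..
  have univ: "\<phi> (fin_class UNIV) = c2" unfolding \<phi> X_def mix_UNIV [OF X2(2)] X2(1) ..
  have "poset_embedding Pomega_Fin Pomega_Fin_le (thin_cones S R) (gens_class_le G) \<phi>"
    unfolding poset_embedding_def
  proof (intro conjI ballI subsetI)
    fix c assume "c \<in> \<phi> ` Pomega_Fin"
    then obtain A where "c = \<phi> (fin_class A)" by (auto elim: Pomega_Fin_cases)
    then show "c \<in> thin_cones S R"
      unfolding \<phi> X_def using mix_thin_cones [OF X1(2) X2(2) X1(3) X2(3) X1(4) X2(4)] by simp
  next
    fix a b assume "a \<in> Pomega_Fin" "b \<in> Pomega_Fin"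
    then obtain A B where "a = fin_class A" "b = fin_class B" by (metis Pomega_Fin_cases)
    then show "Pomega_Fin_le a b \<longleftrightarrow> gens_class_le G (\<phi> a) (\<phi> b)" by (simp add: Pomega_Fin_le_iff \<phi>_le)
  qed
  moreover have "gens_class_le G c1 (\<phi> (fin_class A)) \<and> gens_class_le G (\<phi> (fin_class A)) c2" for A
    using \<phi>_le [of "{}" A] \<phi>_le [of A UNIV] empty univ by simp
  ultimately show ?thesis using empty univ by blast
qed

end

text \<open>The strict inequality fails for the empty piece in a relator of length 0. So no nonempty
  relator can coexist with the empty one, \<open>S\<close> is empty since each generator occurs in a
  relator, and \<open>{[]}\<close> is the only representative.\<close>

lemma trivial_thin_cones:
  assumes "presentation S R" "small_cancellation (1 / 24) R" "[] \<in> R"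
    and "c1 \<in> thin_cones S R" "c2 \<in> thin_cones S R"
  shows "c1 = c2"
proof -
  have nil: "[] \<in> symmetrized R" using assms(3) symmetrized_self symmetrized_Union by blast
  have sym: "w = []" if w: "w \<in> symmetrized R" for w
  proof (rule ccontr)
    assume "w \<noteq> []"
    then have "is_piece R []" unfolding is_piece_def
      using w nil by (intro bexI [of _ w] bexI [of _ "[]"]) auto
    then show False
      using assms(2) [unfolded small_cancellation_def, rule_format, OF nil, of "[]"] by simp
  qed
  have R: "r = []" if "r \<in> R" for r using sym that symmetrized_self symmetrized_Union by blast
  have "S = {}"
  proof (rule ccontr)
    assume "S \<noteq> {}"
    then obtain s r where "r \<in> R" "s \<in> fst ` set r" using assms(1) unfolding presentation_def by blast
    then show False using R by fastforce
  qed
  then have init: "initial_words S R = {[]}"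
    using nil sym by (fastforce simp: initial_words_def basis_words_def)
  have "[] \<in> four_piece_words S R"
    unfolding four_piece_words_def init
      by (intro CollectI conjI exI [of _ "[]"]) (auto simp: free_group_def)
  then have rep: "image_in_group S R {[]} \<in> c" if "c \<in> thin_cones S R" for c
  proof -
    assume "[] \<in> four_piece_words S R"
    obtain X where "four_piece_words S R \<subseteq> X" "X \<subseteq> initial_words S R" "image_in_group S R X \<in> c"
      using \<open>c \<in> thin_cones S R\<close> unfolding thin_cones_def by blast
    moreover from this have "X = {[]}" using \<open>[] \<in> four_piece_words S R\<close> init by auto
    ultimately show ?thesis by simp
  qed
  have "group (presented_group S R)"
    unfolding presented_group_def using assms(1)
    by (intro normal.factorgroup_is_group normal_normal_closure group_free_group) (simp add:
      presentation_def)
  moreover have "c1 \<in> gens_classes (presented_group S R)" "c2 \<in> gens_classes (presented_group S R)"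
    using assms(4,5) by (simp_all add: thin_cones_def)
  ultimately show ?thesis using group.gens_classes_eq(2) rep [OF assms(4)] rep [OF assms(5)] by metis
qed

theorem proposition6p6:
  fixes S :: "'a set" and R :: "'a word set" and c1 c2 :: "'a word set set set"
  assumes "presentation S R"
    and "small_cancellation (1 / 24) R"
    and "c1 \<in> thin_cones S R" and "c2 \<in> thin_cones S R" and "c1 \<noteq> c2"
    and "gens_class_le (presented_group S R) c1 c2"
  shows "\<exists>\<phi>. poset_embedding Pomega_Fin Pomega_Fin_le
                (thin_cones S R) (gens_class_le (presented_group S R)) \<phi> \<and>
             \<phi> (fin_class {}) = c1 \<and> \<phi> (fin_class UNIV) = c2 \<and>
             (\<forall>A. gens_class_le (presented_group S R) c1 (\<phi> (fin_class A)) \<and>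
                  gens_class_le (presented_group S R) (\<phi> (fin_class A)) c2)"
proof -
  have "[] \<notin> R" using trivial_thin_cones assms by blast
  then interpret small_cancellation_presentation S R
    using assms by unfold_locales
  show ?thesis by (rule thin_cones_interval [OF assms(3-6)])
qed

end
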